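(* There is a sequence of imbeddings (injective maps that are homomorphisms of groups and of $\mathbb{C}$-algebras) $$0\to H^1(\mathbb{Z},C^*_{red}(\mathbb{Z}))\overset{d_1}{\to}H^2(\mathbb{Z}^2,C^*_{red}(\mathbb{Z}^2))\overset{d_2}{\to}H^3(\mathbb{Z}^3,C^*_{red}(\mathbb{Z}^3))\to\cdots,$$ i.e. for every $n\ge 1$ an injective homomorphism $d_n:H^n(\mathbb{Z}^n,C^*_{red}(\mathbb{Z}^n))\to H^{n+1}(\mathbb{Z}^{n+1},C^*_{red}(\mathbb{Z}^{n+1}))$ of groups and $\mathbb{C}$-algebras.
   Context: For a group $G$, $C^*_{red}(G)$ is the completion of the group ring $\mathbb{C}G$ in the operator norm $\|\alpha\|_{op}=\sup\{\|\alpha\cdot\beta\|_2:\beta\in L^2(G),\ \|\beta\|_2=1\}$, where $L^2(G)$ is the Hilbert space of formal sums $\sum_{g\in G}a_g g$ with $\sum_g|a_g|^2<\infty$ and $\mathbb{C}G$ acts by left multiplication; $G$ acts on $C^*_{red}(G)$ by left multiplication. $H^n(G,M)$ denotes usual group cohomology, the $n$-th cohomology of $\mathrm{Hom}_{\mathbb{Z}G}(P_\bullet,M)$ for a projective resolution $P_\bullet$ of the trivial module $\mathbb{Z}$ by $\mathbb{Z}G$-modules. $\mathbb{T}^n=\{(z_1,\dots,z_n)\in\mathbb{C}^n:|z_i|=1\text{ for all }i\}$. $C(\mathbb{T}^n)$ is identified with $C^*_{red}(\mathbb{Z}^n)$ by Fourier transform (the coordinate function $z_i$ corresponds to the $i$-th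 free generator $X_i$ of $\mathbb{Z}^n$), so that $X_1^{e_1}\cdots X_n^{e_n}$ acts on $C(\mathbb{T}^n)$ as multiplication by $z_1^{e_1}\cdots z_n^{e_n}$. The group $H^n(\mathbb{Z}^n,C^*_{red}(\mathbb{Z}^n))$ is identified with the quotient of $C(\mathbb{T}^n)$ by the ideal $(z_1-1)C(\mathbb{T}^n)+\dots+(z_n-1)C(\mathbb{T}^n)$, and its $\mathbb{C}$-algebra structure is that of this quotient. The identification is computed from a free resolution $0\to\mathbb{Z}G\overset{\rho_n}{\to}(\mathbb{Z}G)^n\to\cdots\to\mathbb{Z}\to 0$ ($G=\mathbb{Z}^n$), with first module $\mathbb{Z}G$ in degree $n$ and $\rho_n(1)=(X_1-1,-(X_2-1),\dots,-(X_n-1))$, by sending the class of $\varphi\in\mathrm{Hom}_{\mathbb{Z}G}(\mathbb{Z}G,C(\mathbb{T}^n))$ to the class of $\varphi(1)$. *)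

theory Defs
  imports
    "HOL-Analysis.Analysis"
    "HOL-Algebra.Free_Abelian_Groups"
    "HOL-Algebra.QuotRing"
    "HOL-Algebra.Module"
begin

section \<open>Group rings\<close>

text \<open>For finitely supported \<open>a\<close> this is the product \<open>a \<cdot> b\<close> of formal sums; \<open>b\<close> may have infinite
  support, so the same operation gives the action of the group ring on \<open>L\<^sup>2(G)\<close>.\<close>

definition conv :: "('g, 'x) monoid_scheme \<Rightarrow> ('g \<Rightarrow> 'r::comm_ring_1) \<Rightarrow> ('g \<Rightarrow> 'r) \<Rightarrow> 'g \<Rightarrow> 'r"
  where "conv G a b = (\<lambda>g. if g \<in> carrier G
           then (\<Sum>h | a h \<noteq> 0. a h * b (inv\<^bsub>G\<^esub> h \<otimes>\<^bsub>G\<^esub> g)) else 0)"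

definition group_ring :: "('g, 'x) monoid_scheme \<Rightarrow> ('g \<Rightarrow> 'r::comm_ring_1) ring"
  where "group_ring G =
    \<lparr>carrier = {a. finite {g. a g \<noteq> 0} \<and> {g. a g \<noteq> 0} \<subseteq> carrier G},
     monoid.mult = conv G,
     one = indicator {\<one>\<^bsub>G\<^esub>},
     zero = (\<lambda>_. 0),
     add = (\<lambda>a b g. a g + b g)\<rparr>"

abbreviation int_group_ring :: "('g, 'x) monoid_scheme \<Rightarrow> ('g \<Rightarrow> int) ring"
  where "int_group_ring \<equiv> group_ring"

abbreviation complex_group_ring :: "('g, 'x) monoid_scheme \<Rightarrow> ('g \<Rightarrow> complex) ring"
  where "complex_group_ring \<equiv> group_ring"


section \<open>The reduced group \<open>C\<^sup>*\<close>-algebra\<close>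

definition L2 :: "('g, 'x) monoid_scheme \<Rightarrow> ('g \<Rightarrow> complex) set"
  where "L2 G = {\<beta>. (\<forall>g. g \<notin> carrier G \<longrightarrow> \<beta> g = 0) \<and>
                    (\<lambda>g. (cmod (\<beta> g))\<^sup>2) summable_on carrier G}"

definition L2_norm :: "('g, 'x) monoid_scheme \<Rightarrow> ('g \<Rightarrow> complex) \<Rightarrow> real"
  where "L2_norm G \<beta> = sqrt (\<Sum>\<^sub>\<infinity>g\<in>carrier G. (cmod (\<beta> g))\<^sup>2)"

definition bounded_ops :: "('g, 'x) monoid_scheme \<Rightarrow> (('g \<Rightarrow> complex) \<Rightarrow> 'g \<Rightarrow> complex) set"
  where "bounded_ops G = {T \<in> L2 G \<rightarrow>\<^sub>E L2 G.
     (\<forall>\<beta>\<in>L2 G. \<forall>\<gamma>\<in>L2 G. T (\<lambda>g. \<beta> g + \<gamma> g) = (\<lambda>g. T \<beta> g + T \<gamma> g)) \<and>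
     (\<forall>c. \<forall>\<beta>\<in>L2 G. T (\<lambda>g. c * \<beta> g) = (\<lambda>g. c * T \<beta> g)) \<and>
     (\<exists>C. \<forall>\<beta>\<in>L2 G. L2_norm G (T \<beta>) \<le> C * L2_norm G \<beta>)}"

definition op_norm :: "('g, 'x) monoid_scheme \<Rightarrow> (('g \<Rightarrow> complex) \<Rightarrow> 'g \<Rightarrow> complex) \<Rightarrow> real"
  where "op_norm G T = (SUP \<beta>\<in>{\<beta> \<in> L2 G. L2_norm G \<beta> = 1}. L2_norm G (T \<beta>))"

definition left_mult :: "('g, 'x) monoid_scheme \<Rightarrow> ('g \<Rightarrow> complex) \<Rightarrow> ('g \<Rightarrow> complex) \<Rightarrow> 'g \<Rightarrow> complex"
  where "left_mult G \<alpha> = (\<lambda>\<beta>\<in>L2 G. conv G \<alpha> \<beta>)"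

definition op_dist :: "('g, 'x) monoid_scheme \<Rightarrow> (('g \<Rightarrow> complex) \<Rightarrow> 'g \<Rightarrow> complex)
    \<Rightarrow> (('g \<Rightarrow> complex) \<Rightarrow> 'g \<Rightarrow> complex) \<Rightarrow> real"
  where "op_dist G S T = op_norm G (\<lambda>\<beta>\<in>L2 G. \<lambda>g. S \<beta> g - T \<beta> g)"

text \<open>The completion of \<open>\<complex>G\<close> in the operator norm, realised as the norm closure of the (faithful) image
  of \<open>\<complex>G\<close> in the Banach algebra of bounded operators on \<open>L\<^sup>2(G)\<close>.\<close>

definition cstar_red :: "('g, 'x) monoid_scheme \<Rightarrow> (complex, ('g \<Rightarrow> complex) \<Rightarrow> 'g \<Rightarrow> complex) module"
  where "cstar_red G =
    \<lparr>carrier = {T \<in> bounded_ops G.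
        \<forall>e>0. \<exists>\<alpha>\<in>carrier (complex_group_ring G). op_dist G T (left_mult G \<alpha>) < e},
     monoid.mult = compose (L2 G),
     one = (\<lambda>\<beta>\<in>L2 G. \<beta>),
     zero = (\<lambda>\<beta>\<in>L2 G. \<lambda>g. 0),
     add = (\<lambda>S T. \<lambda>\<beta>\<in>L2 G. \<lambda>g. S \<beta> g + T \<beta> g),
     smult = (\<lambda>c T. \<lambda>\<beta>\<in>L2 G. \<lambda>g. c * T \<beta> g)\<rparr>"

text \<open>The same additive group as a \<open>\<int>G\<close>-module: \<open>G\<close> acts by left multiplication.\<close>

definition cstar_red_module ::
    "('g, 'x) monoid_scheme \<Rightarrow> ('g \<Rightarrow> int, ('g \<Rightarrow> complex) \<Rightarrow> 'g \<Rightarrow> complex) module"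
  where "cstar_red_module G =
    \<lparr>carrier = carrier (cstar_red G),
     monoid.mult = mult (cstar_red G),
     one = one (cstar_red G),
     zero = zero (cstar_red G),
     add = add (cstar_red G),
     smult = (\<lambda>a T. left_mult G (\<lambda>g. of_int (a g)) \<otimes>\<^bsub>cstar_red G\<^esub> T)\<rparr>"


section \<open>Cohomology of \<open>Hom(P, M)\<close>\<close>

definition lin_maps :: "('r, 'x) ring_scheme \<Rightarrow> ('r, 'p, 'y) module_scheme
    \<Rightarrow> ('r, 'm, 'z) module_scheme \<Rightarrow> ('p \<Rightarrow> 'm) set"
  where "lin_maps R P M = {\<phi> \<in> carrier P \<rightarrow>\<^sub>E carrier M.
     (\<forall>x\<in>carrier P. \<forall>y\<in>carrier P. \<phi> (x \<oplus>\<^bsub>P\<^esub> y) = \<phi> x \<oplus>\<^bsub>M\<^esub> \<phi> y) \<and>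
     (\<forall>r\<in>carrier R. \<forall>x\<in>carrier P. \<phi> (r \<odot>\<^bsub>P\<^esub> x) = r \<odot>\<^bsub>M\<^esub> \<phi> x)}"

text \<open>A complex \<open>\<dots> \<rightarrow> P 2 \<rightarrow> P 1 \<rightarrow> P 0\<close> has differentials \<open>d k : P (Suc k) \<rightarrow> P k\<close>.\<close>

definition cocycles :: "('r, 'x) ring_scheme \<Rightarrow> (nat \<Rightarrow> ('r, 'p, 'y) module_scheme) \<Rightarrow> (nat \<Rightarrow> 'p \<Rightarrow> 'p)
    \<Rightarrow> ('r, 'm, 'z) module_scheme \<Rightarrow> nat \<Rightarrow> ('p \<Rightarrow> 'm) monoid"
  where "cocycles R P d M k =
    \<lparr>carrier = {\<phi> \<in> lin_maps R (P k) M. \<forall>x\<in>carrier (P (Suc k)). \<phi> (d k x) = \<zero>\<^bsub>M\<^esub>},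
     monoid.mult = (\<lambda>\<phi> \<psi>. \<lambda>x\<in>carrier (P k). \<phi> x \<oplus>\<^bsub>M\<^esub> \<psi> x),
     one = (\<lambda>x\<in>carrier (P k). \<zero>\<^bsub>M\<^esub>)\<rparr>"

fun coboundaries :: "('r, 'x) ring_scheme \<Rightarrow> (nat \<Rightarrow> ('r, 'p, 'y) module_scheme) \<Rightarrow> (nat \<Rightarrow> 'p \<Rightarrow> 'p)
    \<Rightarrow> ('r, 'm, 'z) module_scheme \<Rightarrow> nat \<Rightarrow> ('p \<Rightarrow> 'm) set"
  where
    "coboundaries R P d M 0 = {\<lambda>x\<in>carrier (P 0). \<zero>\<^bsub>M\<^esub>}"
  | "coboundaries R P d M (Suc k) =
       (\<lambda>\<psi>. compose (carrier (P (Suc k))) \<psi> (d k)) ` lin_maps R (P k) M"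

definition cohomology :: "('r, 'x) ring_scheme \<Rightarrow> (nat \<Rightarrow> ('r, 'p, 'y) module_scheme) \<Rightarrow> (nat \<Rightarrow> 'p \<Rightarrow> 'p)
    \<Rightarrow> ('r, 'm, 'z) module_scheme \<Rightarrow> nat \<Rightarrow> ('p \<Rightarrow> 'm) set monoid"
  where "cohomology R P d M k = cocycles R P d M k Mod coboundaries R P d M k"


section \<open>The group \<open>\<int>\<^sup>n\<close> and the Koszul resolution\<close>

text \<open>The \<open>i\<close>-th free generator, \<open>i < n\<close>, is \<open>frag_of i\<close>; the group operation is addition.\<close>

abbreviation Zn :: "nat \<Rightarrow> (nat \<Rightarrow>\<^sub>0 int) monoid"
  where "Zn n \<equiv> free_Abelian_group {..<n}"

definition gen_minus_one :: "nat \<Rightarrow> (nat \<Rightarrow>\<^sub>0 int) \<Rightarrow> int"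
  where "gen_minus_one i = (\<lambda>g. indicator {frag_of i} g - indicator {0} g)"

text \<open>The free module on a finite set \<open>B\<close>.\<close>

definition free_module :: "('r, 'x) ring_scheme \<Rightarrow> 'b set \<Rightarrow> ('r, 'b \<Rightarrow> 'r) module"
  where "free_module R B =
    \<lparr>carrier = B \<rightarrow>\<^sub>E carrier R,
     monoid.mult = undefined,
     one = undefined,
     zero = (\<lambda>b\<in>B. \<zero>\<^bsub>R\<^esub>),
     add = (\<lambda>v w. \<lambda>b\<in>B. v b \<oplus>\<^bsub>R\<^esub> w b),
     smult = (\<lambda>r v. \<lambda>b\<in>B. r \<otimes>\<^bsub>R\<^esub> v b)\<rparr>"

definition koszul_basis :: "nat \<Rightarrow> nat \<Rightarrow> nat set set"
  where "koszul_basis n k = {S. S \<subseteq> {..<n} \<and> card S = k}"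

definition koszul :: "nat \<Rightarrow> nat \<Rightarrow> ((nat \<Rightarrow>\<^sub>0 int) \<Rightarrow> int, nat set \<Rightarrow> (nat \<Rightarrow>\<^sub>0 int) \<Rightarrow> int) module"
  where "koszul n k = free_module (int_group_ring (Zn n)) (koszul_basis n k)"

text \<open>On basis elements: \<open>e\<^sub>S \<mapsto> \<Sum>i\<in>S. (-1) ^ card {j \<in> S. j < i} (X\<^sub>i - 1) e\<^sub>S\<^sub>-\<^sub>{\<^sub>i\<^sub>}\<close>.  In the top degree the
  source is \<open>\<int>G\<close> (one basis element), and \<open>1\<close> goes to the family of the \<open>\<plusminus>(X\<^sub>i - 1)\<close>; the signs depend
  only on the choice of the basis of \<open>(\<int>G)\<^sup>n\<close>.  That this is a resolution of \<open>\<int>\<close> by free modules is proved at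
  the end of this theory.\<close>

definition koszul_diff :: "nat \<Rightarrow> nat \<Rightarrow> (nat set \<Rightarrow> (nat \<Rightarrow>\<^sub>0 int) \<Rightarrow> int) \<Rightarrow> nat set \<Rightarrow> (nat \<Rightarrow>\<^sub>0 int) \<Rightarrow> int"
  where "koszul_diff n k = (\<lambda>v\<in>carrier (koszul n (Suc k)). \<lambda>T\<in>koszul_basis n k. \<lambda>g.
           \<Sum>i\<in>{..<n} - T. (-1) ^ card {j \<in> T. j < i} * conv (Zn n) (gen_minus_one i) (v (insert i T)) g)"

definition koszul_top :: "nat \<Rightarrow> nat set \<Rightarrow> (nat \<Rightarrow>\<^sub>0 int) \<Rightarrow> int"
  where "koszul_top n = (\<lambda>S\<in>koszul_basis n n. \<one>\<^bsub>int_group_ring (Zn n)\<^esub>)"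


section \<open>\<open>C(\<T>\<^sup>n)\<close> and the Fourier transform\<close>

text \<open>Continuity on \<open>torus n\<close> refers to the product topology of \<^typ>\<open>nat \<Rightarrow> complex\<close>; the coordinates
  outside \<open>{..<n}\<close> are frozen at \<^term>\<open>undefined\<close>.\<close>

definition torus :: "nat \<Rightarrow> (nat \<Rightarrow> complex) set"
  where "torus n = {..<n} \<rightarrow>\<^sub>E {z. cmod z = 1}"

definition torus_functions :: "nat \<Rightarrow> ((nat \<Rightarrow> complex) \<Rightarrow> complex) ring"
  where "torus_functions n =
    \<lparr>carrier = {f \<in> extensional (torus n). continuous_on (torus n) f},
     monoid.mult = (\<lambda>f h. \<lambda>z\<in>torus n. f z * h z),
     one = (\<lambda>z\<in>torus n. 1),
     zero = (\<lambda>z\<in>torus n. 0),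
     add = (\<lambda>f h. \<lambda>z\<in>torus n. f z + h z)\<rparr>"

text \<open>\<open>\<Sum>\<^sub>g \<alpha>\<^sub>g z\<^sub>1\<^bsup>g\<^sub>1\<^esup> \<cdots> z\<^sub>n\<^bsup>g\<^sub>n\<^esup>\<close> for \<open>\<alpha> \<in> \<complex>[\<int>\<^sup>n]\<close>\<close>

definition laurent_eval :: "nat \<Rightarrow> ((nat \<Rightarrow>\<^sub>0 int) \<Rightarrow> complex) \<Rightarrow> (nat \<Rightarrow> complex) \<Rightarrow> complex"
  where "laurent_eval n \<alpha> z =
    (\<Sum>g | \<alpha> g \<noteq> 0. \<alpha> g * (\<Prod>i<n. z i powi Poly_Mapping.lookup g i))"

text \<open>The Fourier transform \<open>C\<^sup>*\<^sub>r\<^sub>e\<^sub>d(\<int>\<^sup>n) \<rightarrow> C(\<T>\<^sup>n)\<close>: the extension of \<^const>\<open>laurent_eval\<close> by continuity from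
  the operator norm to the supremum norm.\<close>

definition fourier :: "nat \<Rightarrow> (((nat \<Rightarrow>\<^sub>0 int) \<Rightarrow> complex) \<Rightarrow> (nat \<Rightarrow>\<^sub>0 int) \<Rightarrow> complex)
    \<Rightarrow> (nat \<Rightarrow> complex) \<Rightarrow> complex"
  where "fourier n T = (THE f. f \<in> carrier (torus_functions n) \<and>
     (\<forall>e>0. \<exists>\<alpha>\<in>carrier (complex_group_ring (Zn n)).
        op_dist (Zn n) T (left_mult (Zn n) \<alpha>) < e \<and>
        (\<forall>z\<in>torus n. cmod (f z - laurent_eval n \<alpha> z) < e)))"

definition torus_ideal :: "nat \<Rightarrow> ((nat \<Rightarrow> complex) \<Rightarrow> complex) set"
  where "torus_ideal n = {\<lambda>z\<in>torus n. \<Sum>i<n. (z i - 1) * f i z | f.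
           \<forall>i<n. f i \<in> carrier (torus_functions n)}"

abbreviation torus_quotient :: "nat \<Rightarrow> ((nat \<Rightarrow> complex) \<Rightarrow> complex) set ring"
  where "torus_quotient n \<equiv> torus_functions n Quot torus_ideal n"

definition torus_class :: "nat \<Rightarrow> ((nat \<Rightarrow> complex) \<Rightarrow> complex) \<Rightarrow> ((nat \<Rightarrow> complex) \<Rightarrow> complex) set"
  where "torus_class n f = torus_ideal n +>\<^bsub>torus_functions n\<^esub> f"


section \<open>The \<open>\<complex>\<close>-algebra \<open>H\<^sup>n(\<int>\<^sup>n, C\<^sup>*\<^sub>r\<^sub>e\<^sub>d(\<int>\<^sup>n))\<close>\<close>

type_synonym zn_cochain =
  "(nat set \<Rightarrow> (nat \<Rightarrow>\<^sub>0 int) \<Rightarrow> int) \<Rightarrow> ((nat \<Rightarrow>\<^sub>0 int) \<Rightarrow> complex) \<Rightarrow> (nat \<Rightarrow>\<^sub>0 int) \<Rightarrow> complex"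

definition zn_cohomology :: "nat \<Rightarrow> zn_cochain set monoid"
  where "zn_cohomology n =
    cohomology (int_group_ring (Zn n)) (koszul n) (koszul_diff n) (cstar_red_module (Zn n)) n"

text \<open>The identification with the quotient of \<open>C(\<T>\<^sup>n)\<close>, induced by \<open>\<phi> \<mapsto> \<phi>(1)\<close>.\<close>

definition zn_ident :: "nat \<Rightarrow> zn_cochain set \<Rightarrow> ((nat \<Rightarrow> complex) \<Rightarrow> complex) set"
  where "zn_ident n x = the_elem ((\<lambda>\<phi>. torus_class n (fourier n (\<phi> (koszul_top n)))) ` x)"

abbreviation zn_ident_inv :: "nat \<Rightarrow> ((nat \<Rightarrow> complex) \<Rightarrow> complex) set \<Rightarrow> zn_cochain set"
  where "zn_ident_inv n \<equiv> inv_into (carrier (zn_cohomology n)) (zn_ident n)"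

text \<open>Addition is that of the cohomology group; the remaining structure is transported along
  \<^const>\<open>zn_ident\<close>.\<close>

definition zn_algebra :: "nat \<Rightarrow> (complex, zn_cochain set) module"
  where "zn_algebra n =
    \<lparr>carrier = carrier (zn_cohomology n),
     monoid.mult = (\<lambda>x y. zn_ident_inv n (zn_ident n x \<otimes>\<^bsub>torus_quotient n\<^esub> zn_ident n y)),
     one = zn_ident_inv n \<one>\<^bsub>torus_quotient n\<^esub>,
     zero = \<one>\<^bsub>zn_cohomology n\<^esub>,
     add = (\<lambda>x y. x \<otimes>\<^bsub>zn_cohomology n\<^esub> y),
     smult = (\<lambda>c x. zn_ident_inv n
       (torus_class n (\<lambda>z\<in>torus n. c) \<otimes>\<^bsub>torus_quotient n\<^esub> zn_ident n x))\<rparr>"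

text \<open>Homomorphisms of (unital) \<open>\<complex>\<close>-algebras; \<^const>\<open>ring_hom\<close> includes additivity.\<close>

definition complex_algebra_hom ::
    "(complex, 'a, 'x) module_scheme \<Rightarrow> (complex, 'b, 'y) module_scheme \<Rightarrow> ('a \<Rightarrow> 'b) set"
  where "complex_algebra_hom A B =
    {h \<in> ring_hom A B. \<forall>c. \<forall>x\<in>carrier A. h (c \<odot>\<^bsub>A\<^esub> x) = c \<odot>\<^bsub>B\<^esub> h x}"


section \<open>Group rings and free modules are what they should be\<close>

lemma (in group) conv_alt:
  fixes a b :: "'a \<Rightarrow> 'r::comm_ring_1"
  assumes A: "finite A" "A \<subseteq> carrier G" "{g. a g \<noteq> 0} \<subseteq> A"
    and B: "finite B" "B \<subseteq> carrier G" "{g. b g \<noteq> 0} \<subseteq> B"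
  shows "conv G a b g = (\<Sum>h\<in>A. \<Sum>k\<in>B. if h \<otimes> k = g then a h * b k else 0)"
proof (cases "g \<in> carrier G")
  case True
  have b0: "b k = 0" if "k \<notin> B" for k using that B(3) by blast
  have "conv G a b g = (\<Sum>h\<in>A. a h * b (inv h \<otimes> g))"
    unfolding conv_def using True A by (auto intro!: sum.mono_neutral_left)
  also have "\<dots> = (\<Sum>h\<in>A. \<Sum>k\<in>B. if h \<otimes> k = g then a h * b k else 0)"
  proof (rule sum.cong [OF refl])
    fix h assume h: "h \<in> A"
    then have hc: "h \<in> carrier G" using A by auto
    have "(\<Sum>k\<in>B. if h \<otimes> k = g then a h * b k else 0) = (\<Sum>k\<in>B. if k = inv h \<otimes> g then a h * b k else 0)"
    proof (rule sum.cong [OF refl])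
      fix k assume "k \<in> B"
      then have "k \<in> carrier G" using B by auto
      then have "h \<otimes> k = g \<longleftrightarrow> k = inv h \<otimes> g"
        using hc True by (metis inv_solve_left)
      then show "(if h \<otimes> k = g then a h * b k else 0) = (if k = inv h \<otimes> g then a h * b k else 0)"
        by simp
    qed
    also have "\<dots> = a h * b (inv h \<otimes> g)"
      using B(1) b0 by (simp add: sum.delta)
    finally show "a h * b (inv h \<otimes> g) = (\<Sum>k\<in>B. if h \<otimes> k = g then a h * b k else 0)" by simp
  qed
  finally show ?thesis .
next
  case False
  have "h \<otimes> k \<noteq> g" if "h \<in> A" "k \<in> B" for h k
    using that A B False by blast
  then show ?thesis using False by (simp add: conv_def)
qed

lemma (in group) conv_closed:
  fixes a b :: "'a \<Rightarrow> 'r::comm_ring_1"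
  assumes a: "finite {g. a g \<noteq> 0}" "{g. a g \<noteq> 0} \<subseteq> carrier G"
    and b: "finite {g. b g \<noteq> 0}" "{g. b g \<noteq> 0} \<subseteq> carrier G"
  shows "{g. conv G a b g \<noteq> 0} \<subseteq> (\<lambda>(h, k). h \<otimes> k) ` ({g. a g \<noteq> 0} \<times> {g. b g \<noteq> 0})"
proof
  fix g assume "g \<in> {g. conv G a b g \<noteq> 0}"
  then have "(\<Sum>h\<in>{g. a g \<noteq> 0}. \<Sum>k\<in>{g. b g \<noteq> 0}. if h \<otimes> k = g then a h * b k else 0) \<noteq> 0"
    using conv_alt [OF a(1,2) order_refl b(1,2) order_refl] by simp
  then obtain h where h: "h \<in> {g. a g \<noteq> 0}"
      "(\<Sum>k\<in>{g. b g \<noteq> 0}. if h \<otimes> k = g then a h * b k else 0) \<noteq> 0"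
    by (rule sum.not_neutral_contains_not_neutral)
  from h(2) obtain k where k: "k \<in> {g. b g \<noteq> 0}" "(if h \<otimes> k = g then a h * b k else 0) \<noteq> 0"
    by (rule sum.not_neutral_contains_not_neutral)
  from h(1) k show "g \<in> (\<lambda>(h, k). h \<otimes> k) ` ({g. a g \<noteq> 0} \<times> {g. b g \<noteq> 0})"
    by (force split: if_splits)
qed

lemma (in group) conv_assoc:
  fixes a b c :: "'a \<Rightarrow> 'r::comm_ring_1"
  assumes a: "finite {g. a g \<noteq> 0}" "{g. a g \<noteq> 0} \<subseteq> carrier G"
    and b: "finite {g. b g \<noteq> 0}" "{g. b g \<noteq> 0} \<subseteq> carrier G"
    and c: "finite {g. c g \<noteq> 0}" "{g. c g \<noteq> 0} \<subseteq> carrier G"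
  shows "conv G (conv G a b) c = conv G a (conv G b c)"
proof
  fix g
  let ?A = "{g. a g \<noteq> 0}" and ?B = "{g. b g \<noteq> 0}" and ?C = "{g. c g \<noteq> 0}"
  let ?AB = "(\<lambda>(h, k). h \<otimes> k) ` (?A \<times> ?B)" and ?BC = "(\<lambda>(h, k). h \<otimes> k) ` (?B \<times> ?C)"
  have AB: "finite ?AB" "?AB \<subseteq> carrier G" "{g. conv G a b g \<noteq> 0} \<subseteq> ?AB"
    using a b conv_closed [OF a b] by (auto)
  have BC: "finite ?BC" "?BC \<subseteq> carrier G" "{g. conv G b c g \<noteq> 0} \<subseteq> ?BC"
    using b c conv_closed [OF b c] by (auto)
  have "conv G (conv G a b) c g =
      (\<Sum>p\<in>?AB. \<Sum>k\<in>?C. if p \<otimes> k = g then conv G a b p * c k else 0)"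
    by (rule conv_alt [OF AB c order_refl])
  also have "\<dots> = (\<Sum>p\<in>?AB. \<Sum>k\<in>?C. \<Sum>h\<in>?A. \<Sum>l\<in>?B.
      if h \<otimes> l = p \<and> p \<otimes> k = g then a h * b l * c k else 0)"
    by (intro sum.cong refl) (auto simp: conv_alt [OF a order_refl b order_refl] sum_distrib_right intro!: sum.cong)
  also have "\<dots> = (\<Sum>k\<in>?C. \<Sum>h\<in>?A. \<Sum>l\<in>?B. \<Sum>p\<in>?AB.
      if h \<otimes> l = p \<and> p \<otimes> k = g then a h * b l * c k else 0)"
    by (subst sum.swap, rule sum.cong [OF refl], subst sum.swap, rule sum.cong [OF refl], rule sum.swap)
  also have "\<dots> = (\<Sum>k\<in>?C. \<Sum>h\<in>?A. \<Sum>l\<in>?B. if h \<otimes> l \<otimes> k = g then a h * b l * c k else 0)"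
  proof (intro sum.cong refl)
    fix k h l assume kl: "k \<in> ?C" "h \<in> ?A" "l \<in> ?B"
    have "(\<Sum>p\<in>?AB. if h \<otimes> l = p \<and> p \<otimes> k = g then a h * b l * c k else 0)
        = (\<Sum>p\<in>?AB. if p = h \<otimes> l then (if h \<otimes> l \<otimes> k = g then a h * b l * c k else 0) else 0)"
      by (rule sum.cong) auto
    also have "\<dots> = (if h \<otimes> l \<otimes> k = g then a h * b l * c k else 0)"
      using kl AB(1) by (subst sum.delta) auto
    finally show "(\<Sum>p\<in>?AB. if h \<otimes> l = p \<and> p \<otimes> k = g then a h * b l * c k else 0)
       = (if h \<otimes> l \<otimes> k = g then a h * b l * c k else 0)" .
  qed
  finally have L: "conv G (conv G a b) c g =
    (\<Sum>k\<in>?C. \<Sum>h\<in>?A. \<Sum>l\<in>?B. if h \<otimes> l \<otimes> k = g then a h * b l * c k else 0)" .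
  have "conv G a (conv G b c) g =
      (\<Sum>h\<in>?A. \<Sum>p\<in>?BC. if h \<otimes> p = g then a h * conv G b c p else 0)"
    by (rule conv_alt [OF a order_refl BC])
  also have "\<dots> = (\<Sum>h\<in>?A. \<Sum>p\<in>?BC. \<Sum>l\<in>?B. \<Sum>k\<in>?C.
      if l \<otimes> k = p \<and> h \<otimes> p = g then a h * b l * c k else 0)"
    by (intro sum.cong refl)
      (auto simp: conv_alt [OF b order_refl c order_refl] sum_distrib_left mult.assoc intro!: sum.cong)
  also have "\<dots> = (\<Sum>h\<in>?A. \<Sum>l\<in>?B. \<Sum>k\<in>?C. \<Sum>p\<in>?BC.
      if l \<otimes> k = p \<and> h \<otimes> p = g then a h * b l * c k else 0)"
    by (rule sum.cong [OF refl], subst sum.swap, rule sum.cong [OF refl], rule sum.swap)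
  also have "\<dots> = (\<Sum>h\<in>?A. \<Sum>l\<in>?B. \<Sum>k\<in>?C. if h \<otimes> l \<otimes> k = g then a h * b l * c k else 0)"
  proof (intro sum.cong refl)
    fix k h l assume kl: "k \<in> ?C" "h \<in> ?A" "l \<in> ?B"
    then have e: "h \<otimes> (l \<otimes> k) = h \<otimes> l \<otimes> k"
      using a b c by (intro m_assoc [symmetric]) auto
    have "(\<Sum>p\<in>?BC. if l \<otimes> k = p \<and> h \<otimes> p = g then a h * b l * c k else 0)
        = (\<Sum>p\<in>?BC. if p = l \<otimes> k then (if h \<otimes> l \<otimes> k = g then a h * b l * c k else 0) else 0)"
      by (rule sum.cong) (auto simp: e)
    also have "\<dots> = (if h \<otimes> l \<otimes> k = g then a h * b l * c k else 0)"
      using kl BC(1) by (subst sum.delta) auto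
    finally show "(\<Sum>p\<in>?BC. if l \<otimes> k = p \<and> h \<otimes> p = g then a h * b l * c k else 0)
       = (if h \<otimes> l \<otimes> k = g then a h * b l * c k else 0)" .
  qed
  also have "\<dots> = (\<Sum>h\<in>?A. \<Sum>k\<in>?C. \<Sum>l\<in>?B. if h \<otimes> l \<otimes> k = g then a h * b l * c k else 0)"
    by (rule sum.cong [OF refl], rule sum.swap)
  also have "\<dots> = (\<Sum>k\<in>?C. \<Sum>h\<in>?A. \<Sum>l\<in>?B. if h \<otimes> l \<otimes> k = g then a h * b l * c k else 0)"
    by (rule sum.swap)
  finally show "conv G (conv G a b) c g = conv G a (conv G b c) g" using L by simp
qed

lemma conv_add_right:
  "conv G a (\<lambda>g. b g + c g) g = conv G a b g + conv G a c g"
  by (simp add: conv_def distrib_left sum.distrib)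

lemma (in comm_group) conv_comm:
  fixes a b :: "'a \<Rightarrow> 'r::comm_ring_1"
  assumes a: "finite {g. a g \<noteq> 0}" "{g. a g \<noteq> 0} \<subseteq> carrier G"
    and b: "finite {g. b g \<noteq> 0}" "{g. b g \<noteq> 0} \<subseteq> carrier G"
  shows "conv G a b = conv G b a"
proof
  fix g
  show "conv G a b g = conv G b a g"
    unfolding conv_alt [OF a order_refl b order_refl] conv_alt [OF b order_refl a order_refl]
    using a b by (subst sum.swap) (auto intro!: sum.cong simp: m_comm subset_iff mult.commute)
qed

theorem (in comm_group) group_ring_cring: "cring (group_ring G :: ('a \<Rightarrow> 'r::comm_ring_1) ring)"
proof -
  let ?R = "group_ring G :: ('a \<Rightarrow> 'r) ring"
  note defs = group_ring_def
  have closed: "conv G a b \<in> carrier ?R" if "a \<in> carrier ?R" "b \<in> carrier ?R" for a b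
  proof -
    have "finite {g. a g \<noteq> 0}" "{g. a g \<noteq> 0} \<subseteq> carrier G" "finite {g. b g \<noteq> 0}" "{g. b g \<noteq> 0} \<subseteq> carrier G"
      using that by (auto simp: defs)
    note f = this
    have "{g. conv G a b g \<noteq> 0} \<subseteq> carrier G"
      using f by (intro order_trans [OF conv_closed [OF f]]) auto
    moreover have "finite {g. conv G a b g \<noteq> 0}"
      using f by (intro finite_subset [OF conv_closed [OF f]]) auto
    ultimately show ?thesis by (simp add: defs)
  qed
  have one: "conv G \<one>\<^bsub>?R\<^esub> a = a" if "a \<in> carrier ?R" for a
  proof
    fix g
    have "{h. indicator {\<one>} h \<noteq> (0::'r)} = {\<one>}" by (auto simp: indicator_def)
    then show "conv G \<one>\<^bsub>?R\<^esub> a g = a g"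
      using that by (auto simp: defs conv_def)
  qed
  have comm: "conv G a b = conv G b a" if "a \<in> carrier ?R" "b \<in> carrier ?R" for a b
    using conv_comm that by (auto simp: defs)
  have add_mem: "(\<lambda>g. a g + b g) \<in> carrier ?R" if "a \<in> carrier ?R" "b \<in> carrier ?R" for a b
  proof -
    have "{g. a g + b g \<noteq> 0} \<subseteq> {g. a g \<noteq> 0} \<union> {g. b g \<noteq> 0}" by auto
    moreover have "finite ({g. a g \<noteq> 0} \<union> {g. b g \<noteq> 0})" "{g. a g \<noteq> 0} \<union> {g. b g \<noteq> 0} \<subseteq> carrier G"
      using that by (auto simp: defs)
    ultimately show ?thesis
      unfolding defs by (auto intro: finite_subset)
  qed
  have one_mem: "\<one>\<^bsub>?R\<^esub> \<in> carrier ?R"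
    by (auto simp: defs indicator_def)
  show ?thesis
  proof (rule cringI)
    show "abelian_group ?R"
    proof (rule abelian_groupI)
      fix x assume "x \<in> carrier ?R"
      then show "\<exists>y\<in>carrier ?R. y \<oplus>\<^bsub>?R\<^esub> x = \<zero>\<^bsub>?R\<^esub>"
        by (intro bexI [of _ "\<lambda>g. - x g"]) (auto simp: defs)
    next
      fix x y assume "x \<in> carrier ?R" "y \<in> carrier ?R"
      then show "x \<oplus>\<^bsub>?R\<^esub> y \<in> carrier ?R"
        using add_mem by (simp add: defs)
    qed (auto simp: defs add.commute add.assoc)
    show "Group.comm_monoid ?R"
    proof (rule comm_monoidI)
      show "x \<otimes>\<^bsub>?R\<^esub> y \<otimes>\<^bsub>?R\<^esub> z = x \<otimes>\<^bsub>?R\<^esub> (y \<otimes>\<^bsub>?R\<^esub> z)"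
        if "x \<in> carrier ?R" "y \<in> carrier ?R" "z \<in> carrier ?R" for x y z
        using that conv_assoc by (auto simp: defs)
      show "x \<otimes>\<^bsub>?R\<^esub> y \<in> carrier ?R" if "x \<in> carrier ?R" "y \<in> carrier ?R" for x y
        using closed [OF that] by (simp add: defs)
      show "\<one>\<^bsub>?R\<^esub> \<otimes>\<^bsub>?R\<^esub> x = x" if "x \<in> carrier ?R" for x
        using one [OF that] by (simp add: defs)
      show "x \<otimes>\<^bsub>?R\<^esub> y = y \<otimes>\<^bsub>?R\<^esub> x" if "x \<in> carrier ?R" "y \<in> carrier ?R" for x y
        using comm [OF that] by (simp add: defs)
    qed (rule one_mem)
    show "(x \<oplus>\<^bsub>?R\<^esub> y) \<otimes>\<^bsub>?R\<^esub> z = x \<otimes>\<^bsub>?R\<^esub> z \<oplus>\<^bsub>?R\<^esub> y \<otimes>\<^bsub>?R\<^esub> z"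
      if "x \<in> carrier ?R" "y \<in> carrier ?R" "z \<in> carrier ?R" for x y z
    proof -
      have s: "(\<lambda>g. x g + y g) \<in> carrier ?R"
        using that add_mem by blast
      have "conv G (\<lambda>g. x g + y g) z = (\<lambda>g. conv G x z g + conv G y z g)"
        unfolding comm [OF s that(3)] comm [OF that(1,3)] comm [OF that(2,3)]
        by (rule ext) (rule conv_add_right)
      then show ?thesis by (simp add: defs)
    qed
  qed
qed

lemma free_module_module:
  fixes R (structure)
  assumes "cring R" shows "module R (free_module R B)"
proof -
  interpret cring R by fact
  let ?F = "free_module R B"
  have eqI: "v = w" if "v \<in> carrier ?F" "w \<in> carrier ?F" "\<And>b. b \<in> B \<Longrightarrow> v b = w b" for v w
    using that unfolding free_module_def by (auto intro: PiE_ext)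
  have mem: "v b \<in> carrier R" if "v \<in> carrier ?F" "b \<in> B" for v b
    using that by (auto simp: free_module_def)
  have add_mem: "v \<oplus>\<^bsub>?F\<^esub> w \<in> carrier ?F" if "v \<in> carrier ?F" "w \<in> carrier ?F" for v w
    using that mem by (auto simp: free_module_def)
  have smult_mem: "r \<odot>\<^bsub>?F\<^esub> w \<in> carrier ?F" if "r \<in> carrier R" "w \<in> carrier ?F" for r w
    using that mem by (auto simp: free_module_def)
  have zero_mem: "\<zero>\<^bsub>?F\<^esub> \<in> carrier ?F"
    by (auto simp: free_module_def)
  have add: "(v \<oplus>\<^bsub>?F\<^esub> w) b = v b \<oplus> w b" and smult: "(r \<odot>\<^bsub>?F\<^esub> w) b = r \<otimes> w b"
    and zero: "\<zero>\<^bsub>?F\<^esub> b = \<zero>" if "b \<in> B" for v w r b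
    using that by (simp_all add: free_module_def)
  show ?thesis
  proof (rule moduleI [OF assms])
    show "abelian_group ?F"
    proof (rule abelian_groupI)
      fix x assume x: "x \<in> carrier ?F"
      have y: "(\<lambda>b\<in>B. \<ominus> x b) \<in> carrier ?F"
        using mem [OF x] by (auto simp: free_module_def)
      show "\<exists>y\<in>carrier ?F. y \<oplus>\<^bsub>?F\<^esub> x = \<zero>\<^bsub>?F\<^esub>"
        by (intro bexI [OF eqI y] add_mem y x zero_mem) (simp add: add zero mem [OF x] l_neg)
    next
      show "x \<oplus>\<^bsub>?F\<^esub> y \<oplus>\<^bsub>?F\<^esub> z = x \<oplus>\<^bsub>?F\<^esub> (y \<oplus>\<^bsub>?F\<^esub> z)"
        if "x \<in> carrier ?F" "y \<in> carrier ?F" "z \<in> carrier ?F" for x y z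
        by (intro eqI add_mem that) (simp add: add a_assoc mem that)
      show "x \<oplus>\<^bsub>?F\<^esub> y = y \<oplus>\<^bsub>?F\<^esub> x" if "x \<in> carrier ?F" "y \<in> carrier ?F" for x y
        by (intro eqI add_mem that) (simp add: add a_comm mem that)
      show "\<zero>\<^bsub>?F\<^esub> \<oplus>\<^bsub>?F\<^esub> x = x" if "x \<in> carrier ?F" for x
        by (intro eqI add_mem zero_mem that) (simp add: add zero mem that)
    qed (fact add_mem zero_mem)+
    show "(a \<oplus> b) \<odot>\<^bsub>?F\<^esub> x = a \<odot>\<^bsub>?F\<^esub> x \<oplus>\<^bsub>?F\<^esub> b \<odot>\<^bsub>?F\<^esub> x"
      if "a \<in> carrier R" "b \<in> carrier R" "x \<in> carrier ?F" for a b x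
      by (intro eqI add_mem smult_mem a_closed that) (simp add: add smult mem l_distr that)
    show "a \<odot>\<^bsub>?F\<^esub> (x \<oplus>\<^bsub>?F\<^esub> y) = a \<odot>\<^bsub>?F\<^esub> x \<oplus>\<^bsub>?F\<^esub> a \<odot>\<^bsub>?F\<^esub> y"
      if "a \<in> carrier R" "x \<in> carrier ?F" "y \<in> carrier ?F" for a x y
      by (intro eqI add_mem smult_mem that) (simp add: add smult mem r_distr that)
    show "(a \<otimes> b) \<odot>\<^bsub>?F\<^esub> x = a \<odot>\<^bsub>?F\<^esub> (b \<odot>\<^bsub>?F\<^esub> x)"
      if "a \<in> carrier R" "b \<in> carrier R" "x \<in> carrier ?F" for a b x
      by (intro eqI smult_mem m_closed that) (simp add: smult mem m_assoc that)
    show "\<one> \<odot>\<^bsub>?F\<^esub> x = x" if "x \<in> carrier ?F" for x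
      by (intro eqI smult_mem that one_closed) (simp add: smult mem that)
  qed (fact smult_mem)
qed


section \<open>The Koszul complex is a free resolution of \<open>\<int>\<close>\<close>

definition shift_diff :: "nat \<Rightarrow> ((nat \<Rightarrow>\<^sub>0 int) \<Rightarrow> int) \<Rightarrow> (nat \<Rightarrow>\<^sub>0 int) \<Rightarrow> int"
  where "shift_diff i a = (\<lambda>g. a (g - frag_of i) - a g)"

definition kd :: "nat \<Rightarrow> (nat set \<Rightarrow> (nat \<Rightarrow>\<^sub>0 int) \<Rightarrow> int) \<Rightarrow> nat set \<Rightarrow> (nat \<Rightarrow>\<^sub>0 int) \<Rightarrow> int"
  where "kd m v T = (\<lambda>g. \<Sum>i\<in>{..<m} - T. (-1) ^ card {j \<in> T. j < i} * shift_diff i (v (insert i T)) g)"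

abbreviation zg :: "nat \<Rightarrow> ((nat \<Rightarrow>\<^sub>0 int) \<Rightarrow> int) set"
  where "zg n \<equiv> carrier (int_group_ring (Zn n))"

lemma zg_iff: "a \<in> zg n \<longleftrightarrow> finite {g. a g \<noteq> 0} \<and> (\<forall>g. a g \<noteq> 0 \<longrightarrow> Poly_Mapping.keys g \<subseteq> {..<n})"
  unfolding group_ring_def by (auto simp: subset_iff)

lemma keys_shift:
  assumes "i < n"
  shows "Poly_Mapping.keys (g - frag_of i) \<subseteq> {..<n} \<longleftrightarrow> Poly_Mapping.keys g \<subseteq> {..<n}"
proof -
  have *: "Poly_Mapping.keys (frag_of i) \<subseteq> {..<n}" using assms by simp
  show ?thesis
    using keys_diff [of g "frag_of i"] Poly_Mapping.keys_add [of "g - frag_of i" "frag_of i"] *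
    by auto
qed

lemma finite_support_add:
  fixes a b :: "'g \<Rightarrow> 'r::comm_ring_1"
  shows "finite {g. a g \<noteq> 0} \<Longrightarrow> finite {g. b g \<noteq> 0} \<Longrightarrow> finite {g. a g + b g \<noteq> 0}"
  by (rule finite_subset [of _ "{g. a g \<noteq> 0} \<union> {g. b g \<noteq> 0}"]) auto

lemma zg_add: "a \<in> zg n \<Longrightarrow> b \<in> zg n \<Longrightarrow> (\<lambda>g. a g + b g) \<in> zg n"
  unfolding zg_iff by (metis (mono_tags, lifting) add.right_neutral finite_support_add)

lemma zg_uminus: "a \<in> zg n \<Longrightarrow> (\<lambda>g. - a g) \<in> zg n"
  by (auto simp: zg_iff)

lemma zg_scale: "a \<in> zg n \<Longrightarrow> (\<lambda>g. c * a g) \<in> zg n"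
  by (auto simp: zg_iff)

lemma zg_diff: "a \<in> zg n \<Longrightarrow> b \<in> zg n \<Longrightarrow> (\<lambda>g. a g - b g) \<in> zg n"
  using zg_add [OF _ zg_uminus, of a n b] by simp

lemma zg_zero: "(\<lambda>g. 0) \<in> zg n"
  by (auto simp: zg_iff)

lemma zg_sum: "(\<And>i. i \<in> I \<Longrightarrow> a i \<in> zg n) \<Longrightarrow> (\<lambda>g. \<Sum>i\<in>I. a i g) \<in> zg n"
  by (induction I rule: infinite_finite_induct) (auto simp: zg_zero intro: zg_add)

lemma finite_support_shift:
  fixes a :: "(nat \<Rightarrow>\<^sub>0 int) \<Rightarrow> int"
  assumes "finite {g. a g \<noteq> 0}" shows "finite {g. a (g - h) \<noteq> 0}"
proof -
  have "{g. a (g - h) \<noteq> 0} = (\<lambda>g. g + h) ` {g. a g \<noteq> 0}"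
    by (auto simp: image_iff) (metis diff_add_cancel)
  then show ?thesis using assms by simp
qed

lemma zg_shift: "i < n \<Longrightarrow> a \<in> zg n \<Longrightarrow> (\<lambda>g. a (g - frag_of i)) \<in> zg n"
  using keys_shift [of i n] finite_support_shift [of a "frag_of i"] unfolding zg_iff by auto

lemma zg_shift_diff: "i < n \<Longrightarrow> a \<in> zg n \<Longrightarrow> shift_diff i a \<in> zg n"
  unfolding shift_diff_def by (intro zg_diff zg_shift)

lemma conv_gen_minus_one:
  assumes "i < n" "a \<in> zg n"
  shows "conv (Zn n) (gen_minus_one i) a = shift_diff i a"
proof
  fix g :: "nat \<Rightarrow>\<^sub>0 int"
  have ne: "frag_of i \<noteq> (0 :: nat \<Rightarrow>\<^sub>0 int)" by (simp add: frag_of_nonzero)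
  have supp: "{h. gen_minus_one i h \<noteq> 0} = {frag_of i, 0}"
    using ne by (auto simp: gen_minus_one_def indicator_def)
  show "conv (Zn n) (gen_minus_one i) a g = shift_diff i a g"
  proof (cases "Poly_Mapping.keys g \<subseteq> {..<n}")
    case True
    have "conv (Zn n) (gen_minus_one i) a g =
        (\<Sum>h\<in>{frag_of i, 0}. gen_minus_one i h * a (inv\<^bsub>Zn n\<^esub> h + g))"
      using True by (simp add: conv_def supp)
    also have "\<dots> = gen_minus_one i (frag_of i) * a (inv\<^bsub>Zn n\<^esub> (frag_of i) + g)
        + gen_minus_one i 0 * a (inv\<^bsub>Zn n\<^esub> 0 + g)"
      using ne by simp
    also have "\<dots> = shift_diff i a g"
      using ne assms(1) by (simp add: gen_minus_one_def shift_diff_def)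
    finally show ?thesis .
  next
    case False
    then have "a g = 0" "a (g - frag_of i) = 0"
      using assms keys_shift [OF assms(1), of g] by (auto simp: zg_iff)
    then show ?thesis using False by (simp add: conv_def shift_diff_def)
  qed
qed

lemma kd_cong:
  assumes "\<And>S. S \<in> koszul_basis m (Suc k) \<Longrightarrow> v S = w S" "T \<in> koszul_basis m k"
  shows "kd m v T = kd m w T"
proof -
  have "v (insert i T) = w (insert i T)" if "i \<in> {..<m} - T" for i
    using that assms(2) finite_subset [of T "{..<m}"]
    by (intro assms(1)) (auto simp: koszul_basis_def)
  then show ?thesis unfolding kd_def by simp
qed

lemma kd_mem:
  assumes "m \<le> n" "\<And>S. S \<in> koszul_basis m (Suc k) \<Longrightarrow> v S \<in> zg n" "T \<in> koszul_basis m k"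
  shows "kd m v T \<in> zg n"
  unfolding kd_def
proof (intro zg_sum zg_scale zg_shift_diff)
  fix i assume i: "i \<in> {..<m} - T"
  then show "i < n" using assms(1) by auto
  show "v (insert i T) \<in> zg n"
    using i assms(3) finite_subset [of T "{..<m}"]
    by (intro assms(2)) (auto simp: koszul_basis_def)
qed

lemma kd_insert:
  assumes "T \<subseteq> {..<m}"
  shows "kd (Suc m) v (insert m T) = kd m (\<lambda>S. v (insert m S)) T"
proof -
  have e: "{..<Suc m} - insert m T = {..<m} - T" by auto
  have "{j \<in> insert m T. j < i} = {j \<in> T. j < i}" if "i < m" for i
    using that by auto
  then show ?thesis
    unfolding kd_def e by (auto intro!: sum.cong ext simp: insert_commute)
qed

lemma kd_Suc:
  assumes "T \<subseteq> {..<m}"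
  shows "kd (Suc m) v T g = kd m v T g + (-1) ^ card T * shift_diff m (v (insert m T)) g"
proof -
  have e: "{..<Suc m} - T = insert m ({..<m} - T)" using assms by auto
  have "{j \<in> T. j < m} = T" using assms by auto
  then show ?thesis
    unfolding kd_def e by simp
qed

lemma kd_linear: "kd m (\<lambda>S g. v S g + c * w S g) T g = kd m v T g + c * kd m w T g"
  by (simp add: kd_def shift_diff_def sum_distrib_left flip: sum.distrib)
     (rule sum.cong [OF refl], simp add: algebra_simps)

lemma shift_diff_kd: "shift_diff l (kd m v T) g = kd m (\<lambda>S. shift_diff l (v S)) T g"
  by (simp add: kd_def shift_diff_def sum_subtractf [symmetric])
     (rule sum.cong [OF refl], simp add: algebra_simps)

lemma kd_zero: "kd m (\<lambda>S g. 0) T g = 0"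
  by (simp add: kd_def shift_diff_def)

lemma shift_diff_zero: "shift_diff l (\<lambda>g. 0) g = 0"
  by (simp add: shift_diff_def)

lemma kd_kd:
  assumes "T \<subseteq> {..<m}"
  shows "kd m (kd m v) T g = 0"
  using assms
proof (induction m arbitrary: v T g)
  case 0
  then show ?case by (simp add: kd_def)
next
  case (Suc m)
  have fin: "finite S" if "S \<subseteq> {..<m}" for S using that finite_subset by blast
  show ?case
  proof (cases "m \<in> T")
    case True
    define U where "U = T - {m}"
    have U: "T = insert m U" "U \<subseteq> {..<m}" using True Suc.prems unfolding U_def by (auto simp: less_Suc_eq)
    have "kd (Suc m) (kd (Suc m) v) T g = kd m (\<lambda>S. kd (Suc m) v (insert m S)) U g"
      unfolding U(1) by (simp add: kd_insert U(2))
    also have "\<dots> = kd m (kd m (\<lambda>S. v (insert m S))) U g"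
    proof -
      have "kd m (\<lambda>S. kd (Suc m) v (insert m S)) U = kd m (kd m (\<lambda>S. v (insert m S))) U"
        by (rule kd_cong [of _ "card U"]) (use U(2) in \<open>auto simp: koszul_basis_def kd_insert\<close>)
      then show ?thesis by simp
    qed
    also have "\<dots> = 0" by (rule Suc.IH [OF U(2)])
    finally show ?thesis .
  next
    case False
    then have T: "T \<subseteq> {..<m}" using Suc.prems by (auto simp: less_Suc_eq)
    let ?b = "\<lambda>S. v (insert m S)"
    have "kd (Suc m) (kd (Suc m) v) T g =
        kd m (kd (Suc m) v) T g + (-1) ^ card T * shift_diff m (kd (Suc m) v (insert m T)) g"
      by (rule kd_Suc [OF T])
    also have "kd m (kd (Suc m) v) T =
        kd m (\<lambda>S g. kd m v S g + (-1) ^ Suc (card T) * shift_diff m (?b S) g) T"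
      by (rule kd_cong [of _ "card T"])
         (use T in \<open>auto simp: koszul_basis_def kd_Suc intro!: ext\<close>)
    also have "\<dots> g = kd m (kd m v) T g + (-1) ^ Suc (card T) * kd m (\<lambda>S. shift_diff m (?b S)) T g"
      by (rule kd_linear)
    also have "shift_diff m (kd (Suc m) v (insert m T)) g = kd m (\<lambda>S. shift_diff m (?b S)) T g"
      by (simp add: kd_insert [OF T] shift_diff_kd)
    finally show ?thesis using Suc.IH [OF T] by simp
  qed
qed

text \<open>Sums over the cosets of the subgroup generated by the first \<open>m\<close> generators.\<close>

definition fiber_sum :: "nat \<Rightarrow> (nat \<Rightarrow>\<^sub>0 int) \<Rightarrow> ((nat \<Rightarrow>\<^sub>0 int) \<Rightarrow> int) \<Rightarrow> int"
  where "fiber_sum m g a =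
    Sum_any (\<lambda>h. if \<forall>j\<ge>m. Poly_Mapping.lookup h j = Poly_Mapping.lookup g j then a h else 0)"

lemma fiber_support:
  fixes a :: "(nat \<Rightarrow>\<^sub>0 int) \<Rightarrow> int"
  assumes "finite {g. a g \<noteq> 0}" shows "finite {h. (if P h then a h else 0) \<noteq> 0}"
  by (rule finite_subset [OF _ assms]) auto

lemma fiber_sum_add:
  assumes "finite {g. a g \<noteq> 0}" "finite {g. b g \<noteq> 0}"
  shows "fiber_sum m g (\<lambda>h. a h + b h) = fiber_sum m g a + fiber_sum m g b"
  unfolding fiber_sum_def
  by (subst Sum_any.distrib [symmetric]) (auto simp: fiber_support assms intro!: Sum_any.cong)

lemma fiber_sum_scale:
  assumes "finite {g. a g \<noteq> 0}"
  shows "fiber_sum m g (\<lambda>h. c * a h) = c * fiber_sum m g a"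
  unfolding fiber_sum_def
  by (subst Sum_any_right_distrib) (auto simp: fiber_support assms intro!: Sum_any.cong)

lemma fiber_sum_shift:
  assumes "i < m"
  shows "fiber_sum m g (\<lambda>h. a (h - frag_of i)) = fiber_sum m g a"
proof -
  let ?l = "\<lambda>h :: nat \<Rightarrow>\<^sub>0 int. h - frag_of i"
  let ?f = "\<lambda>h. if \<forall>j\<ge>m. Poly_Mapping.lookup h j = Poly_Mapping.lookup g j then a h else 0"
  have "bij ?l"
    by (rule bij_betw_byWitness [of _ "\<lambda>h. h + frag_of i"]) auto
  moreover have "?f \<circ> ?l = (\<lambda>h. if \<forall>j\<ge>m. Poly_Mapping.lookup h j = Poly_Mapping.lookup g j
      then a (h - frag_of i) else 0)"
    using assms by (auto simp: fun_eq_iff lookup_minus)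
  ultimately show ?thesis
    unfolding fiber_sum_def by (intro sym [OF Sum_any.reindex_cong [of ?l]]) (auto dest: bij_is_inj bij_is_surj)
qed

lemma fiber_sum_shift_diff:
  assumes "i < m" "finite {g. a g \<noteq> 0}"
  shows "fiber_sum m g (shift_diff i a) = 0"
proof -
  have "fiber_sum m g (shift_diff i a) = fiber_sum m g (\<lambda>h. a (h - frag_of i) + (-1) * a h)"
    by (simp add: shift_diff_def)
  also have "\<dots> = fiber_sum m g (\<lambda>h. a (h - frag_of i)) + fiber_sum m g (\<lambda>h. (-1) * a h)"
    using assms finite_support_shift [OF assms(2)] by (intro fiber_sum_add) auto
  finally show ?thesis
    using assms by (simp only: fiber_sum_scale fiber_sum_shift)
qed

lemma fiber_sum_sum:
  assumes "finite I" "\<And>i. i \<in> I \<Longrightarrow> finite {g. a i g \<noteq> 0}"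
  shows "finite {h. (\<Sum>i\<in>I. a i h) \<noteq> 0} \<and> fiber_sum m g (\<lambda>h. \<Sum>i\<in>I. a i h) = (\<Sum>i\<in>I. fiber_sum m g (a i))"
  using assms
proof (induction I)
  case empty
  then show ?case by (simp add: fiber_sum_def)
next
  case (insert x I)
  have fx: "finite {g. a x g \<noteq> 0}" and fI: "finite {h. (\<Sum>i\<in>I. a i h) \<noteq> 0}"
    using insert by auto
  then show ?case using insert by (simp add: fiber_sum_add finite_support_add)
qed

lemma fiber_sum_kd:
  assumes "m \<le> n" "\<And>S. S \<in> koszul_basis m 1 \<Longrightarrow> v S \<in> zg n"
  shows "fiber_sum m g (kd m v {}) = 0"
proof -
  have f: "shift_diff i (v {i}) \<in> zg n" "v {i} \<in> zg n" if "i < m" for i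
    using that assms by (auto simp: koszul_basis_def intro!: zg_shift_diff)
  have "fiber_sum m g (kd m v {}) = fiber_sum m g (\<lambda>h. \<Sum>i<m. shift_diff i (v {i}) h)"
    by (simp add: kd_def)
  also have "\<dots> = (\<Sum>i<m. fiber_sum m g (shift_diff i (v {i})))"
    using f by (intro conjunct2 [OF fiber_sum_sum]) (auto simp: zg_iff)
  also have "\<dots> = 0"
    using f by (intro sum.neutral) (auto intro!: fiber_sum_shift_diff simp: zg_iff)
  finally show ?thesis .
qed

definition low_zero :: "nat \<Rightarrow> (nat \<Rightarrow>\<^sub>0 int) set"
  where "low_zero m = {g. \<forall>i<m. Poly_Mapping.lookup g i = 0}"

lemma fiber_sum_low_zero:
  assumes "{h. a h \<noteq> 0} \<subseteq> low_zero m" "g \<in> low_zero m"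
  shows "fiber_sum m g a = a g"
proof -
  have "(if \<forall>j\<ge>m. Poly_Mapping.lookup h j = Poly_Mapping.lookup g j then a h else 0) = (if h = g then a h else 0)" for h
  proof (cases "a h = 0")
    case False
    then have h: "h \<in> low_zero m" using assms by auto
    have "h = g" if "\<forall>j\<ge>m. Poly_Mapping.lookup h j = Poly_Mapping.lookup g j"
    proof (rule poly_mapping_eqI)
      fix j show "Poly_Mapping.lookup h j = Poly_Mapping.lookup g j"
        using that h assms(2) by (cases "j < m") (auto simp: low_zero_def)
    qed
    then show ?thesis by auto
  qed auto
  then have "fiber_sum m g a = Sum_any (\<lambda>h. if h = g then a h else 0)"
    unfolding fiber_sum_def by simp
  then show ?thesis by simp
qed

text \<open>Modulo \<open>X\<^sub>m - 1\<close> every element can be moved to exponents that vanish at \<open>m\<close>.\<close>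

definition reducible :: "nat \<Rightarrow> nat \<Rightarrow> ((nat \<Rightarrow>\<^sub>0 int) \<Rightarrow> int) \<Rightarrow> bool"
  where "reducible n m a \<longleftrightarrow> (\<exists>w\<in>zg n. {g. w g \<noteq> 0} \<subseteq> low_zero m \<and>
           {g. a g - shift_diff m w g \<noteq> 0} \<subseteq> low_zero (Suc m))"

lemma reducible_add:
  assumes "reducible n m a" "d \<in> zg n" "{g. d g \<noteq> 0} \<subseteq> low_zero m"
    and e: "\<And>g. b g = a g + c * shift_diff m d g"
  shows "reducible n m b"
proof -
  obtain w where w: "w \<in> zg n" "{g. w g \<noteq> 0} \<subseteq> low_zero m"
      "{g. a g - shift_diff m w g \<noteq> 0} \<subseteq> low_zero (Suc m)"
    using assms(1) unfolding reducible_def by blast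
  let ?w = "\<lambda>g. w g + c * d g"
  have "b g - shift_diff m ?w g = a g - shift_diff m w g" for g
    unfolding e by (simp add: shift_diff_def right_diff_distrib)
  then have 1: "{g. b g - shift_diff m ?w g \<noteq> 0} \<subseteq> low_zero (Suc m)"
    using w(3) by (simp only:)
  have "{g. ?w g \<noteq> 0} \<subseteq> {g. w g \<noteq> 0} \<union> {g. d g \<noteq> 0}" by auto
  then have 2: "{g. ?w g \<noteq> 0} \<subseteq> low_zero m"
    using w(2) assms(3) by blast
  have 3: "?w \<in> zg n" using w(1) assms(2) by (intro zg_add zg_scale)
  show ?thesis unfolding reducible_def by (intro bexI [of _ ?w] conjI 1 2 3)
qed

lemma division_single:
  assumes "m < n" "Poly_Mapping.keys h \<subseteq> {..<n}" "h \<in> low_zero m"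
  shows "reducible n m (\<lambda>g. if g = h then 1 else 0)"
proof -
  let ?\<delta> = "\<lambda>h g. if g = h then (1::int) else 0"
  have \<delta>: "?\<delta> h \<in> zg n" "{g. ?\<delta> h g \<noteq> 0} \<subseteq> low_zero m"
    if "Poly_Mapping.keys h \<subseteq> {..<n}" "h \<in> low_zero m" for h
    using that by (auto simp: zg_iff)
  have sd: "shift_diff m (?\<delta> h) g = ?\<delta> (h + frag_of m) g - ?\<delta> h g" for h g
    by (simp only: shift_diff_def diff_eq_eq)
  have up: "reducible n m (?\<delta> (h + frag_of m))"
    if "reducible n m (?\<delta> h)" "Poly_Mapping.keys h \<subseteq> {..<n}" "h \<in> low_zero m" for h
    by (rule reducible_add [OF that(1) \<delta> [OF that(2,3)], of _ 1]) (unfold sd, simp)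
  have down: "reducible n m (?\<delta> h)"
    if "reducible n m (?\<delta> (h + frag_of m))" "Poly_Mapping.keys h \<subseteq> {..<n}" "h \<in> low_zero m" for h
    by (rule reducible_add [OF that(1) \<delta> [OF that(2,3)], of _ "-1"]) (unfold sd, simp)
  have lz: "h + frag_of m \<in> low_zero m \<longleftrightarrow> h \<in> low_zero m" for h
    by (simp add: low_zero_def lookup_add)
  have ks: "Poly_Mapping.keys (h + frag_of m) \<subseteq> {..<n} \<longleftrightarrow> Poly_Mapping.keys h \<subseteq> {..<n}" for h
    using keys_shift [OF assms(1), of "h + frag_of m"] by simp
  have base: "reducible n m (?\<delta> h)" if "h \<in> low_zero (Suc m)" for h
    unfolding reducible_def
    by (rule bexI [of _ "\<lambda>g. 0", OF _ zg_zero]) (use that in \<open>simp add: shift_diff_zero\<close>)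
  have "\<forall>h. Poly_Mapping.lookup h m = k \<longrightarrow> Poly_Mapping.keys h \<subseteq> {..<n} \<longrightarrow> h \<in> low_zero m \<longrightarrow>
      reducible n m (?\<delta> h)" for k :: int
  proof (induction k rule: int_induct [where k = 0])
    case base
    have "h \<in> low_zero (Suc m)" if "Poly_Mapping.lookup h m = 0" "h \<in> low_zero m" for h
      using that by (simp add: low_zero_def less_Suc_eq)
    then show ?case using \<open>\<And>h. h \<in> low_zero (Suc m) \<Longrightarrow> reducible n m (?\<delta> h)\<close> by blast
  next
    case (step1 i)
    show ?case
    proof (intro allI impI)
      fix h :: "nat \<Rightarrow>\<^sub>0 int"
      assume h: "Poly_Mapping.lookup h m = i + 1" "Poly_Mapping.keys h \<subseteq> {..<n}" "h \<in> low_zero m"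
      let ?h = "h - frag_of m"
      have e: "h = ?h + frag_of m" by simp
      have k: "Poly_Mapping.lookup ?h m = i" "Poly_Mapping.keys ?h \<subseteq> {..<n}" "?h \<in> low_zero m"
        using h lz [of ?h] ks [of ?h] by (simp_all add: lookup_minus)
      then have "reducible n m (?\<delta> ?h)" using step1.IH by blast
      then have "reducible n m (?\<delta> (?h + frag_of m))" by (rule up [OF _ k(2,3)])
      then show "reducible n m (?\<delta> h)" by (simp only: e [symmetric])
    qed
  next
    case (step2 i)
    show ?case
    proof (intro allI impI)
      fix h :: "nat \<Rightarrow>\<^sub>0 int"
      assume h: "Poly_Mapping.lookup h m = i - 1" "Poly_Mapping.keys h \<subseteq> {..<n}" "h \<in> low_zero m"
      have "Poly_Mapping.lookup (h + frag_of m) m = i" using h(1) by (simp add: lookup_add)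
      then have "reducible n m (?\<delta> (h + frag_of m))" using step2.IH h ks [of h] lz [of h] by blast
      then show "reducible n m (?\<delta> h)" by (rule down [OF _ h(2,3)])
    qed
  qed
  then show ?thesis using assms by blast
qed

lemma division:
  assumes "m < n" "a \<in> zg n" "{h. a h \<noteq> 0} \<subseteq> low_zero m"
  shows "\<exists>w\<in>zg n. {g. w g \<noteq> 0} \<subseteq> low_zero m \<and>
           {g. a g - shift_diff m w g \<noteq> 0} \<subseteq> low_zero (Suc m)"
proof -
  define A where "A = {h. a h \<noteq> 0}"
  have A: "finite A" "\<And>h. h \<in> A \<Longrightarrow> Poly_Mapping.keys h \<subseteq> {..<n}" "\<And>h. h \<in> A \<Longrightarrow> h \<in> low_zero m"
    using assms by (auto simp: A_def zg_iff)
  have "\<forall>h\<in>A. \<exists>w. w \<in> zg n \<and> {g. w g \<noteq> 0} \<subseteq> low_zero m \<and>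
      {g. (if g = h then 1 else 0) - shift_diff m w g \<noteq> 0} \<subseteq> low_zero (Suc m)"
  proof
    fix h assume h: "h \<in> A"
    show "\<exists>w. w \<in> zg n \<and> {g. w g \<noteq> 0} \<subseteq> low_zero m \<and>
      {g. (if g = h then 1 else 0) - shift_diff m w g \<noteq> 0} \<subseteq> low_zero (Suc m)"
      using division_single [OF assms(1) A(2,3) [OF h]] unfolding reducible_def Bex_def .
  qed
  from bchoice [OF this] obtain W where W0: "\<forall>h\<in>A. W h \<in> zg n \<and> {g. W h g \<noteq> 0} \<subseteq> low_zero m \<and>
      {g. (if g = h then 1 else 0) - shift_diff m (W h) g \<noteq> 0} \<subseteq> low_zero (Suc m)" by (elim exE)
  have W:
    "\<And>h. h \<in> A \<Longrightarrow> W h \<in> zg n"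
    "\<And>h. h \<in> A \<Longrightarrow> {g. W h g \<noteq> 0} \<subseteq> low_zero m"
    "\<And>h. h \<in> A \<Longrightarrow> {g. (if g = h then 1 else 0) - shift_diff m (W h) g \<noteq> 0} \<subseteq> low_zero (Suc m)"
    by (drule bspec [OF W0], elim conjE, assumption)+
  let ?w = "\<lambda>g. \<Sum>h\<in>A. a h * W h g"
  have "?w \<in> zg n" by (intro zg_sum zg_scale W)
  moreover have "{g. ?w g \<noteq> 0} \<subseteq> low_zero m"
  proof
    fix g assume "g \<in> {g. ?w g \<noteq> 0}"
    then have "?w g \<noteq> 0" by simp
    then obtain h where h: "h \<in> A" "a h * W h g \<noteq> 0" by (rule sum.not_neutral_contains_not_neutral)
    then have "g \<in> {g. W h g \<noteq> 0}" by simp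
    then show "g \<in> low_zero m" by (rule subsetD [OF W(2) [OF h(1)]])
  qed
  moreover have "{g. a g - shift_diff m ?w g \<noteq> 0} \<subseteq> low_zero (Suc m)"
  proof
    fix g assume g: "g \<in> {g. a g - shift_diff m ?w g \<noteq> 0}"
    have "(\<Sum>h\<in>A. a h * (if g = h then 1 else 0)) = (\<Sum>h\<in>A. if h = g then a g else 0)"
      by (rule sum.cong) auto
    also have "\<dots> = (if g \<in> A then a g else 0)" by (rule sum.delta [OF A(1)])
    also have "\<dots> = a g" by (simp add: A_def)
    finally have "a g = (\<Sum>h\<in>A. a h * (if g = h then 1 else 0))" by (rule sym)
    moreover have "shift_diff m ?w g = (\<Sum>h\<in>A. a h * shift_diff m (W h) g)"
      by (simp only: shift_diff_def right_diff_distrib sum_subtractf)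
    ultimately have e: "a g - shift_diff m ?w g = (\<Sum>h\<in>A. a h * ((if g = h then 1 else 0) - shift_diff m (W h) g))"
      by (simp only: right_diff_distrib sum_subtractf)
    from g have "a g - shift_diff m ?w g \<noteq> 0" by (rule CollectD)
    then obtain h where h: "h \<in> A" "a h * ((if g = h then 1 else 0) - shift_diff m (W h) g) \<noteq> 0"
      unfolding e by (rule sum.not_neutral_contains_not_neutral)
    have "(if g = h then 1 else 0) - shift_diff m (W h) g \<noteq> 0"
    proof
      assume z: "(if g = h then 1 else 0) - shift_diff m (W h) g = 0"
      show False using h(2) unfolding z by simp
    qed
    then have "g \<in> {g. (if g = h then 1 else 0) - shift_diff m (W h) g \<noteq> 0}" by (rule CollectI)
    then show "g \<in> low_zero (Suc m)" by (rule subsetD [OF W(3) [OF h(1)]])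
  qed
  ultimately show ?thesis by (intro bexI [of _ ?w] conjI)
qed

lemma reduction:
  assumes "m \<le> n" "a \<in> zg n"
  shows "\<exists>w. (\<forall>S. w S \<in> zg n) \<and> {g. a g - kd m w {} g \<noteq> 0} \<subseteq> low_zero m"
  using assms(1)
proof (induction m)
  case 0
  show ?case by (rule exI [of _ "\<lambda>S g. 0"]) (auto simp: zg_zero low_zero_def)
next
  case (Suc m)
  then obtain w where w: "\<And>S. w S \<in> zg n" "{g. a g - kd m w {} g \<noteq> 0} \<subseteq> low_zero m" by auto
  let ?r = "\<lambda>g. a g - kd m w {} g"
  have r: "?r \<in> zg n"
    using assms(2) Suc.prems w(1) by (intro zg_diff kd_mem [of m n 0]) (auto simp: koszul_basis_def)
  obtain u where u: "u \<in> zg n" "{g. u g \<noteq> 0} \<subseteq> low_zero m"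
      "{g. ?r g - shift_diff m u g \<noteq> 0} \<subseteq> low_zero (Suc m)"
    using division [OF _ r w(2)] Suc.prems by auto
  let ?w = "\<lambda>S. if S = {m} then u else w S"
  have "kd m ?w {} = kd m w {}"
    by (rule kd_cong [of m 0]) (auto simp: koszul_basis_def)
  then have e: "a g - kd (Suc m) ?w {} g = ?r g - shift_diff m u g" for g
    by (simp add: kd_Suc)
  have "{g. a g - kd (Suc m) ?w {} g \<noteq> 0} \<subseteq> low_zero (Suc m)"
    unfolding e by (rule u(3))
  moreover have "\<forall>S. ?w S \<in> zg n" using u(1) w(1) by simp
  ultimately show ?case by (intro exI [of _ ?w] conjI)
qed

text \<open>\<open>X\<^sub>m - 1\<close> is a nonzerodivisor modulo \<open>X\<^sub>0 - 1, \<dots>, X\<^sub>m\<^sub>-\<^sub>1 - 1\<close>.\<close>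

lemma nonzerodivisor:
  assumes "m < n" "b \<in> zg n" "\<And>S. S \<in> koszul_basis m 1 \<Longrightarrow> v S \<in> zg n"
    and e: "\<And>g. kd m v {} g + shift_diff m b g = 0"
  shows "\<exists>c. (\<forall>S. c S \<in> zg n) \<and> b = kd m c {}"
proof -
  obtain c where c: "\<And>S. c S \<in> zg n" "{g. b g - kd m c {} g \<noteq> 0} \<subseteq> low_zero m"
    using reduction [of m n b] assms by auto
  define r where "r = (\<lambda>g. b g - kd m c {} g)"
  have rz: "r \<in> zg n"
    unfolding r_def using assms c(1) by (intro zg_diff kd_mem [of m n 0]) (auto simp: koszul_basis_def)
  have rl: "{g. r g \<noteq> 0} \<subseteq> low_zero m" using c by (simp add: r_def)
  let ?u = "\<lambda>S g. (- v S g) + (-1) * shift_diff m (c S) g"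
  have sr: "shift_diff m r = kd m ?u {}"
  proof
    fix g
    have "kd m ?u {} g = kd m (\<lambda>S g. - v S g) {} g + (-1) * kd m (\<lambda>S. shift_diff m (c S)) {} g"
      by (rule kd_linear)
    also have "kd m (\<lambda>S g. - v S g) {} g = - kd m v {} g"
      using kd_linear [of m "\<lambda>S g. 0" "-1" v "{}" g] by (simp add: kd_zero)
    also have "kd m (\<lambda>S. shift_diff m (c S)) {} g = shift_diff m (kd m c {}) g"
      by (rule shift_diff_kd [symmetric])
    finally show "shift_diff m r g = kd m ?u {} g"
      using e [of g] by (simp add: r_def shift_diff_def)
  qed
  have low: "{g. shift_diff m r g \<noteq> 0} \<subseteq> low_zero m"
  proof
    fix g assume "g \<in> {g. shift_diff m r g \<noteq> 0}"
    then have "r (g - frag_of m) \<noteq> 0 \<or> r g \<noteq> 0" by (auto simp: shift_diff_def)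
    then have "g - frag_of m \<in> low_zero m \<or> g \<in> low_zero m" using rl by auto
    then show "g \<in> low_zero m" by (auto simp: low_zero_def lookup_minus)
  qed
  have u: "?u S \<in> zg n" if "S \<in> koszul_basis m 1" for S
    using that assms c(1) by (intro zg_add zg_uminus zg_scale zg_shift_diff)
  have fs: "fiber_sum m g (shift_diff m r) = 0" for g
    unfolding sr by (rule fiber_sum_kd [OF less_imp_le [OF assms(1)]]) (rule u)
  have z: "shift_diff m r g = 0" for g
    using fiber_sum_low_zero [OF low, of g] fs [of g] low by (cases "g \<in> low_zero m") auto
  have r0: "r g = 0" for g
  proof (rule ccontr)
    assume "r g \<noteq> 0"
    have "r (g - frag_cmul (int k) (frag_of m)) \<noteq> 0" for k
    proof (induction k)
      case (Suc k)
      then show ?case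
        using z [of "g - frag_cmul (int k) (frag_of m)"]
        by (simp add: shift_diff_def frag_cmul_distrib algebra_simps)
    qed (use \<open>r g \<noteq> 0\<close> in simp)
    then have "range (\<lambda>k. g - frag_cmul (int k) (frag_of m)) \<subseteq> {g. r g \<noteq> 0}" by auto
    then have "finite (range (\<lambda>k. g - frag_cmul (int k) (frag_of m)))"
      using rz by (auto simp: zg_iff intro: finite_subset)
    moreover have "inj (\<lambda>k. g - frag_cmul (int k) (frag_of m))"
    proof (rule injI)
      fix k l assume "g - frag_cmul (int k) (frag_of m) = g - frag_cmul (int l) (frag_of m)"
      from arg_cong [OF this, of "\<lambda>h. Poly_Mapping.lookup h m"]
      show "k = l" by (simp add: lookup_minus)
    qed
    ultimately show False using finite_imageD by blast
  qed
  have "b = kd m c {}" using r0 by (auto simp: r_def fun_eq_iff)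
  then show ?thesis using c(1) by blast
qed

lemma kd_exact:
  assumes "m \<le> n"
    and v: "\<And>S. S \<in> koszul_basis m (Suc k) \<Longrightarrow> v S \<in> zg n"
    and z: "\<And>T g. T \<in> koszul_basis m k \<Longrightarrow> kd m v T g = 0"
  shows "\<exists>w. (\<forall>S. S \<in> koszul_basis m (Suc (Suc k)) \<longrightarrow> w S \<in> zg n) \<and>
             (\<forall>T\<in>koszul_basis m (Suc k). kd m w T = v T)"
  using assms
proof (induction m arbitrary: k v)
  case 0
  have "koszul_basis 0 (Suc k) = {}" for k by (auto simp: koszul_basis_def)
  then show ?case by auto
next
  case (Suc m)
  have fin: "finite S" if "S \<subseteq> {..<m}" for S using that finite_subset by blast
  have basis: "S \<in> koszul_basis (Suc m) l" if "S \<in> koszul_basis m l" for S l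
    using that by (auto simp: koszul_basis_def)
  have basis': "insert m S \<in> koszul_basis (Suc m) (Suc l)" if "S \<in> koszul_basis m l" for S l
  proof -
    have "m \<notin> S" "finite S" using that fin by (auto simp: koszul_basis_def)
    then show ?thesis using that by (auto simp: koszul_basis_def)
  qed
  have sub: "S \<subseteq> {..<m}" "card S = l" if "S \<in> koszul_basis m l" for S l
    using that by (auto simp: koszul_basis_def)
  have split: "S \<in> koszul_basis m l \<or> (\<exists>l' U. l = Suc l' \<and> S = insert m U \<and> U \<in> koszul_basis m l')"
    if "S \<in> koszul_basis (Suc m) l" for S l
  proof (cases "m \<in> S")
    case True
    have S: "S \<subseteq> {..<Suc m}" "card S = l" using that by (simp_all add: koszul_basis_def)
    have "finite S" by (rule finite_subset [OF S(1)]) simp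
    then have "l = Suc (card (S - {m}))"
      unfolding S(2) [symmetric] by (rule card.remove [OF _ True])
    moreover have "S = insert m (S - {m})" by (rule insert_Diff [OF True, symmetric])
    moreover have "S - {m} \<in> koszul_basis m (card (S - {m}))"
      using S(1) by (auto simp: koszul_basis_def less_Suc_eq)
    ultimately show ?thesis
      by (intro disjI2 exI [of _ "card (S - {m})"] exI [of _ "S - {m}"] conjI)
  next
    case False
    have "S \<subseteq> {..<Suc m}" "card S = l" using that by (simp_all add: koszul_basis_def)
    then show ?thesis using False
      by (intro disjI1) (auto simp: koszul_basis_def less_Suc_eq)
  qed
  let ?b = "\<lambda>S. v (insert m S)"
  have m: "m \<le> n" "m < n" using Suc.prems by auto
  have vm: "v S \<in> zg n" if "S \<in> koszul_basis m (Suc k)" for S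
    by (rule Suc.prems(2) [OF basis [OF that]])
  have bm: "?b S \<in> zg n" if "S \<in> koszul_basis m k" for S
    by (rule Suc.prems(2) [OF basis' [OF that]])
  have cyc: "kd m v T g + (-1) ^ k * shift_diff m (?b T) g = 0" if "T \<in> koszul_basis m k" for T g
    using Suc.prems(3) [OF basis [OF that], of g] unfolding kd_Suc [OF sub(1) [OF that]] sub(2) [OF that] .
  have "\<exists>c. (\<forall>S. S \<in> koszul_basis m (Suc k) \<longrightarrow> c S \<in> zg n) \<and> (\<forall>T\<in>koszul_basis m k. kd m c T = ?b T)"
  proof (cases k)
    case 0
    have e: "{} \<in> koszul_basis m k" using 0 by (auto simp: koszul_basis_def)
    have "\<exists>c. (\<forall>S. c S \<in> zg n) \<and> ?b {} = kd m c {}"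
      by (rule nonzerodivisor [OF m(2) bm [OF e], of v])
         (use vm cyc [OF e] 0 in auto)
    moreover have "T = {}" if "T \<in> koszul_basis m k" for T
      using that 0 fin by (auto simp: koszul_basis_def)
    ultimately show ?thesis by metis
  next
    case (Suc l)
    have "kd m ?b T g = 0" if "T \<in> koszul_basis m l" for T g
      using Suc.prems(3) [of "insert m T" g] basis' [OF that] sub [OF that] Suc by (simp add: kd_insert)
    then show ?thesis
      using Suc.IH [OF m(1), of l ?b] bm Suc by blast
  qed
  then obtain c where c: "\<And>S. S \<in> koszul_basis m (Suc k) \<Longrightarrow> c S \<in> zg n"
      "\<And>T. T \<in> koszul_basis m k \<Longrightarrow> kd m c T = ?b T" by blast
  let ?v = "\<lambda>S g. v S g + (-1) ^ k * shift_diff m (c S) g"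
  have "\<exists>w. (\<forall>S. S \<in> koszul_basis m (Suc (Suc k)) \<longrightarrow> w S \<in> zg n) \<and>
            (\<forall>T\<in>koszul_basis m (Suc k). kd m w T = ?v T)"
  proof (rule Suc.IH [OF m(1)])
    show "?v S \<in> zg n" if "S \<in> koszul_basis m (Suc k)" for S
      using that m by (intro zg_add zg_scale zg_shift_diff vm c)
    show "kd m ?v T g = 0" if "T \<in> koszul_basis m k" for T g
    proof -
      have "kd m ?v T g = kd m v T g + (-1) ^ k * kd m (\<lambda>S. shift_diff m (c S)) T g"
        by (rule kd_linear)
      also have "kd m (\<lambda>S. shift_diff m (c S)) T g = shift_diff m (kd m c T) g"
        by (rule shift_diff_kd [symmetric])
      finally show ?thesis using cyc [OF that, of g] c(2) [OF that] by simp
    qed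
  qed
  then obtain u where u: "\<And>S. S \<in> koszul_basis m (Suc (Suc k)) \<Longrightarrow> u S \<in> zg n"
      "\<And>T. T \<in> koszul_basis m (Suc k) \<Longrightarrow> kd m u T = ?v T" by blast
  let ?w = "\<lambda>S. if m \<in> S then c (S - {m}) else u S"
  have nm: "m \<notin> S" if "S \<in> koszul_basis m l" for S l
    using that by (auto simp: koszul_basis_def)
  have wi: "?w (insert m S) = c S" if "S \<in> koszul_basis m l" for S l
    using nm [OF that] by simp
  show ?case
  proof (intro exI [of _ ?w] conjI allI impI ballI)
    fix S assume "S \<in> koszul_basis (Suc m) (Suc (Suc k))"
    then show "?w S \<in> zg n"
      using split [of S] u(1) c(1) nm wi by fastforce
  next
    fix T assume "T \<in> koszul_basis (Suc m) (Suc k)"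
    then consider "T \<in> koszul_basis m (Suc k)" | U where "T = insert m U" "U \<in> koszul_basis m k"
      using split [of T] by auto
    then show "kd (Suc m) ?w T = v T"
    proof cases
      case 1
      have "kd m ?w T = kd m u T"
        by (rule kd_cong [OF _ 1]) (use nm in auto)
      then show ?thesis
        using 1 sub [OF 1] nm [OF 1] u(2) [OF 1] by (auto simp: kd_Suc fun_eq_iff)
    next
      case 2
      have "kd (Suc m) ?w T = kd m (\<lambda>S. ?w (insert m S)) U"
        using 2 sub by (simp add: kd_insert)
      also have "\<dots> = kd m c U"
        by (rule kd_cong [OF _ 2(2)]) (rule wi)
      finally show ?thesis using c(2) 2 by simp
    qed
  qed
qed

definition trivial_module :: "('g \<Rightarrow> int, int) module"
  where "trivial_module =
    \<lparr>carrier = UNIV, monoid.mult = undefined, one = undefined, zero = 0, add = (+),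
     smult = (\<lambda>a k. (\<Sum>g | a g \<noteq> 0. a g) * k)\<rparr>"

definition augmentation :: "nat \<Rightarrow> (nat set \<Rightarrow> (nat \<Rightarrow>\<^sub>0 int) \<Rightarrow> int) \<Rightarrow> int"
  where "augmentation n = (\<lambda>v\<in>carrier (koszul n 0). \<Sum>g | v {} g \<noteq> 0. v {} g)"

lemma cring_zg: "cring (int_group_ring (Zn n))"
  by (rule comm_group.group_ring_cring [OF abelian_free_Abelian_group])

lemma koszul_module: "module (int_group_ring (Zn n)) (koszul n k)"
  unfolding koszul_def by (rule free_module_module [OF cring_zg])

lemma koszul_carrier: "carrier (koszul n k) = koszul_basis n k \<rightarrow>\<^sub>E zg n"
  by (simp add: koszul_def free_module_def)

lemma koszul_mem: "v \<in> carrier (koszul n k) \<Longrightarrow> S \<in> koszul_basis n k \<Longrightarrow> v S \<in> zg n"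
  unfolding koszul_carrier by (rule PiE_mem)

lemma koszul_zero: "\<zero>\<^bsub>koszul n k\<^esub> = (\<lambda>S\<in>koszul_basis n k. \<lambda>g. 0)"
  by (simp add: koszul_def free_module_def group_ring_def)

lemma koszul_diff_kd:
  assumes "v \<in> carrier (koszul n (Suc k))"
  shows "koszul_diff n k v = (\<lambda>T\<in>koszul_basis n k. kd n v T)"
  unfolding koszul_diff_def kd_def restrict_apply' [OF assms]
proof (intro restrict_ext ext sum.cong refl)
  fix T g i assume T: "T \<in> koszul_basis n k" and i: "i \<in> {..<n} - T"
  then have "insert i T \<in> koszul_basis n (Suc k)"
    using finite_subset [of T "{..<n}"] by (auto simp: koszul_basis_def)
  then have "v (insert i T) \<in> zg n" by (rule koszul_mem [OF assms])
  then have "conv (Zn n) (gen_minus_one i) (v (insert i T)) = shift_diff i (v (insert i T))"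
    using i by (intro conv_gen_minus_one) auto
  then show "(-1) ^ card {j \<in> T. j < i} * conv (Zn n) (gen_minus_one i) (v (insert i T)) g =
      (-1) ^ card {j \<in> T. j < i} * shift_diff i (v (insert i T)) g" by simp
qed

lemma gen_minus_one_mem: "i < n \<Longrightarrow> gen_minus_one i \<in> zg n"
proof -
  assume "i < n"
  moreover have "{g. gen_minus_one i g \<noteq> 0} \<subseteq> {frag_of i, 0}"
    by (auto simp: gen_minus_one_def indicator_def)
  ultimately show ?thesis
    unfolding zg_iff by (auto dest: subsetD intro: finite_subset)
qed

lemma shift_diff_conv:
  assumes "i < n" "r \<in> zg n" "a \<in> zg n"
  shows "shift_diff i (conv (Zn n) r a) = conv (Zn n) r (shift_diff i a)"
proof -
  interpret R: cring "int_group_ring (Zn n)" by (rule cring_zg)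
  have m: "x \<otimes>\<^bsub>int_group_ring (Zn n)\<^esub> y = conv (Zn n) x y" for x y
    by (simp add: group_ring_def)
  note x = gen_minus_one_mem [OF assms(1)]
  have "conv (Zn n) r a \<in> zg n"
    using R.m_closed [OF assms(2,3)] by (simp only: m)
  then have "shift_diff i (conv (Zn n) r a) = conv (Zn n) (gen_minus_one i) (conv (Zn n) r a)"
    using assms(1) by (rule conv_gen_minus_one [symmetric, rotated])
  also have "\<dots> = conv (Zn n) r (conv (Zn n) (gen_minus_one i) a)"
    using R.m_lcomm [OF x assms(2,3)] by (simp only: m)
  also have "conv (Zn n) (gen_minus_one i) a = shift_diff i a"
    using assms(1,3) by (rule conv_gen_minus_one)
  finally show ?thesis .
qed

lemma conv_sum_right:
  "conv G r (\<lambda>g. \<Sum>i\<in>I. c i * f i g) g = (\<Sum>i\<in>I. c i * conv G r (f i) g)"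
  by (simp add: conv_def sum_distrib_left)
     (auto simp: mult.left_commute sum.swap [of _ I])

lemma kd_conv:
  assumes "r \<in> zg n" "\<And>S. S \<in> koszul_basis n (Suc k) \<Longrightarrow> v S \<in> zg n" "T \<in> koszul_basis n k"
  shows "kd n (\<lambda>S. conv (Zn n) r (v S)) T = conv (Zn n) r (kd n v T)"
proof
  fix g
  have "shift_diff i (conv (Zn n) r (v (insert i T))) = conv (Zn n) r (shift_diff i (v (insert i T)))"
    if "i \<in> {..<n} - T" for i
    using that assms(3) finite_subset [of T "{..<n}"]
    by (intro shift_diff_conv assms(1,2)) (auto simp: koszul_basis_def)
  then show "kd n (\<lambda>S. conv (Zn n) r (v S)) T g = conv (Zn n) r (kd n v T) g"
    unfolding kd_def conv_sum_right by (intro sum.cong refl) simp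
qed

lemma koszul_diff_linear:
  "koszul_diff n k \<in> lin_maps (int_group_ring (Zn n)) (koszul n (Suc k)) (koszul n k)"
    (is "_ \<in> lin_maps ?R ?P ?Q")
proof -
  interpret P: module ?R ?P by (rule koszul_module)
  have add: "(x \<oplus>\<^bsub>koszul n l\<^esub> y) = (\<lambda>S\<in>koszul_basis n l. \<lambda>g. x S g + y S g)" for x y l
    by (simp add: koszul_def free_module_def group_ring_def)
  have smult: "(r \<odot>\<^bsub>koszul n l\<^esub> x) = (\<lambda>S\<in>koszul_basis n l. conv (Zn n) r (x S))" for r x l
    by (simp add: koszul_def free_module_def group_ring_def)
  show ?thesis
    unfolding lin_maps_def
  proof (intro CollectI conjI ballI PiE_I)
    fix x assume x: "x \<in> carrier ?P"
    show "koszul_diff n k x \<in> carrier ?Q"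
      unfolding koszul_diff_kd [OF x] koszul_carrier
      by (intro restrict_PiE_iff [THEN iffD2] ballI kd_mem [of n n k] koszul_mem [OF x]) simp
  next
    fix x y assume x: "x \<in> carrier ?P" and y: "y \<in> carrier ?P"
    show "koszul_diff n k (x \<oplus>\<^bsub>?P\<^esub> y) = koszul_diff n k x \<oplus>\<^bsub>?Q\<^esub> koszul_diff n k y"
      unfolding koszul_diff_kd [OF P.M.add.m_closed [OF x y]] koszul_diff_kd [OF x] koszul_diff_kd [OF y]
      unfolding add
    proof (rule restrict_ext)
      fix T assume T: "T \<in> koszul_basis n k"
      have "kd n (\<lambda>S\<in>koszul_basis n (Suc k). \<lambda>g. x S g + y S g) T = kd n (\<lambda>S g. x S g + 1 * y S g) T"
        by (rule kd_cong [OF _ T]) simp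
      also have "\<dots> = (\<lambda>g. kd n x T g + kd n y T g)"
        by (rule ext, subst kd_linear) simp
      finally show "kd n (\<lambda>S\<in>koszul_basis n (Suc k). \<lambda>g. x S g + y S g) T =
          (\<lambda>g. restrict (kd n x) (koszul_basis n k) T g + restrict (kd n y) (koszul_basis n k) T g)"
        using T by simp
    qed
  next
    fix r x assume r: "r \<in> carrier ?R" and x: "x \<in> carrier ?P"
    show "koszul_diff n k (r \<odot>\<^bsub>?P\<^esub> x) = r \<odot>\<^bsub>?Q\<^esub> koszul_diff n k x"
      unfolding koszul_diff_kd [OF P.smult_closed [OF r x]] koszul_diff_kd [OF x]
      unfolding smult
    proof (rule restrict_ext)
      fix T assume T: "T \<in> koszul_basis n k"
      have "kd n (\<lambda>S\<in>koszul_basis n (Suc k). conv (Zn n) r (x S)) T = kd n (\<lambda>S. conv (Zn n) r (x S)) T"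
        by (rule kd_cong [OF _ T]) simp
      also have "\<dots> = conv (Zn n) r (kd n x T)"
        by (rule kd_conv [OF r koszul_mem [OF x] T])
      finally show "kd n (\<lambda>S\<in>koszul_basis n (Suc k). conv (Zn n) r (x S)) T =
          conv (Zn n) r (restrict (kd n x) (koszul_basis n k) T)"
        using T by simp
    qed
  qed (simp add: koszul_diff_def)
qed

lemma sum_support_conv:
  fixes a b :: "(nat \<Rightarrow>\<^sub>0 int) \<Rightarrow> int"
  assumes "a \<in> zg n" "b \<in> zg n"
  shows "(\<Sum>g | conv (Zn n) a b g \<noteq> 0. conv (Zn n) a b g) = (\<Sum>g | a g \<noteq> 0. a g) * (\<Sum>g | b g \<noteq> 0. b g)"
proof -
  interpret G: comm_group "Zn n" by (rule abelian_free_Abelian_group)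
  let ?A = "{g. a g \<noteq> 0}" and ?B = "{g. b g \<noteq> 0}"
  let ?AB = "(\<lambda>(h, k). h + k) ` (?A \<times> ?B)"
  have a: "finite ?A" "?A \<subseteq> carrier (Zn n)" and b: "finite ?B" "?B \<subseteq> carrier (Zn n)"
    using assms by (simp_all add: group_ring_def)
  have "{g. conv (Zn n) a b g \<noteq> 0} \<subseteq> ?AB"
    using G.conv_closed [OF a b] by (simp only: mult_free_Abelian_group)
  then have "(\<Sum>g | conv (Zn n) a b g \<noteq> 0. conv (Zn n) a b g) = (\<Sum>g\<in>?AB. conv (Zn n) a b g)"
    using a(1) b(1) by (intro sum.mono_neutral_left) simp_all
  also have "\<dots> = (\<Sum>g\<in>?AB. \<Sum>h\<in>?A. \<Sum>k\<in>?B. if h + k = g then a h * b k else 0)"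
    unfolding G.conv_alt [OF a order_refl b order_refl] by (simp only: mult_free_Abelian_group)
  also have "\<dots> = (\<Sum>h\<in>?A. \<Sum>k\<in>?B. \<Sum>g\<in>?AB. if h + k = g then a h * b k else 0)"
    by (subst sum.swap, rule sum.cong [OF refl], rule sum.swap)
  also have "\<dots> = (\<Sum>h\<in>?A. \<Sum>k\<in>?B. a h * b k)"
  proof (intro sum.cong refl)
    fix h k assume hk: "h \<in> ?A" "k \<in> ?B"
    have "finite ?AB" using a(1) b(1) by simp
    then have "(\<Sum>g\<in>?AB. if h + k = g then a h * b k else 0) = (if h + k \<in> ?AB then a h * b k else 0)"
      by (rule sum.delta')
    moreover have "h + k \<in> ?AB" using hk by (intro image_eqI [of _ _ "(h, k)"]) simp_all
    ultimately show "(\<Sum>g\<in>?AB. if h + k = g then a h * b k else 0) = a h * b k" by (simp only: if_True)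
  qed
  also have "\<dots> = (\<Sum>h\<in>?A. a h) * (\<Sum>k\<in>?B. b k)" by (rule sum_product [symmetric])
  finally show ?thesis .
qed

lemma sum_support_add:
  fixes a b :: "(nat \<Rightarrow>\<^sub>0 int) \<Rightarrow> int"
  assumes "a \<in> zg n" "b \<in> zg n"
  shows "(\<Sum>g | a g + b g \<noteq> 0. a g + b g) = (\<Sum>g | a g \<noteq> 0. a g) + (\<Sum>g | b g \<noteq> 0. b g)"
  using Sum_any.distrib [of a b] assms by (simp only: Sum_any.expand_set zg_iff)

lemma fiber_sum_total:
  assumes "a \<in> zg n"
  shows "fiber_sum n 0 a = (\<Sum>g | a g \<noteq> 0. a g)"
proof -
  have "(if \<forall>j\<ge>n. Poly_Mapping.lookup h j = Poly_Mapping.lookup 0 j then a h else 0) = a h" for h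
  proof (cases "a h = 0")
    case False
    then have "Poly_Mapping.keys h \<subseteq> {..<n}" using assms by (simp add: zg_iff)
    then have "Poly_Mapping.lookup h j = 0" if "j \<ge> n" for j
      using that by (auto simp: in_keys_iff subset_iff not_less)
    then show ?thesis by simp
  qed simp
  then show ?thesis unfolding fiber_sum_def Sum_any.expand_set by simp
qed

lemma augmentation_linear:
  "augmentation n \<in> lin_maps (int_group_ring (Zn n)) (koszul n 0) trivial_module"
    (is "_ \<in> lin_maps ?R ?P _")
proof -
  interpret P: module ?R ?P by (rule koszul_module)
  have e: "{} \<in> koszul_basis n 0" by (simp add: koszul_basis_def)
  show ?thesis
    unfolding lin_maps_def
  proof (intro CollectI conjI ballI PiE_I)
    fix x y assume x: "x \<in> carrier ?P" and y: "y \<in> carrier ?P"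
    have "(x \<oplus>\<^bsub>?P\<^esub> y) {} = (\<lambda>g. x {} g + y {} g)"
      using e by (simp add: koszul_def free_module_def group_ring_def)
    then show "augmentation n (x \<oplus>\<^bsub>?P\<^esub> y) = augmentation n x \<oplus>\<^bsub>trivial_module\<^esub> augmentation n y"
      using x y sum_support_add [OF koszul_mem [OF x e] koszul_mem [OF y e]]
      by (simp add: augmentation_def trivial_module_def)
  next
    fix r x assume r: "r \<in> carrier ?R" and x: "x \<in> carrier ?P"
    have "(r \<odot>\<^bsub>?P\<^esub> x) {} = conv (Zn n) r (x {})"
      using e by (simp add: koszul_def free_module_def group_ring_def)
    then show "augmentation n (r \<odot>\<^bsub>?P\<^esub> x) = r \<odot>\<^bsub>trivial_module\<^esub> augmentation n x"
      using r x sum_support_conv [OF r koszul_mem [OF x e]]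
      by (simp add: augmentation_def trivial_module_def)
  qed (simp_all add: augmentation_def trivial_module_def)
qed

lemma koszul_diff_image_iff:
  assumes v: "v \<in> carrier (koszul n k)"
    and w: "\<And>S. S \<in> koszul_basis n (Suc k) \<Longrightarrow> w S \<in> zg n" "\<And>T. T \<in> koszul_basis n k \<Longrightarrow> kd n w T = v T"
  shows "v \<in> koszul_diff n k ` carrier (koszul n (Suc k))"
proof
  let ?w = "\<lambda>S\<in>koszul_basis n (Suc k). w S"
  show m: "?w \<in> carrier (koszul n (Suc k))"
    unfolding koszul_carrier using w(1) by simp
  have "kd n ?w T = v T" if "T \<in> koszul_basis n k" for T
    using w(2) [OF that] kd_cong [of n k ?w w, OF _ that] by simp
  then have "(\<lambda>T\<in>koszul_basis n k. kd n ?w T) = restrict v (koszul_basis n k)"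
    by (intro restrict_ext)
  also have "\<dots> = v" using v unfolding koszul_carrier by (rule PiE_restrict)
  finally show "v = koszul_diff n k ?w" unfolding koszul_diff_kd [OF m] by (rule sym)
qed

theorem koszul_exact:
  "{v \<in> carrier (koszul n (Suc k)). koszul_diff n k v = \<zero>\<^bsub>koszul n k\<^esub>} =
     koszul_diff n (Suc k) ` carrier (koszul n (Suc (Suc k)))"
proof (intro equalityI subsetI)
  fix v assume "v \<in> {v \<in> carrier (koszul n (Suc k)). koszul_diff n k v = \<zero>\<^bsub>koszul n k\<^esub>}"
  then have v: "v \<in> carrier (koszul n (Suc k))" and z: "koszul_diff n k v = \<zero>\<^bsub>koszul n k\<^esub>" by simp_all
  have "kd n v T g = 0" if "T \<in> koszul_basis n k" for T g
    using fun_cong [OF fun_cong [OF z, of T], of g] that by (simp add: koszul_diff_kd [OF v] koszul_zero)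
  from kd_exact [OF order_refl koszul_mem [OF v] this]
  obtain w where "\<And>S. S \<in> koszul_basis n (Suc (Suc k)) \<Longrightarrow> w S \<in> zg n"
      "\<And>T. T \<in> koszul_basis n (Suc k) \<Longrightarrow> kd n w T = v T" by blast
  then show "v \<in> koszul_diff n (Suc k) ` carrier (koszul n (Suc (Suc k)))"
    by (rule koszul_diff_image_iff [OF v])
next
  fix v assume "v \<in> koszul_diff n (Suc k) ` carrier (koszul n (Suc (Suc k)))"
  then obtain w where w: "w \<in> carrier (koszul n (Suc (Suc k)))" and v: "v = koszul_diff n (Suc k) w" by blast
  have vm: "v \<in> carrier (koszul n (Suc k))"
    using koszul_diff_linear [of n "Suc k"] w unfolding v lin_maps_def by blast
  moreover have "koszul_diff n k v = \<zero>\<^bsub>koszul n k\<^esub>"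
    unfolding koszul_diff_kd [OF vm] koszul_zero
  proof (rule restrict_ext)
    fix T assume T: "T \<in> koszul_basis n k"
    have "kd n v T = kd n (kd n w) T"
      by (rule kd_cong [OF _ T]) (simp add: v koszul_diff_kd [OF w])
    also have "\<dots> = (\<lambda>g. 0)"
      by (rule ext, rule kd_kd) (use T in \<open>simp add: koszul_basis_def\<close>)
    finally show "kd n v T = (\<lambda>g. 0)" .
  qed
  ultimately show "v \<in> {v \<in> carrier (koszul n (Suc k)). koszul_diff n k v = \<zero>\<^bsub>koszul n k\<^esub>}" by simp
qed

theorem augmentation_exact:
  "{v \<in> carrier (koszul n 0). augmentation n v = 0} = koszul_diff n 0 ` carrier (koszul n 1)"
proof (intro equalityI subsetI)
  have e: "{} \<in> koszul_basis n 0" by (simp add: koszul_basis_def)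
  have only: "T = {}" if "T \<in> koszul_basis n 0" for T
    using that finite_subset [of T "{..<n}"] by (auto simp: koszul_basis_def)
  {
    fix v assume "v \<in> {v \<in> carrier (koszul n 0). augmentation n v = 0}"
    then have v: "v \<in> carrier (koszul n 0)" and z: "augmentation n v = 0" by simp_all
    have a: "v {} \<in> zg n" by (rule koszul_mem [OF v e])
    then obtain w where w: "\<And>S. w S \<in> zg n" "{g. v {} g - kd n w {} g \<noteq> 0} \<subseteq> low_zero n"
      using reduction [OF order_refl a] by blast
    let ?r = "\<lambda>g. v {} g - kd n w {} g"
    have kw: "kd n w {} \<in> zg n" by (rule kd_mem [OF order_refl w(1) e])
    have "fiber_sum n 0 (\<lambda>g. v {} g + (-1) * kd n w {} g) = fiber_sum n 0 (v {}) + fiber_sum n 0 (\<lambda>g. (-1) * kd n w {} g)"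
      using a zg_scale [OF kw, of "-1"] unfolding zg_iff by (intro fiber_sum_add) blast+
    also have "fiber_sum n 0 (\<lambda>g. (-1) * kd n w {} g) = (-1) * fiber_sum n 0 (kd n w {})"
      using kw unfolding zg_iff by (intro fiber_sum_scale) blast
    also have "fiber_sum n 0 (kd n w {}) = 0"
      by (rule fiber_sum_kd [OF order_refl w(1)])
    also have "fiber_sum n 0 (v {}) = 0"
      using z v by (simp add: fiber_sum_total [OF a] augmentation_def)
    finally have "fiber_sum n 0 ?r = 0" by simp
    then have r0: "?r 0 = 0"
      using fiber_sum_low_zero [OF w(2), of 0] by (simp add: low_zero_def)
    have rz: "?r \<in> zg n" by (rule zg_diff [OF a kw])
    have "?r g = 0" for g
    proof (rule ccontr)
      assume ne: "?r g \<noteq> 0"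
      then have l: "g \<in> low_zero n" using w(2) by blast
      have k: "Poly_Mapping.keys g \<subseteq> {..<n}" using rz ne unfolding zg_iff by blast
      have "Poly_Mapping.lookup g i = 0" for i
        using l k by (cases "i < n") (auto simp: low_zero_def in_keys_iff subset_iff)
      then have "g = 0" by (intro poly_mapping_eqI) simp
      then show False using ne r0 by simp
    qed
    then have "kd n w {} = v {}" by (intro ext) simp
    then have "kd n w T = v T" if "T \<in> koszul_basis n 0" for T using only [OF that] by simp
    with w(1) show "v \<in> koszul_diff n 0 ` carrier (koszul n 1)"
      unfolding One_nat_def by (intro koszul_diff_image_iff [OF v])
  next
    fix v assume "v \<in> koszul_diff n 0 ` carrier (koszul n 1)"
    then obtain w where w: "w \<in> carrier (koszul n (Suc 0))" and v: "v = koszul_diff n 0 w" by auto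
    have vm: "v \<in> carrier (koszul n 0)"
      using koszul_diff_linear [of n 0] w unfolding v lin_maps_def by blast
    have "v {} = kd n w {}" using e by (simp add: v koszul_diff_kd [OF w])
    moreover have "fiber_sum n 0 (kd n w {}) = 0"
      by (rule fiber_sum_kd [OF order_refl]) (use koszul_mem [OF w] in simp)
    ultimately have "augmentation n v = 0"
      using vm fiber_sum_total [OF koszul_mem [OF vm e]] by (simp add: augmentation_def)
    then show "v \<in> {v \<in> carrier (koszul n 0). augmentation n v = 0}" using vm by simp
  }
qed

theorem augmentation_surj: "augmentation n ` carrier (koszul n 0) = UNIV"
proof (intro equalityI subsetI UNIV_I)
  fix c :: int
  let ?v = "\<lambda>S\<in>koszul_basis n 0. \<lambda>g. if g = (0 :: nat \<Rightarrow>\<^sub>0 int) then c else 0"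
  have "(\<lambda>g. if g = (0 :: nat \<Rightarrow>\<^sub>0 int) then c else 0) \<in> zg n" by (auto simp: zg_iff)
  then have v: "?v \<in> carrier (koszul n 0)" unfolding koszul_carrier by simp
  have e: "{} \<in> koszul_basis n 0" by (simp add: koszul_basis_def)
  have "augmentation n ?v = Sum_any (\<lambda>g. if g = (0 :: nat \<Rightarrow>\<^sub>0 int) then c else 0)"
    using v e by (simp add: augmentation_def Sum_any.expand_set)
  also have "\<dots> = c" by simp
  finally show "c \<in> augmentation n ` carrier (koszul n 0)" using v by (intro image_eqI) simp_all
qed

end

theory Submission
  imports Defs
begin

text \<open>
  Write \<open>I\<^sub>n\<close> for the ideal of \<open>C(\<T>\<^sup>n)\<close> generated by the functions \<open>z\<^sub>i - 1\<close>.  Composition with the projection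
  \<open>\<T>\<^sup>n\<^sup>+\<^sup>1 \<rightarrow> \<T>\<^sup>n\<close> is a homomorphism \<open>C(\<T>\<^sup>n) \<rightarrow> C(\<T>\<^sup>n\<^sup>+\<^sup>1)\<close> of unital \<open>\<complex>\<close>-algebras that maps \<open>I\<^sub>n\<close> into \<open>I\<^sub>n\<^sub>+\<^sub>1\<close>.
  If the image of \<open>f\<close> lies in \<open>I\<^sub>n\<^sub>+\<^sub>1\<close>, then restricting an equation that shows this to the subtorus where the
  last coordinate is \<open>1\<close> shows \<open>f \<in> I\<^sub>n\<close> (\<open>pullback_ideal_iff\<close>).  So the induced homomorphism of the quotients
  is injective (\<open>torus_quotient_embedding\<close>), and it remains to see that the identification of
  \<open>H\<^sup>n(\<int>\<^sup>n, C\<^sup>*\<^sub>r\<^sub>e\<^sub>d(\<int>\<^sup>n))\<close> with \<open>C(\<T>\<^sup>n) / I\<^sub>n\<close> by \<open>\<phi> \<mapsto> \<phi>(1)\<close> is a well-defined isomorphism of groups for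
  \<open>n \<ge> 1\<close> (\<open>zn_ident_iso\<close>); the embedding is transported along it.

  The analytic part of the identification is the Fourier transform.  For \<open>\<alpha> \<in> \<complex>[\<int>\<^sup>n]\<close> the operator norm equals
  the supremum norm of the associated Laurent polynomial.  One inequality (\<open>conv_norm_le\<close>) follows from a finite
  form of Parseval's equation, with averages over roots of unity of large order; the other
  (\<open>laurent_eval_le_op_bound\<close>) from testing the operator on characters that are cut off to large cubes.  Hence
  norm limits of convolution operators correspond to uniform limits of Laurent polynomials.  By
  Stone-Weierstrass the latter are all the continuous functions, so that the transform is a bijection
  \<open>C\<^sup>*\<^sub>r\<^sub>e\<^sub>d(\<int>\<^sup>n) \<rightarrow> C(\<T>\<^sup>n)\<close> (\<open>fourier_bij\<close>), which is additive and takes the action of \<open>\<int>[\<int>\<^sup>n]\<close> to multiplication.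

  The algebraic part is the Koszul complex.  In degree \<open>n\<close> it has one generator and it is zero above, so by the
  transform the group of \<open>n\<close>-cocycles is \<open>C(\<T>\<^sup>n)\<close>.  A cochain of degree \<open>n - 1\<close> is a family of \<open>n\<close> arbitrary
  continuous functions \<open>f\<^sub>i\<close> (\<open>lin_maps_exists\<close>), and its coboundary is \<open>\<Sum> \<plusminus>(z\<^sub>i - 1) f\<^sub>i\<close>; the coboundaries
  therefore make up exactly \<open>I\<^sub>n\<close> (\<open>coboundary_iff\<close>).
\<close>

section \<open>The Hilbert space norm through finite partial sums\<close>

text \<open>The Euclidean norm of the part of \<open>\<beta>\<close> that lives on \<open>F\<close>.  For finite \<open>F\<close> these norms determine both
  membership in \<open>L\<^sup>2(G)\<close> and the norm there, so that estimates reduce to finite sums.\<close>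

abbreviation fin_norm :: "'g set \<Rightarrow> ('g \<Rightarrow> complex) \<Rightarrow> real"
  where "fin_norm F \<beta> \<equiv> L2_set (\<lambda>g. cmod (\<beta> g)) F"

lemma L2_norm_nonneg: "0 \<le> L2_norm G \<beta>"
  by (simp add: L2_norm_def infsum_nonneg)

lemma fin_norm_le_L2_norm:
  assumes "\<beta> \<in> L2 G" "finite F" "F \<subseteq> carrier G"
  shows "fin_norm F \<beta> \<le> L2_norm G \<beta>"
  using assms unfolding L2_set_def L2_norm_def L2_def
  by (intro real_sqrt_le_mono finite_sum_le_infsum) auto

lemma L2_norm_leI:
  assumes "\<beta> \<in> L2 G" "\<And>F. finite F \<Longrightarrow> F \<subseteq> carrier G \<Longrightarrow> fin_norm F \<beta> \<le> B"
  shows "L2_norm G \<beta> \<le> B"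
proof -
  have B: "0 \<le> B" using assms(2) [of "{}"] by simp
  have "(\<Sum>\<^sub>\<infinity>g\<in>carrier G. (cmod (\<beta> g))\<^sup>2) \<le> B\<^sup>2"
  proof (rule infsum_le_finite_sums)
    show "(\<Sum>g\<in>F. (cmod (\<beta> g))\<^sup>2) \<le> B\<^sup>2" if "finite F" "F \<subseteq> carrier G" for F
      using assms(2) [OF that] by (simp add: L2_set_def real_sqrt_le_iff' sqrt_le_D)
  qed (use assms(1) in \<open>simp add: L2_def\<close>)
  then show ?thesis
    unfolding L2_norm_def using B by (intro real_le_lsqrt) auto
qed

lemma L2I:
  assumes "\<And>g. g \<notin> carrier G \<Longrightarrow> \<beta> g = 0"
    and B: "\<And>F. finite F \<Longrightarrow> F \<subseteq> carrier G \<Longrightarrow> fin_norm F \<beta> \<le> B"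
  shows "\<beta> \<in> L2 G"
  unfolding L2_def
proof (intro CollectI conjI allI impI nonneg_bdd_above_summable_on)
  show "bdd_above (sum (\<lambda>g. (cmod (\<beta> g))\<^sup>2) ` {F. F \<subseteq> carrier G \<and> finite F})"
  proof (rule bdd_aboveI2)
    fix F assume "F \<in> {F. F \<subseteq> carrier G \<and> finite F}"
    then have "fin_norm F \<beta> \<le> B" by (intro B) auto
    then show "(\<Sum>g\<in>F. (cmod (\<beta> g))\<^sup>2) \<le> B\<^sup>2"
      by (simp add: L2_set_def sqrt_le_D)
  qed
qed (use assms(1) in auto)

lemma L2_outside: "\<beta> \<in> L2 G \<Longrightarrow> g \<notin> carrier G \<Longrightarrow> \<beta> g = 0"
  by (simp add: L2_def)

lemma fin_norm_add: "fin_norm F (\<lambda>g. \<beta> g + \<gamma> g) \<le> fin_norm F \<beta> + fin_norm F \<gamma>"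
proof -
  have "fin_norm F (\<lambda>g. \<beta> g + \<gamma> g) \<le> L2_set (\<lambda>g. cmod (\<beta> g) + cmod (\<gamma> g)) F"
    by (intro L2_set_mono norm_triangle_ineq) auto
  also have "\<dots> \<le> fin_norm F \<beta> + fin_norm F \<gamma>" by (rule L2_set_triangle_ineq)
  finally show ?thesis .
qed

lemma fin_norm_scale: "fin_norm F (\<lambda>g. c * \<beta> g) = cmod c * fin_norm F \<beta>"
  by (simp add: norm_mult L2_set_right_distrib)

lemma
  assumes "\<beta> \<in> L2 G" "\<gamma> \<in> L2 G"
  shows L2_add: "(\<lambda>g. \<beta> g + \<gamma> g) \<in> L2 G"
    and L2_norm_add: "L2_norm G (\<lambda>g. \<beta> g + \<gamma> g) \<le> L2_norm G \<beta> + L2_norm G \<gamma>"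
proof -
  have *: "fin_norm F (\<lambda>g. \<beta> g + \<gamma> g) \<le> L2_norm G \<beta> + L2_norm G \<gamma>"
    if "finite F" "F \<subseteq> carrier G" for F
    using fin_norm_add [of \<beta> \<gamma> F] fin_norm_le_L2_norm [OF assms(1) that] fin_norm_le_L2_norm [OF assms(2) that]
    by linarith
  show m: "(\<lambda>g. \<beta> g + \<gamma> g) \<in> L2 G"
    by (rule L2I [OF _ *]) (use assms in \<open>auto simp: L2_outside\<close>)
  show "L2_norm G (\<lambda>g. \<beta> g + \<gamma> g) \<le> L2_norm G \<beta> + L2_norm G \<gamma>"
    by (rule L2_norm_leI [OF m *])
qed

lemma
  assumes "\<beta> \<in> L2 G"
  shows L2_scale: "(\<lambda>g. c * \<beta> g) \<in> L2 G"
    and L2_norm_scale_le: "L2_norm G (\<lambda>g. c * \<beta> g) \<le> cmod c * L2_norm G \<beta>"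
proof -
  have *: "fin_norm F (\<lambda>g. c * \<beta> g) \<le> cmod c * L2_norm G \<beta>"
    if "finite F" "F \<subseteq> carrier G" for F
    using fin_norm_le_L2_norm [OF assms that] by (simp add: fin_norm_scale mult_left_mono)
  show m: "(\<lambda>g. c * \<beta> g) \<in> L2 G"
    by (rule L2I [OF _ *]) (use assms in \<open>auto simp: L2_outside\<close>)
  show "L2_norm G (\<lambda>g. c * \<beta> g) \<le> cmod c * L2_norm G \<beta>"
    by (rule L2_norm_leI [OF m *])
qed

lemma L2_norm_scale: 
  assumes "\<beta> \<in> L2 G"
  shows "L2_norm G (\<lambda>g. c * \<beta> g) = cmod c * L2_norm G \<beta>"
proof (rule antisym [OF L2_norm_scale_le [OF assms]])
  show "cmod c * L2_norm G \<beta> \<le> L2_norm G (\<lambda>g. c * \<beta> g)"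
  proof (cases "c = 0")
    case False
    have "L2_norm G (\<lambda>g. inverse c * (c * \<beta> g)) \<le> cmod (inverse c) * L2_norm G (\<lambda>g. c * \<beta> g)"
      by (rule L2_norm_scale_le [OF L2_scale [OF assms]])
    then show ?thesis using False by (simp add: norm_divide field_simps)
  qed (simp add: L2_norm_nonneg)
qed

lemma L2_diff: "\<beta> \<in> L2 G \<Longrightarrow> \<gamma> \<in> L2 G \<Longrightarrow> (\<lambda>g. \<beta> g - \<gamma> g) \<in> L2 G"
  using L2_add [of \<beta> G "\<lambda>g. (-1) * \<gamma> g"] L2_scale [of \<gamma> G "-1"] by simp

lemma L2_norm_zero: "L2_norm G (\<lambda>g. 0) = 0"
  by (simp add: L2_norm_def)

lemma norm_le_L2_norm:
  assumes "\<beta> \<in> L2 G" shows "cmod (\<beta> g) \<le> L2_norm G \<beta>"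
proof (cases "g \<in> carrier G")
  case True
  then show ?thesis using fin_norm_le_L2_norm [OF assms, of "{g}"] by simp
next
  case False
  then show ?thesis using assms by (simp add: L2_outside L2_norm_nonneg)
qed

lemma
  assumes "finite S" "S \<subseteq> carrier G" "\<And>g. g \<notin> S \<Longrightarrow> \<beta> g = 0"
  shows L2_finite_support: "\<beta> \<in> L2 G"
    and L2_norm_finite_support: "L2_norm G \<beta> = fin_norm S \<beta>"
proof -
  have *: "fin_norm F \<beta> \<le> fin_norm S \<beta>" if "finite F" for F
  proof -
    have "(\<Sum>g\<in>F. (cmod (\<beta> g))\<^sup>2) = (\<Sum>g\<in>F \<inter> S. (cmod (\<beta> g))\<^sup>2)"
      using that assms(3) by (intro sum.mono_neutral_right) auto
    also have "\<dots> \<le> (\<Sum>g\<in>S. (cmod (\<beta> g))\<^sup>2)"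
      using assms(1) by (intro sum_mono2) auto
    finally show ?thesis by (simp add: L2_set_def)
  qed
  show m: "\<beta> \<in> L2 G"
    by (rule L2I [of _ _ "fin_norm S \<beta>"]) (use assms * in auto)
  show "L2_norm G \<beta> = fin_norm S \<beta>"
    by (intro antisym L2_norm_leI [OF m] fin_norm_le_L2_norm [OF m assms(1,2)] *)
qed

section \<open>Bounded operators\<close>

text \<open>The constant \<open>c\<close> bounds the operator \<open>D\<close> on \<open>L\<^sup>2(G)\<close>.  For bounded linear \<open>D\<close> and \<open>c \<ge> 0\<close> this says that
  the operator norm is at most \<open>c\<close>.\<close>

definition op_bounded_by ::
    "('g, 'x) monoid_scheme \<Rightarrow> (('g \<Rightarrow> complex) \<Rightarrow> 'g \<Rightarrow> complex) \<Rightarrow> real \<Rightarrow> bool" where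
  "op_bounded_by G D c \<longleftrightarrow> (\<forall>\<beta>\<in>L2 G. L2_norm G (D \<beta>) \<le> c * L2_norm G \<beta>)"

lemma bounded_opsI:
  assumes "D \<in> extensional (L2 G)"
    and "\<And>\<beta>. \<beta> \<in> L2 G \<Longrightarrow> D \<beta> \<in> L2 G"
    and "\<And>\<beta> \<gamma>. \<beta> \<in> L2 G \<Longrightarrow> \<gamma> \<in> L2 G \<Longrightarrow> D (\<lambda>g. \<beta> g + \<gamma> g) = (\<lambda>g. D \<beta> g + D \<gamma> g)"
    and "\<And>c \<beta>. \<beta> \<in> L2 G \<Longrightarrow> D (\<lambda>g. c * \<beta> g) = (\<lambda>g. c * D \<beta> g)"
    and "op_bounded_by G D C"
  shows "D \<in> bounded_ops G"
  using assms unfolding bounded_ops_def op_bounded_by_def by (auto simp: PiE_iff)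

lemma bounded_opsD:
  assumes "D \<in> bounded_ops G"
  shows "D \<in> extensional (L2 G)"
    and "\<And>\<beta>. \<beta> \<in> L2 G \<Longrightarrow> D \<beta> \<in> L2 G"
    and "\<And>\<beta> \<gamma>. \<beta> \<in> L2 G \<Longrightarrow> \<gamma> \<in> L2 G \<Longrightarrow> D (\<lambda>g. \<beta> g + \<gamma> g) = (\<lambda>g. D \<beta> g + D \<gamma> g)"
    and "\<And>c \<beta>. \<beta> \<in> L2 G \<Longrightarrow> D (\<lambda>g. c * \<beta> g) = (\<lambda>g. c * D \<beta> g)"
    and "\<exists>C\<ge>0. op_bounded_by G D C"
proof -
  obtain C where C: "\<And>\<beta>. \<beta> \<in> L2 G \<Longrightarrow> L2_norm G (D \<beta>) \<le> C * L2_norm G \<beta>"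
    using assms unfolding bounded_ops_def by blast
  have "L2_norm G (D \<beta>) \<le> \<bar>C\<bar> * L2_norm G \<beta>" if "\<beta> \<in> L2 G" for \<beta>
    using C [OF that] mult_right_mono [OF abs_ge_self L2_norm_nonneg, of C G \<beta>] by linarith
  then show "\<exists>C\<ge>0. op_bounded_by G D C"
    unfolding op_bounded_by_def by (intro exI [of _ "\<bar>C\<bar>"]) auto
qed (use assms in \<open>auto simp: bounded_ops_def PiE_iff\<close>)

text \<open>The nonempty carrier provides unit vectors.  Without them the supremum would be over the empty set.\<close>

lemma op_norm_le_iff:
  assumes "D \<in> bounded_ops G" and g0: "g0 \<in> carrier G"
  shows "op_norm G D \<le> c \<longleftrightarrow> 0 \<le> c \<and> op_bounded_by G D c"
proof -
  note D = bounded_opsD [OF assms(1)]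
  let ?U = "{\<beta> \<in> L2 G. L2_norm G \<beta> = 1}"
  let ?u = "\<lambda>g. if g = g0 then 1 else 0 :: complex"
  have u: "?u \<in> L2 G" "L2_norm G ?u = 1"
    using g0 L2_finite_support [of "{g0}" G ?u] L2_norm_finite_support [of "{g0}" G ?u] by auto
  then have "?U \<noteq> {}" by blast
  obtain C where C: "0 \<le> C" "op_bounded_by G D C" using D(5) by blast
  have bdd: "bdd_above ((\<lambda>\<beta>. L2_norm G (D \<beta>)) ` ?U)"
    using C unfolding op_bounded_by_def by (intro bdd_aboveI2 [of _ _ C]) fastforce
  have iff: "op_norm G D \<le> c \<longleftrightarrow> (\<forall>\<beta>\<in>?U. L2_norm G (D \<beta>) \<le> c)"
    unfolding op_norm_def by (rule cSUP_le_iff [OF \<open>?U \<noteq> {}\<close> bdd])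
  show ?thesis
  proof
    assume "op_norm G D \<le> c"
    then have U: "L2_norm G (D \<beta>) \<le> c" if "\<beta> \<in> ?U" for \<beta> using iff that by blast
    have "0 \<le> c" using U [of ?u] u order_trans [OF L2_norm_nonneg] by auto
    moreover have "L2_norm G (D \<beta>) \<le> c * L2_norm G \<beta>" if \<beta>: "\<beta> \<in> L2 G" for \<beta>
    proof (cases "L2_norm G \<beta> = 0")
      case True
      then show ?thesis using C(2) \<beta> unfolding op_bounded_by_def by fastforce
    next
      case False
      define r where "r = L2_norm G \<beta>"
      have r: "r > 0" using False L2_norm_nonneg [of G \<beta>] unfolding r_def by linarith
      let ?b = "\<lambda>g. complex_of_real (inverse r) * \<beta> g"
      have "?b \<in> ?U" using L2_scale [OF \<beta>, of "complex_of_real (inverse r)"]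
          L2_norm_scale [OF \<beta>, of "complex_of_real (inverse r)"] r by (simp add: r_def [symmetric] norm_inverse)
      from U [OF this] have "inverse r * L2_norm G (D \<beta>) \<le> c"
        using r by (simp add: D(4) [OF \<beta>] L2_norm_scale [OF D(2) [OF \<beta>]] norm_inverse)
      then show ?thesis using r by (simp add: r_def [symmetric] field_simps)
    qed
    ultimately show "0 \<le> c \<and> op_bounded_by G D c" unfolding op_bounded_by_def by blast
  next
    assume "0 \<le> c \<and> op_bounded_by G D c"
    then show "op_norm G D \<le> c" unfolding iff op_bounded_by_def by fastforce
  qed
qed

text \<open>The difference \<open>S - T\<close> of operators, in the form in which it occurs in \<^const>\<open>op_dist\<close>.\<close>

abbreviation op_diff where
  "op_diff G S T \<equiv> (\<lambda>\<beta>\<in>L2 G. \<lambda>g. S \<beta> g - T \<beta> g)"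

lemma op_bounded_by_combine:
  assumes "\<And>\<beta>. \<beta> \<in> L2 G \<Longrightarrow> S \<beta> \<in> L2 G" "\<And>\<beta>. \<beta> \<in> L2 G \<Longrightarrow> T \<beta> \<in> L2 G"
    and "op_bounded_by G S c" "op_bounded_by G T d"
  shows "op_bounded_by G (\<lambda>\<beta>\<in>L2 G. \<lambda>g. S \<beta> g + k * T \<beta> g) (c + cmod k * d)"
  unfolding op_bounded_by_def
proof
  fix \<beta> assume \<beta>: "\<beta> \<in> L2 G"
  have "L2_norm G (\<lambda>g. S \<beta> g + k * T \<beta> g) \<le> L2_norm G (S \<beta>) + L2_norm G (\<lambda>g. k * T \<beta> g)"
    by (intro L2_norm_add L2_scale assms \<beta>)
  also have "L2_norm G (\<lambda>g. k * T \<beta> g) = cmod k * L2_norm G (T \<beta>)"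
    by (intro L2_norm_scale assms \<beta>)
  also have "L2_norm G (S \<beta>) + cmod k * L2_norm G (T \<beta>) \<le> c * L2_norm G \<beta> + cmod k * (d * L2_norm G \<beta>)"
    using assms \<beta> unfolding op_bounded_by_def by (intro add_mono mult_left_mono) auto
  finally show "L2_norm G ((\<lambda>\<beta>\<in>L2 G. \<lambda>g. S \<beta> g + k * T \<beta> g) \<beta>) \<le> (c + cmod k * d) * L2_norm G \<beta>"
    using \<beta> by (simp add: algebra_simps)
qed

lemma bounded_ops_combine:
  assumes "S \<in> bounded_ops G" "T \<in> bounded_ops G"
  shows "(\<lambda>\<beta>\<in>L2 G. \<lambda>g. S \<beta> g + k * T \<beta> g) \<in> bounded_ops G"
proof -
  note S = bounded_opsD [OF assms(1)] and T = bounded_opsD [OF assms(2)]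
  obtain c d where "op_bounded_by G S c" "op_bounded_by G T d" using S(5) T(5) by blast
  from op_bounded_by_combine [OF S(2) T(2) this] show ?thesis
    by (rule bounded_opsI [rotated -1])
       (auto simp: S T L2_add L2_scale algebra_simps)
qed

lemma op_bounded_by_diff:
  assumes "\<And>\<beta>. \<beta> \<in> L2 G \<Longrightarrow> S \<beta> \<in> L2 G" "\<And>\<beta>. \<beta> \<in> L2 G \<Longrightarrow> T \<beta> \<in> L2 G"
    and "op_bounded_by G S c" "op_bounded_by G T d"
  shows "op_bounded_by G (op_diff G S T) (c + d)"
  using op_bounded_by_combine [OF assms, of "-1"] by simp

lemma bounded_ops_diff:
  assumes "S \<in> bounded_ops G" "T \<in> bounded_ops G"
  shows "op_diff G S T \<in> bounded_ops G"
  using bounded_ops_combine [OF assms, of "-1"] by simp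

lemma op_bounded_by_cong:
  "(\<And>\<beta>. \<beta> \<in> L2 G \<Longrightarrow> S \<beta> = T \<beta>) \<Longrightarrow> op_bounded_by G S c \<longleftrightarrow> op_bounded_by G T c"
  by (simp add: op_bounded_by_def)

lemma bounded_ops_compose:
  assumes "S \<in> bounded_ops G" "T \<in> bounded_ops G"
  shows "compose (L2 G) S T \<in> bounded_ops G"
proof -
  note S = bounded_opsD [OF assms(1)] and T = bounded_opsD [OF assms(2)]
  obtain c d where c: "0 \<le> c" "op_bounded_by G S c" and d: "op_bounded_by G T d" using S(5) T(5) by blast
  have "op_bounded_by G (compose (L2 G) S T) (c * d)"
    unfolding op_bounded_by_def
  proof
    fix \<beta> assume \<beta>: "\<beta> \<in> L2 G"
    have "L2_norm G (S (T \<beta>)) \<le> c * L2_norm G (T \<beta>)"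
      using c T(2) [OF \<beta>] unfolding op_bounded_by_def by blast
    also have "\<dots> \<le> c * (d * L2_norm G \<beta>)"
      using c d \<beta> unfolding op_bounded_by_def by (intro mult_left_mono) auto
    finally show "L2_norm G (compose (L2 G) S T \<beta>) \<le> c * d * L2_norm G \<beta>"
      using \<beta> by (simp add: compose_eq mult.assoc)
  qed
  then show ?thesis
    by (rule bounded_opsI [rotated -1])
       (auto simp: S T L2_add L2_scale compose_eq)
qed

lemma op_dist_le_iff:
  assumes "S \<in> bounded_ops G" "T \<in> bounded_ops G" "g0 \<in> carrier G"
  shows "op_dist G S T \<le> e \<longleftrightarrow> 0 \<le> e \<and> op_bounded_by G (op_diff G S T) e"
  unfolding op_dist_def by (rule op_norm_le_iff [OF bounded_ops_diff [OF assms(1,2)] assms(3)])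

lemma bounded_ops_eq_0:
  assumes "D \<in> bounded_ops G" "op_bounded_by G D 0"
  shows "D = (\<lambda>\<beta>\<in>L2 G. \<lambda>g. 0)"
proof (rule extensionalityI [OF bounded_opsD(1) [OF assms(1)]])
  fix \<beta> assume \<beta>: "\<beta> \<in> L2 G"
  have "L2_norm G (D \<beta>) \<le> 0" using assms(2) \<beta> by (simp add: op_bounded_by_def)
  then have "cmod (D \<beta> g) \<le> 0" for g
    using norm_le_L2_norm [OF bounded_opsD(2) [OF assms(1) \<beta>], of g] by linarith
  then show "D \<beta> = (\<lambda>\<beta>\<in>L2 G. \<lambda>g. 0) \<beta>" using \<beta> by auto
qed simp

section \<open>The ring \<open>C(\<T>\<^sup>n)\<close> modulo its ideal\<close>

text \<open>The ring \<open>C(\<T>\<^sup>n)\<close>.\<close>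

abbreviation CT where "CT \<equiv> torus_functions"

lemma torus_iff: "z \<in> torus n \<longleftrightarrow> (\<forall>i. (i < n \<longrightarrow> cmod (z i) = 1) \<and> (\<not> i < n \<longrightarrow> z i = undefined))"
  unfolding torus_def PiE_iff extensional_def by blast

lemma CT_carrier: "f \<in> carrier (CT n) \<longleftrightarrow> f \<in> extensional (torus n) \<and> continuous_on (torus n) f"
  by (simp add: torus_functions_def)

lemma CT_restrict: "continuous_on (torus n) f \<Longrightarrow> restrict f (torus n) \<in> carrier (CT n)"
  by (simp add: CT_carrier continuous_on_restrict)

lemma CT_continuous: "f \<in> carrier (CT n) \<Longrightarrow> continuous_on (torus n) f"
  by (simp add: CT_carrier)

lemma CT_eqI:
  "f \<in> carrier (CT n) \<Longrightarrow> h \<in> carrier (CT n) \<Longrightarrow> (\<And>z. z \<in> torus n \<Longrightarrow> f z = h z) \<Longrightarrow> f = h"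
  unfolding CT_carrier by (elim conjE, rule extensionalityI)

lemma CT_simps:
  "z \<in> torus n \<Longrightarrow> (f \<oplus>\<^bsub>CT n\<^esub> h) z = f z + h z"
  "z \<in> torus n \<Longrightarrow> (f \<otimes>\<^bsub>CT n\<^esub> h) z = f z * h z"
  "z \<in> torus n \<Longrightarrow> \<zero>\<^bsub>CT n\<^esub> z = 0"
  "z \<in> torus n \<Longrightarrow> \<one>\<^bsub>CT n\<^esub> z = 1"
  by (simp_all add: torus_functions_def)

lemma
  assumes "f \<in> carrier (CT n)" "h \<in> carrier (CT n)"
  shows CT_add_closed: "f \<oplus>\<^bsub>CT n\<^esub> h \<in> carrier (CT n)"
    and CT_mult_closed: "f \<otimes>\<^bsub>CT n\<^esub> h \<in> carrier (CT n)"
proof -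
  note c = assms [THEN CT_continuous]
  have "f \<oplus>\<^bsub>CT n\<^esub> h = (\<lambda>z\<in>torus n. f z + h z)" "f \<otimes>\<^bsub>CT n\<^esub> h = (\<lambda>z\<in>torus n. f z * h z)"
    by (simp_all add: torus_functions_def)
  then show "f \<oplus>\<^bsub>CT n\<^esub> h \<in> carrier (CT n)" "f \<otimes>\<^bsub>CT n\<^esub> h \<in> carrier (CT n)"
    using CT_restrict [OF continuous_on_add [OF c]] CT_restrict [OF continuous_on_mult [OF c]] by simp_all
qed

lemma CT_const_closed: "\<zero>\<^bsub>CT n\<^esub> \<in> carrier (CT n)" "\<one>\<^bsub>CT n\<^esub> \<in> carrier (CT n)"
  using CT_restrict [OF continuous_on_const, of n 0] CT_restrict [OF continuous_on_const, of n 1]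
  by (simp_all add: torus_functions_def)

lemmas CT_closed = CT_add_closed CT_mult_closed CT_const_closed

lemma CT_cring: "cring (CT n)"
proof (rule cringI)
  show "abelian_group (CT n)"
  proof (rule abelian_groupI)
    fix f assume f: "f \<in> carrier (CT n)"
    show "\<exists>h\<in>carrier (CT n). h \<oplus>\<^bsub>CT n\<^esub> f = \<zero>\<^bsub>CT n\<^esub>"
    proof (rule bexI)
      show m: "(\<lambda>z\<in>torus n. - f z) \<in> carrier (CT n)"
        by (intro CT_restrict continuous_intros CT_continuous f)
      show "(\<lambda>z\<in>torus n. - f z) \<oplus>\<^bsub>CT n\<^esub> f = \<zero>\<^bsub>CT n\<^esub>"
        by (intro CT_eqI [of _ n] CT_closed m f) (simp add: CT_simps)
    qed
  next
    fix f h k assume "f \<in> carrier (CT n)" "h \<in> carrier (CT n)" "k \<in> carrier (CT n)"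
    then show "f \<oplus>\<^bsub>CT n\<^esub> h \<oplus>\<^bsub>CT n\<^esub> k = f \<oplus>\<^bsub>CT n\<^esub> (h \<oplus>\<^bsub>CT n\<^esub> k)"
      by (intro CT_eqI [of _ n] CT_closed) (simp_all add: CT_simps)
  next
    fix f h assume "f \<in> carrier (CT n)" "h \<in> carrier (CT n)"
    then show "f \<oplus>\<^bsub>CT n\<^esub> h = h \<oplus>\<^bsub>CT n\<^esub> f"
      by (intro CT_eqI [of _ n] CT_closed) (simp_all add: CT_simps)
  next
    fix f assume "f \<in> carrier (CT n)"
    then show "\<zero>\<^bsub>CT n\<^esub> \<oplus>\<^bsub>CT n\<^esub> f = f"
      by (intro CT_eqI [of _ n] CT_closed) (simp_all add: CT_simps)
  qed (simp_all add: CT_closed)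
  show "Group.comm_monoid (CT n)"
  proof (rule comm_monoidI)
    fix f h k assume "f \<in> carrier (CT n)" "h \<in> carrier (CT n)" "k \<in> carrier (CT n)"
    then show "f \<otimes>\<^bsub>CT n\<^esub> h \<otimes>\<^bsub>CT n\<^esub> k = f \<otimes>\<^bsub>CT n\<^esub> (h \<otimes>\<^bsub>CT n\<^esub> k)"
      by (intro CT_eqI [of _ n] CT_closed) (simp_all add: CT_simps)
  next
    fix f h assume "f \<in> carrier (CT n)" "h \<in> carrier (CT n)"
    then show "f \<otimes>\<^bsub>CT n\<^esub> h = h \<otimes>\<^bsub>CT n\<^esub> f"
      by (intro CT_eqI [of _ n] CT_closed) (simp_all add: CT_simps)
  next
    fix f assume "f \<in> carrier (CT n)"
    then show "\<one>\<^bsub>CT n\<^esub> \<otimes>\<^bsub>CT n\<^esub> f = f"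
      by (intro CT_eqI [of _ n] CT_closed) (simp_all add: CT_simps)
  qed (simp_all add: CT_closed)
  fix f h k assume "f \<in> carrier (CT n)" "h \<in> carrier (CT n)" "k \<in> carrier (CT n)"
  then show "(f \<oplus>\<^bsub>CT n\<^esub> h) \<otimes>\<^bsub>CT n\<^esub> k = f \<otimes>\<^bsub>CT n\<^esub> k \<oplus>\<^bsub>CT n\<^esub> h \<otimes>\<^bsub>CT n\<^esub> k"
    by (intro CT_eqI [of _ n] CT_closed) (simp_all add: CT_simps distrib_right)
qed

lemma torus_coordinate_continuous: "continuous_on S (\<lambda>z :: nat \<Rightarrow> complex. z i)"
  by (rule continuous_on_subset [OF continuous_on_product_coordinates]) simp

lemma CT_coordinate_sum:
  assumes "\<And>i. i < n \<Longrightarrow> f i \<in> carrier (CT n)"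
  shows "(\<lambda>z\<in>torus n. \<Sum>i<n. (z i - 1) * f i z) \<in> carrier (CT n)"
  by (intro CT_restrict continuous_intros torus_coordinate_continuous CT_continuous assms) simp

lemma torus_ideal_iff:
  "u \<in> torus_ideal n \<longleftrightarrow> u \<in> carrier (CT n) \<and>
    (\<exists>f. (\<forall>i<n. f i \<in> carrier (CT n)) \<and> (\<forall>z\<in>torus n. u z = (\<Sum>i<n. (z i - 1) * f i z)))"
proof
  assume "u \<in> torus_ideal n"
  then obtain f where "\<forall>i<n. f i \<in> carrier (CT n)" "u = (\<lambda>z\<in>torus n. \<Sum>i<n. (z i - 1) * f i z)"
    unfolding torus_ideal_def by blast
  then show "u \<in> carrier (CT n) \<and>
    (\<exists>f. (\<forall>i<n. f i \<in> carrier (CT n)) \<and> (\<forall>z\<in>torus n. u z = (\<Sum>i<n. (z i - 1) * f i z)))"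
    using CT_coordinate_sum by auto
next
  assume "u \<in> carrier (CT n) \<and>
    (\<exists>f. (\<forall>i<n. f i \<in> carrier (CT n)) \<and> (\<forall>z\<in>torus n. u z = (\<Sum>i<n. (z i - 1) * f i z)))"
  then obtain f where u: "u \<in> carrier (CT n)" and f: "\<forall>i<n. f i \<in> carrier (CT n)"
    "\<forall>z\<in>torus n. u z = (\<Sum>i<n. (z i - 1) * f i z)" by blast
  have "u = (\<lambda>z\<in>torus n. \<Sum>i<n. (z i - 1) * f i z)"
    by (rule CT_eqI [OF u CT_coordinate_sum]) (use f in auto)
  then show "u \<in> torus_ideal n" using f unfolding torus_ideal_def by blast
qed

lemma torus_ideal: "ideal (torus_ideal n) (CT n)"
proof -
  interpret cring "CT n" by (rule CT_cring)
  have mult: "a \<otimes>\<^bsub>CT n\<^esub> x \<in> torus_ideal n" if a: "a \<in> torus_ideal n" and x: "x \<in> carrier (CT n)" for a x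
  proof -
    obtain f where f: "\<forall>i<n. f i \<in> carrier (CT n)" "\<forall>z\<in>torus n. a z = (\<Sum>i<n. (z i - 1) * f i z)"
      using a unfolding torus_ideal_iff by blast
    show ?thesis
      unfolding torus_ideal_iff
    proof (intro conjI exI [of _ "\<lambda>i. f i \<otimes>\<^bsub>CT n\<^esub> x"] allI impI ballI)
      show "a \<otimes>\<^bsub>CT n\<^esub> x \<in> carrier (CT n)" using a x unfolding torus_ideal_iff by simp
      show "f i \<otimes>\<^bsub>CT n\<^esub> x \<in> carrier (CT n)" if "i < n" for i using f(1) that x by simp
      show "(a \<otimes>\<^bsub>CT n\<^esub> x) z = (\<Sum>i<n. (z i - 1) * (f i \<otimes>\<^bsub>CT n\<^esub> x) z)" if "z \<in> torus n" for z
        using f(2) that by (simp add: CT_simps sum_distrib_right mult.assoc)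
    qed
  qed
  have add: "a \<oplus>\<^bsub>CT n\<^esub> b \<in> torus_ideal n" if a: "a \<in> torus_ideal n" and b: "b \<in> torus_ideal n" for a b
  proof -
    obtain f where f: "\<forall>i<n. f i \<in> carrier (CT n)" "\<forall>z\<in>torus n. a z = (\<Sum>i<n. (z i - 1) * f i z)"
      using a unfolding torus_ideal_iff by blast
    obtain h where h: "\<forall>i<n. h i \<in> carrier (CT n)" "\<forall>z\<in>torus n. b z = (\<Sum>i<n. (z i - 1) * h i z)"
      using b unfolding torus_ideal_iff by blast
    show ?thesis
      unfolding torus_ideal_iff
    proof (intro conjI exI [of _ "\<lambda>i. f i \<oplus>\<^bsub>CT n\<^esub> h i"] allI impI ballI)
      show "a \<oplus>\<^bsub>CT n\<^esub> b \<in> carrier (CT n)" using a b unfolding torus_ideal_iff by simp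
      show "f i \<oplus>\<^bsub>CT n\<^esub> h i \<in> carrier (CT n)" if "i < n" for i using f(1) h(1) that by simp
      show "(a \<oplus>\<^bsub>CT n\<^esub> b) z = (\<Sum>i<n. (z i - 1) * (f i \<oplus>\<^bsub>CT n\<^esub> h i) z)" if "z \<in> torus n" for z
        using f(2) h(2) that by (simp add: CT_simps sum.distrib distrib_left)
    qed
  qed
  have car: "a \<in> carrier (CT n)" if "a \<in> torus_ideal n" for a
    using that unfolding torus_ideal_iff by blast
  show ?thesis
  proof (rule idealI [OF ring_axioms])
    show "subgroup (torus_ideal n) (add_monoid (CT n))"
    proof (rule group.subgroupI [OF a_group])
      show "torus_ideal n \<subseteq> carrier (add_monoid (CT n))" using car by auto
      have "\<zero>\<^bsub>CT n\<^esub> \<in> torus_ideal n"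
        unfolding torus_ideal_iff by (intro conjI exI [of _ "\<lambda>i. \<zero>\<^bsub>CT n\<^esub>"]) (auto simp: CT_simps)
      then show "torus_ideal n \<noteq> {}" by blast
      show "inv\<^bsub>add_monoid (CT n)\<^esub> a \<in> torus_ideal n" if a: "a \<in> torus_ideal n" for a
      proof -
        have "a \<otimes>\<^bsub>CT n\<^esub> (\<ominus>\<^bsub>CT n\<^esub> \<one>\<^bsub>CT n\<^esub>) \<in> torus_ideal n" by (rule mult [OF a]) simp
        also have "a \<otimes>\<^bsub>CT n\<^esub> (\<ominus>\<^bsub>CT n\<^esub> \<one>\<^bsub>CT n\<^esub>) = \<ominus>\<^bsub>CT n\<^esub> a"
          using car [OF a] by (simp add: r_minus)
        finally show ?thesis by (simp add: a_inv_def)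
      qed
      show "a \<otimes>\<^bsub>add_monoid (CT n)\<^esub> b \<in> torus_ideal n" if "a \<in> torus_ideal n" "b \<in> torus_ideal n" for a b
        using add [OF that] by simp
    qed
    fix a x assume ax: "a \<in> torus_ideal n" "x \<in> carrier (CT n)"
    show "a \<otimes>\<^bsub>CT n\<^esub> x \<in> torus_ideal n" by (rule mult [OF ax])
    then show "x \<otimes>\<^bsub>CT n\<^esub> a \<in> torus_ideal n" using m_comm [OF car [OF ax(1)] ax(2)] by simp
  qed
qed

lemma torus_class_hom: "torus_class n \<in> ring_hom (CT n) (torus_quotient n)"
proof -
  interpret ideal "torus_ideal n" "CT n" by (rule torus_ideal)
  have "torus_class n = (+>\<^bsub>CT n\<^esub>) (torus_ideal n)" by (simp add: fun_eq_iff torus_class_def)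
  then show ?thesis using rcos_ring_hom by simp
qed

lemma torus_quotient_ring: "ring (torus_quotient n)"
proof -
  interpret ideal "torus_ideal n" "CT n" by (rule torus_ideal)
  show ?thesis by (rule quotient_is_ring)
qed

lemma torus_class_surj: "carrier (torus_quotient n) = torus_class n ` carrier (CT n)"
  by (auto simp: FactRing_def A_RCOSETS_def' torus_class_def)

lemma torus_class_zero_iff:
  assumes "f \<in> carrier (CT n)"
  shows "torus_class n f = \<zero>\<^bsub>torus_quotient n\<^esub> \<longleftrightarrow> f \<in> torus_ideal n"
proof -
  interpret ideal "torus_ideal n" "CT n" by (rule torus_ideal)
  interpret abelian_subgroup "torus_ideal n" "CT n"
    by (rule abelian_subgroupI3 [OF is_additive_subgroup is_abelian_group])
  have z: "\<zero>\<^bsub>torus_quotient n\<^esub> = torus_ideal n" by (simp add: FactRing_def)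
  show ?thesis
    unfolding z torus_class_def using a_rcos_self [OF assms] a_rcos_const by metis
qed

section \<open>Characters and Laurent polynomials\<close>

text \<open>The underlying set of \<open>\<complex>[\<int>\<^sup>n]\<close>.\<close>

abbreviation cg :: "nat \<Rightarrow> ((nat \<Rightarrow>\<^sub>0 int) \<Rightarrow> complex) set"
  where "cg n \<equiv> carrier (complex_group_ring (Zn n))"

lemma cg_iff: "\<alpha> \<in> cg n \<longleftrightarrow> finite {g. \<alpha> g \<noteq> 0} \<and> {g. \<alpha> g \<noteq> 0} \<subseteq> carrier (Zn n)"
  by (simp add: group_ring_def)

lemma cgI: "finite A \<Longrightarrow> A \<subseteq> carrier (Zn n) \<Longrightarrow> (\<And>g. g \<notin> A \<Longrightarrow> \<alpha> g = 0) \<Longrightarrow> \<alpha> \<in> cg n"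
  unfolding cg_iff by (auto intro: finite_subset)

lemma Zn_add: "g \<in> carrier (Zn n) \<Longrightarrow> h \<in> carrier (Zn n) \<Longrightarrow> g + h \<in> carrier (Zn n)"
  using group.is_monoid [OF group_free_Abelian_group, THEN monoid.m_closed, of g "{..<n}" h] by simp

lemma Zn_diff: "g \<in> carrier (Zn n) \<Longrightarrow> h \<in> carrier (Zn n) \<Longrightarrow> g - h \<in> carrier (Zn n)"
  unfolding carrier_free_Abelian_group_iff using keys_diff [of g h] by blast

lemma Zn_zero: "0 \<in> carrier (Zn n)"
  by simp

lemma Zn_eqI:
  assumes "g \<in> carrier (Zn n)" "h \<in> carrier (Zn n)"
    and "\<And>i. i < n \<Longrightarrow> Poly_Mapping.lookup g i = Poly_Mapping.lookup h i"
  shows "g = h"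
proof (rule poly_mapping_eqI)
  fix i show "Poly_Mapping.lookup g i = Poly_Mapping.lookup h i"
  proof (cases "i < n")
    case False
    then have "i \<notin> Poly_Mapping.keys g" "i \<notin> Poly_Mapping.keys h" using assms(1,2) by auto
    then show ?thesis by (simp add: in_keys_iff)
  qed (rule assms(3))
qed

lemma conv_outside: "g \<notin> carrier G \<Longrightarrow> conv G a b g = 0"
  by (simp add: conv_def)

lemma conv_Zn:
  assumes "finite A" "A \<subseteq> carrier (Zn n)" "{h. a h \<noteq> 0} \<subseteq> A" "g \<in> carrier (Zn n)"
  shows "conv (Zn n) a b g = (\<Sum>h\<in>A. a h * b (g - h))"
proof -
  have "conv (Zn n) a b g = (\<Sum>h | a h \<noteq> 0. a h * b (inv\<^bsub>Zn n\<^esub> h + g))"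
    unfolding conv_def if_P [OF assms(4)] by (simp only: mult_free_Abelian_group)
  also have "\<dots> = (\<Sum>h | a h \<noteq> 0. a h * b (g - h))"
    using assms(2,3) by (intro sum.cong refl) (auto simp: inv_free_Abelian_group subset_iff)
  also have "\<dots> = (\<Sum>h\<in>A. a h * b (g - h))"
    using assms by (intro sum.mono_neutral_left) auto
  finally show ?thesis .
qed

lemma cg_conv: "\<alpha> \<in> cg n \<Longrightarrow> \<beta> \<in> cg n \<Longrightarrow> conv (Zn n) \<alpha> \<beta> \<in> cg n"
proof -
  interpret R: cring "complex_group_ring (Zn n)"
    by (rule comm_group.group_ring_cring [OF abelian_free_Abelian_group])
  show "\<alpha> \<in> cg n \<Longrightarrow> \<beta> \<in> cg n \<Longrightarrow> conv (Zn n) \<alpha> \<beta> \<in> cg n"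
    using R.m_closed [of \<alpha> \<beta>] by (simp add: group_ring_def)
qed

lemma cg_combine:
  assumes "\<alpha> \<in> cg n" "\<beta> \<in> cg n"
  shows "(\<lambda>g. c * \<alpha> g + d * \<beta> g) \<in> cg n"
  using assms unfolding cg_iff
  by (intro cgI [of "{g. \<alpha> g \<noteq> 0} \<union> {g. \<beta> g \<noteq> 0}", unfolded cg_iff]) auto

lemma cg_add: "\<alpha> \<in> cg n \<Longrightarrow> \<beta> \<in> cg n \<Longrightarrow> (\<lambda>g. \<alpha> g + \<beta> g) \<in> cg n"
  using cg_combine [of \<alpha> n \<beta> 1 1] by simp

lemma cg_diff: "\<alpha> \<in> cg n \<Longrightarrow> \<beta> \<in> cg n \<Longrightarrow> (\<lambda>g. \<alpha> g - \<beta> g) \<in> cg n"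
  using cg_combine [of \<alpha> n \<beta> 1 "-1"] by simp

lemma cg_of_int: "a \<in> zg n \<Longrightarrow> (\<lambda>g. of_int (a g)) \<in> cg n"
  by (simp add: group_ring_def)

text \<open>The character \<open>g \<mapsto> z\<^sub>1\<^bsup>g\<^sub>1\<^esup> \<cdots> z\<^sub>n\<^bsup>g\<^sub>n\<^esup>\<close> of \<open>\<int>\<^sup>n\<close> that belongs to a point \<open>z\<close> of the torus.\<close>

definition character :: "nat \<Rightarrow> (nat \<Rightarrow> complex) \<Rightarrow> (nat \<Rightarrow>\<^sub>0 int) \<Rightarrow> complex"
  where "character n z g = (\<Prod>i<n. z i powi Poly_Mapping.lookup g i)"

lemma torus_norm: "z \<in> torus n \<Longrightarrow> i < n \<Longrightarrow> cmod (z i) = 1"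
  by (auto simp: torus_def)

lemma torus_nonzero: "z \<in> torus n \<Longrightarrow> i < n \<Longrightarrow> z i \<noteq> 0"
  using torus_norm by fastforce

lemma character_add:
  assumes "z \<in> torus n"
  shows "character n z (g + h) = character n z g * character n z h"
  unfolding character_def prod.distrib [symmetric]
  using torus_nonzero [OF assms] by (intro prod.cong refl) (simp add: lookup_add power_int_add)

lemma character_norm: "z \<in> torus n \<Longrightarrow> cmod (character n z g) = 1"
  unfolding character_def prod_norm [symmetric]
  by (intro prod.neutral) (simp add: norm_power_int torus_norm)

lemma character_zero: "character n z 0 = 1"
  by (simp add: character_def)

lemma character_frag_of:
  assumes "i < n" shows "character n z (frag_of i) = z i"
proof -
  have "character n z (frag_of i) = (\<Prod>j<n. if j = i then z i else 1)"
    unfolding character_def by (intro prod.cong) (auto simp: lookup_frag_of)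
  also have "\<dots> = z i" using assms by simp
  finally show ?thesis .
qed

lemma laurent_eval_superset:
  assumes "finite A" "{g. \<alpha> g \<noteq> 0} \<subseteq> A"
  shows "laurent_eval n \<alpha> z = (\<Sum>g\<in>A. \<alpha> g * character n z g)"
  unfolding laurent_eval_def character_def
  using assms by (intro sum.mono_neutral_left) auto

lemma laurent_eval_combine:
  assumes "\<alpha> \<in> cg n" "\<beta> \<in> cg n"
  shows "laurent_eval n (\<lambda>g. c * \<alpha> g + d * \<beta> g) z = c * laurent_eval n \<alpha> z + d * laurent_eval n \<beta> z"
proof -
  let ?A = "{g. \<alpha> g \<noteq> 0} \<union> {g. \<beta> g \<noteq> 0}"
  have A: "finite ?A" using assms by (simp add: cg_iff)
  show ?thesis
    by (subst (1 2 3) laurent_eval_superset [OF A])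
       (auto simp: sum_distrib_left sum.distrib [symmetric] algebra_simps)
qed

lemma laurent_eval_add:
  "\<alpha> \<in> cg n \<Longrightarrow> \<beta> \<in> cg n \<Longrightarrow> laurent_eval n (\<lambda>g. \<alpha> g + \<beta> g) z = laurent_eval n \<alpha> z + laurent_eval n \<beta> z"
  using laurent_eval_combine [of \<alpha> n \<beta> 1 1] by simp

lemma laurent_eval_diff:
  "\<alpha> \<in> cg n \<Longrightarrow> \<beta> \<in> cg n \<Longrightarrow> laurent_eval n (\<lambda>g. \<alpha> g - \<beta> g) z = laurent_eval n \<alpha> z - laurent_eval n \<beta> z"
  using laurent_eval_combine [of \<alpha> n \<beta> 1 "-1"] by simp

lemma laurent_eval_conv:
  assumes \<alpha>: "\<alpha> \<in> cg n" and \<beta>: "\<beta> \<in> cg n" and z: "z \<in> torus n"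
  shows "laurent_eval n (conv (Zn n) \<alpha> \<beta>) z = laurent_eval n \<alpha> z * laurent_eval n \<beta> z"
proof -
  let ?A = "{g. \<alpha> g \<noteq> 0}" and ?B = "{g. \<beta> g \<noteq> 0}"
  let ?AB = "(\<lambda>(h, k). h + k) ` (?A \<times> ?B)"
  have A: "finite ?A" "?A \<subseteq> carrier (Zn n)" and B: "finite ?B" "?B \<subseteq> carrier (Zn n)"
    using assms by (simp_all add: cg_iff)
  have AB: "finite ?AB" "?AB \<subseteq> carrier (Zn n)"
    using A B by (auto intro!: Zn_add simp del: carrier_free_Abelian_group_iff)
  have "{g. conv (Zn n) \<alpha> \<beta> g \<noteq> 0} \<subseteq> ?AB"
    using group.conv_closed [OF group_free_Abelian_group A B] by (simp only: mult_free_Abelian_group)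
  then have "laurent_eval n (conv (Zn n) \<alpha> \<beta>) z = (\<Sum>g\<in>?AB. conv (Zn n) \<alpha> \<beta> g * character n z g)"
    by (rule laurent_eval_superset [OF AB(1)])
  also have "\<dots> = (\<Sum>g\<in>?AB. \<Sum>h\<in>?A. \<alpha> h * \<beta> (g - h) * character n z g)"
  proof (rule sum.cong [OF refl])
    fix g assume "g \<in> ?AB"
    then have "g \<in> carrier (Zn n)" using AB(2) by blast
    then show "conv (Zn n) \<alpha> \<beta> g * character n z g = (\<Sum>h\<in>?A. \<alpha> h * \<beta> (g - h) * character n z g)"
      by (simp only: conv_Zn [OF A order_refl] sum_distrib_right)
  qed
  also have "\<dots> = (\<Sum>h\<in>?A. \<Sum>g\<in>?AB. \<alpha> h * \<beta> (g - h) * character n z g)"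
    by (rule sum.swap)
  also have "\<dots> = (\<Sum>h\<in>?A. \<alpha> h * character n z h * laurent_eval n \<beta> z)"
  proof (rule sum.cong [OF refl])
    fix h assume h: "h \<in> ?A"
    have "(\<Sum>g\<in>?AB. \<alpha> h * \<beta> (g - h) * character n z g) =
        (\<Sum>g\<in>?AB. \<alpha> h * character n z h * (\<beta> (g - h) * character n z (g - h)))"
    proof (rule sum.cong [OF refl])
      fix g
      have "character n z g = character n z h * character n z (g - h)"
        using character_add [OF z, of h "g - h"] by simp
      then show "\<alpha> h * \<beta> (g - h) * character n z g =
          \<alpha> h * character n z h * (\<beta> (g - h) * character n z (g - h))"
        by (simp only: ac_simps)
    qed
    also have "\<dots> = \<alpha> h * character n z h * (\<Sum>g\<in>?AB. \<beta> (g - h) * character n z (g - h))"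
      by (rule sum_distrib_left [symmetric])
    also have "(\<Sum>g\<in>?AB. \<beta> (g - h) * character n z (g - h)) =
        (\<Sum>k\<in>(\<lambda>g. g - h) ` ?AB. \<beta> k * character n z k)"
      by (subst sum.reindex) (auto simp: inj_on_def)
    also have "\<dots> = laurent_eval n \<beta> z"
    proof (rule laurent_eval_superset [symmetric])
      show "?B \<subseteq> (\<lambda>g. g - h) ` ?AB"
      proof
        fix k assume "k \<in> ?B"
        then have "h + k \<in> ?AB" using h by blast
        then show "k \<in> (\<lambda>g. g - h) ` ?AB" by (rule rev_image_eqI) simp
      qed
    qed (use AB in simp)
    finally show "(\<Sum>g\<in>?AB. \<alpha> h * \<beta> (g - h) * character n z g) = \<alpha> h * character n z h * laurent_eval n \<beta> z" .
  qed
  also have "\<dots> = laurent_eval n \<alpha> z * laurent_eval n \<beta> z"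
    unfolding sum_distrib_right [symmetric] by (subst laurent_eval_superset [OF A(1) order_refl, symmetric]) simp
  finally show ?thesis .
qed

section \<open>The operator norm is at most the supremum norm\<close>

lemma sum_roots_unity_powi:
  assumes "k \<noteq> 0" "\<bar>k\<bar> < int N"
  shows "(\<Sum>z | z ^ N = 1. z powi k) = (0 :: complex)"
proof -
  have N: "N > 0" using assms by linarith
  let ?U = "{z :: complex. z ^ N = 1}"
  define w where "w = cis (2 * pi / N)"
  have w: "w ^ N = 1" "w \<noteq> 0" using N by (simp_all add: w_def Complex.DeMoivre)
  have "w powi k \<noteq> 1"
  proof
    assume "w powi k = 1"
    then have "cis (real_of_int k * (2 * pi / N)) = 1" by (simp add: w_def cis_power_int)
    then have "Re (cis (real_of_int k * (2 * pi / N))) = 1" by simp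
    then obtain j :: int where "real_of_int k * (2 * pi / N) = real_of_int j * 2 * pi"
      by (auto simp: cos_one_2pi_int)
    then have "real_of_int k = real_of_int j * real N" using N by (simp add: field_simps)
    also have "\<dots> = real_of_int (j * int N)" by simp
    finally have "k = j * int N" by linarith
    then have "j \<noteq> 0" "\<bar>k\<bar> = \<bar>j\<bar> * int N" using assms by (auto simp: abs_mult)
    then have "\<bar>k\<bar> \<ge> 1 * int N" by (metis mult_right_mono of_nat_0_le_iff zero_less_abs_iff int_one_le_iff_zero_less)
    then show False using assms(2) by simp
  qed
  \<comment> \<open>Multiplication by \<open>w\<close> permutes the roots of unity and multiplies the sum by \<open>w\<^sup>k \<noteq> 1\<close>.\<close>
  have "bij_betw (\<lambda>z. w * z) ?U ?U"
    by (rule bij_betw_byWitness [of _ "\<lambda>z. inverse w * z"])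
       (use w in \<open>auto simp: power_mult_distrib power_inverse\<close>)
  then have "(\<Sum>z\<in>?U. z powi k) = (\<Sum>z\<in>?U. (w * z) powi k)"
    by (rule sum.reindex_bij_betw [symmetric])
  also have "\<dots> = w powi k * (\<Sum>z\<in>?U. z powi k)"
    by (simp add: power_int_mult_distrib sum_distrib_left)
  finally have "(1 - w powi k) * (\<Sum>z\<in>?U. z powi k) = 0" by (simp add: algebra_simps)
  then show ?thesis using \<open>w powi k \<noteq> 1\<close> by simp
qed

lemma roots_unity_torus: "N > 0 \<Longrightarrow> ({..<n} \<rightarrow>\<^sub>E {z. z ^ N = 1}) \<subseteq> torus n"
  unfolding torus_def using power_eq_1_iff by (intro PiE_mono) (auto simp: norm_power_int)

text \<open>Averages over the points whose coordinates are \<open>N\<close>-th roots of unity serve instead of integrals over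
  the torus.  They separate two exponents as soon as the entries of these differ by less than \<open>N\<close>.\<close>

lemma character_orthogonal:
  assumes N: "N > 0" and g: "g \<in> carrier (Zn n)" and h: "h \<in> carrier (Zn n)"
    and close: "\<And>i. i < n \<Longrightarrow> \<bar>Poly_Mapping.lookup g i - Poly_Mapping.lookup h i\<bar> < int N"
  shows "(\<Sum>z\<in>{..<n} \<rightarrow>\<^sub>E {z. z ^ N = 1}. character n z g * cnj (character n z h)) =
    (if g = h then of_nat N ^ n else 0)"
proof -
  let ?U = "{z :: complex. z ^ N = 1}"
  let ?d = "\<lambda>i. Poly_Mapping.lookup g i - Poly_Mapping.lookup h i"
  have fin: "finite ?U" using N by (intro finite_roots_unity) simp
  have U: "\<zeta> \<noteq> 0 \<and> cnj \<zeta> = inverse \<zeta>" if "\<zeta> \<in> ?U" for \<zeta>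
  proof -
    have "cmod \<zeta> ^ N = 1" using that by (simp flip: norm_power)
    then have "cmod \<zeta> = 1" using N power_eq_1_iff [of "cmod \<zeta>" N] by simp
    then have "\<zeta> * cnj \<zeta> = 1" by (simp add: complex_norm_square [symmetric])
    then show ?thesis by (metis inverse_unique mult_zero_left zero_neq_one)
  qed
  have "(\<Sum>z\<in>{..<n} \<rightarrow>\<^sub>E ?U. character n z g * cnj (character n z h)) =
      (\<Sum>z\<in>{..<n} \<rightarrow>\<^sub>E ?U. \<Prod>i<n. z i powi ?d i)"
  proof (rule sum.cong [OF refl])
    fix z assume z: "z \<in> {..<n} \<rightarrow>\<^sub>E ?U"
    have "z i powi Poly_Mapping.lookup g i * cnj (z i powi Poly_Mapping.lookup h i) = z i powi ?d i"
      if "i < n" for i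
    proof -
      have "z i \<in> ?U" using PiE_mem [OF z] that by blast
      from U [OF this] show ?thesis
        by (simp add: power_int_diff power_int_inverse divide_inverse)
    qed
    then show "character n z g * cnj (character n z h) = (\<Prod>i<n. z i powi ?d i)"
      unfolding character_def cnj_prod prod.distrib [symmetric] by (intro prod.cong) auto
  qed
  also have "\<dots> = (\<Prod>i<n. \<Sum>\<zeta>\<in>?U. \<zeta> powi ?d i)"
    by (rule prod_sum_PiE [symmetric]) (use fin in auto)
  also have "\<dots> = (\<Prod>i<n. if ?d i = 0 then of_nat N else 0)"
  proof (rule prod.cong [OF refl])
    fix i assume "i \<in> {..<n}"
    then show "(\<Sum>\<zeta>\<in>?U. \<zeta> powi ?d i) = (if ?d i = 0 then of_nat N else 0)"
      using sum_roots_unity_powi [of "?d i" N] close [of i] card_roots_unity_eq [OF N] by auto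
  qed
  also have "\<dots> = (if g = h then of_nat N ^ n else 0)"
  proof (cases "g = h")
    case False
    then obtain i where "i < n" "?d i \<noteq> 0" using Zn_eqI [OF g h] by force
    then show ?thesis using False by (auto intro!: prod_zero)
  qed simp
  finally show ?thesis .
qed

lemma Parseval:
  assumes S: "finite S" "S \<subseteq> carrier (Zn n)" and \<gamma>: "{g. \<gamma> g \<noteq> 0} \<subseteq> S" and N: "N > 0"
    and close: "\<And>g h i. g \<in> S \<Longrightarrow> h \<in> S \<Longrightarrow> i < n \<Longrightarrow>
      \<bar>Poly_Mapping.lookup g i - Poly_Mapping.lookup h i\<bar> < int N"
  shows "(\<Sum>z\<in>{..<n} \<rightarrow>\<^sub>E {z. z ^ N = 1}. (cmod (laurent_eval n \<gamma> z))\<^sup>2) = real N ^ n * (\<Sum>g\<in>S. (cmod (\<gamma> g))\<^sup>2)"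
proof -
  let ?Z = "{..<n} \<rightarrow>\<^sub>E {z :: complex. z ^ N = 1}"
  have "complex_of_real (\<Sum>z\<in>?Z. (cmod (laurent_eval n \<gamma> z))\<^sup>2) =
      (\<Sum>z\<in>?Z. laurent_eval n \<gamma> z * cnj (laurent_eval n \<gamma> z))"
    by (simp only: of_real_sum complex_norm_square)
  also have "\<dots> = (\<Sum>z\<in>?Z. \<Sum>g\<in>S. \<Sum>h\<in>S. \<gamma> g * cnj (\<gamma> h) * (character n z g * cnj (character n z h)))"
    unfolding laurent_eval_superset [OF S(1) \<gamma>] cnj_sum sum_product
    by (intro sum.cong refl) simp
  also have "\<dots> = (\<Sum>g\<in>S. \<Sum>h\<in>S. \<Sum>z\<in>?Z. \<gamma> g * cnj (\<gamma> h) * (character n z g * cnj (character n z h)))"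
    by (subst sum.swap, rule sum.cong [OF refl], rule sum.swap)
  also have "\<dots> = (\<Sum>g\<in>S. \<Sum>h\<in>S. if h = g then \<gamma> g * cnj (\<gamma> g) * of_nat N ^ n else 0)"
  proof (intro sum.cong refl)
    fix g h assume "g \<in> S" "h \<in> S"
    then have "(\<Sum>z\<in>?Z. character n z g * cnj (character n z h)) = (if g = h then of_nat N ^ n else 0)"
      using S(2) close by (intro character_orthogonal N) (blast+)
    then show "(\<Sum>z\<in>?Z. \<gamma> g * cnj (\<gamma> h) * (character n z g * cnj (character n z h))) =
        (if h = g then \<gamma> g * cnj (\<gamma> g) * of_nat N ^ n else 0)"
      by (simp flip: sum_distrib_left)
  qed
  also have "\<dots> = (\<Sum>g\<in>S. \<gamma> g * cnj (\<gamma> g) * of_nat N ^ n)"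
    using S(1) by (intro sum.cong refl) simp
  also have "\<dots> = complex_of_real (real N ^ n * (\<Sum>g\<in>S. (cmod (\<gamma> g))\<^sup>2))"
    unfolding of_real_mult of_real_sum complex_norm_square by (simp add: sum_distrib_left mult.commute)
  finally show ?thesis by (simp only: of_real_eq_iff)
qed

lemma Zn_separating_bound:
  fixes S :: "(nat \<Rightarrow>\<^sub>0 int) set"
  assumes "finite S"
  shows "\<exists>N>0. \<forall>g\<in>S. \<forall>h\<in>S. \<forall>i. \<bar>Poly_Mapping.lookup g i - Poly_Mapping.lookup h i\<bar> < int N"
proof -
  let ?I = "\<lambda>g :: nat \<Rightarrow>\<^sub>0 int. (\<lambda>i. \<bar>Poly_Mapping.lookup g i\<bar>) ` Poly_Mapping.keys g"
  have "finite (\<Union>g\<in>S. ?I g)" using assms by auto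
  from bdd_above_finite [OF this] obtain R where R: "\<forall>x\<in>(\<Union>g\<in>S. ?I g). x \<le> R"
    unfolding bdd_above_def by (rule exE)
  have *: "\<bar>Poly_Mapping.lookup g i\<bar> \<le> \<bar>R\<bar>" if "g \<in> S" for g i
  proof (cases "i \<in> Poly_Mapping.keys g")
    case True
    then have "\<bar>Poly_Mapping.lookup g i\<bar> \<le> R" using that by (intro bspec [OF R]) auto
    then show ?thesis by simp
  qed (simp add: in_keys_iff)
  show ?thesis
  proof (intro exI [of _ "nat (2 * \<bar>R\<bar> + 1)"] conjI ballI allI)
    fix g h i assume "g \<in> S" "h \<in> S"
    then show "\<bar>Poly_Mapping.lookup g i - Poly_Mapping.lookup h i\<bar> < int (nat (2 * \<bar>R\<bar> + 1))"
      using *[of g i] *[of h i] by linarith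
  qed simp
qed

text \<open>By Parseval it is enough to compare the square means of the transforms over points of the torus, where
  multiplication by \<open>\<alpha>\<close> is multiplication by a function bounded by \<open>M\<close>.\<close>

lemma conv_norm_le_cg:
  assumes \<alpha>: "\<alpha> \<in> cg n" and \<beta>: "\<beta> \<in> cg n" and M: "\<And>z. z \<in> torus n \<Longrightarrow> cmod (laurent_eval n \<alpha> z) \<le> M"
    and "0 \<le> M"
  shows "L2_norm (Zn n) (conv (Zn n) \<alpha> \<beta>) \<le> M * L2_norm (Zn n) \<beta>"
proof -
  let ?\<gamma> = "conv (Zn n) \<alpha> \<beta>"
  define S where "S = {g. ?\<gamma> g \<noteq> 0} \<union> {g. \<beta> g \<noteq> 0}"
  have S: "finite S" "S \<subseteq> carrier (Zn n)" "{g. ?\<gamma> g \<noteq> 0} \<subseteq> S" "{g. \<beta> g \<noteq> 0} \<subseteq> S"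
    using cg_conv [OF \<alpha> \<beta>] \<beta> unfolding cg_iff S_def by auto
  obtain N where N: "N > 0"
    "\<And>g h i. g \<in> S \<Longrightarrow> h \<in> S \<Longrightarrow> \<bar>Poly_Mapping.lookup g i - Poly_Mapping.lookup h i\<bar> < int N"
    using Zn_separating_bound [OF S(1)] by blast
  let ?Z = "{..<n} \<rightarrow>\<^sub>E {z :: complex. z ^ N = 1}"
  have "real N ^ n * (\<Sum>g\<in>S. (cmod (?\<gamma> g))\<^sup>2) = (\<Sum>z\<in>?Z. (cmod (laurent_eval n ?\<gamma> z))\<^sup>2)"
    by (rule Parseval [OF S(1-3) N(1), symmetric]) (rule N(2))
  also have "\<dots> \<le> (\<Sum>z\<in>?Z. M\<^sup>2 * (cmod (laurent_eval n \<beta> z))\<^sup>2)"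
  proof (rule sum_mono)
    fix z assume "z \<in> ?Z"
    then have z: "z \<in> torus n" using roots_unity_torus [OF N(1)] by blast
    have "(cmod (laurent_eval n ?\<gamma> z))\<^sup>2 = (cmod (laurent_eval n \<alpha> z))\<^sup>2 * (cmod (laurent_eval n \<beta> z))\<^sup>2"
      by (simp add: laurent_eval_conv [OF \<alpha> \<beta> z] norm_mult power_mult_distrib)
    also have "\<dots> \<le> M\<^sup>2 * (cmod (laurent_eval n \<beta> z))\<^sup>2"
      using M [OF z] by (intro mult_right_mono power_mono) auto
    finally show "(cmod (laurent_eval n ?\<gamma> z))\<^sup>2 \<le> M\<^sup>2 * (cmod (laurent_eval n \<beta> z))\<^sup>2" .
  qed
  also have "\<dots> = M\<^sup>2 * (real N ^ n * (\<Sum>g\<in>S. (cmod (\<beta> g))\<^sup>2))"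
    unfolding sum_distrib_left [symmetric]
    by (subst Parseval [OF S(1,2,4) N(1)]) (use N(2) in auto)
  finally have "real N ^ n * (\<Sum>g\<in>S. (cmod (?\<gamma> g))\<^sup>2) \<le> real N ^ n * (M\<^sup>2 * (\<Sum>g\<in>S. (cmod (\<beta> g))\<^sup>2))"
    by (simp only: mult.left_commute)
  then have "(\<Sum>g\<in>S. (cmod (?\<gamma> g))\<^sup>2) \<le> M\<^sup>2 * (\<Sum>g\<in>S. (cmod (\<beta> g))\<^sup>2)"
    using N(1) by (simp add: mult_le_cancel_left_pos)
  then have "fin_norm S ?\<gamma> \<le> sqrt (M\<^sup>2 * (\<Sum>g\<in>S. (cmod (\<beta> g))\<^sup>2))"
    unfolding L2_set_def by (rule real_sqrt_le_mono)
  also have "\<dots> = M * fin_norm S \<beta>"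
    using \<open>0 \<le> M\<close> by (simp add: real_sqrt_mult L2_set_def)
  finally show ?thesis
    using S by (subst (1 2) L2_norm_finite_support [OF S(1,2)]) auto
qed

text \<open>Only finitely many values of \<open>\<beta>\<close> enter into a finite part of \<open>\<alpha> \<cdot> \<beta>\<close>, so the bound extends from
  the group ring to all of \<open>L\<^sup>2\<close>.\<close>

lemma
  assumes \<alpha>: "\<alpha> \<in> cg n" and \<beta>: "\<beta> \<in> L2 (Zn n)"
    and M: "\<And>z. z \<in> torus n \<Longrightarrow> cmod (laurent_eval n \<alpha> z) \<le> M" and "0 \<le> M"
  shows conv_L2_bounded: "conv (Zn n) \<alpha> \<beta> \<in> L2 (Zn n)"
    and conv_norm_le: "L2_norm (Zn n) (conv (Zn n) \<alpha> \<beta>) \<le> M * L2_norm (Zn n) \<beta>"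
proof -
  let ?A = "{g. \<alpha> g \<noteq> 0}"
  have A: "finite ?A" "?A \<subseteq> carrier (Zn n)" using \<alpha> by (simp_all add: cg_iff)
  have *: "fin_norm F (conv (Zn n) \<alpha> \<beta>) \<le> M * L2_norm (Zn n) \<beta>"
    if F: "finite F" "F \<subseteq> carrier (Zn n)" for F
  proof -
    let ?K = "(\<lambda>(g, h). g - h) ` (F \<times> ?A)"
    let ?b = "\<lambda>g. if g \<in> ?K then \<beta> g else 0"
    have K: "finite ?K" "?K \<subseteq> carrier (Zn n)"
      using A F by (auto intro!: Zn_diff simp del: carrier_free_Abelian_group_iff)
    have b: "?b \<in> cg n" by (rule cgI [OF K]) simp
    have "fin_norm F (conv (Zn n) \<alpha> \<beta>) = fin_norm F (conv (Zn n) \<alpha> ?b)"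
    proof (rule L2_set_cong [OF refl])
      fix g assume g: "g \<in> F"
      then have gc: "g \<in> carrier (Zn n)" using F by blast
      have "(\<Sum>h\<in>?A. \<alpha> h * \<beta> (g - h)) = (\<Sum>h\<in>?A. \<alpha> h * ?b (g - h))"
      proof (rule sum.cong [OF refl])
        fix h assume "h \<in> ?A"
        then have "g - h \<in> ?K" using g by blast
        then show "\<alpha> h * \<beta> (g - h) = \<alpha> h * ?b (g - h)" by (simp only: if_True)
      qed
      then show "cmod (conv (Zn n) \<alpha> \<beta> g) = cmod (conv (Zn n) \<alpha> ?b g)"
        by (simp only: conv_Zn [OF A order_refl gc])
    qed
    also have "\<dots> \<le> L2_norm (Zn n) (conv (Zn n) \<alpha> ?b)"
    proof (rule fin_norm_le_L2_norm [OF _ F])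
      have "conv (Zn n) \<alpha> ?b \<in> cg n" by (rule cg_conv [OF \<alpha> b])
      then show "conv (Zn n) \<alpha> ?b \<in> L2 (Zn n)"
        unfolding cg_iff by (intro L2_finite_support [of "{g. conv (Zn n) \<alpha> ?b g \<noteq> 0}"]) blast+
    qed
    also have "\<dots> \<le> M * L2_norm (Zn n) ?b"
      by (rule conv_norm_le_cg [OF \<alpha> b M \<open>0 \<le> M\<close>])
    also have "L2_norm (Zn n) ?b = fin_norm ?K ?b"
      by (rule L2_norm_finite_support [OF K]) simp
    also have "\<dots> = fin_norm ?K \<beta>" by (rule L2_set_cong) simp_all
    also have "\<dots> \<le> L2_norm (Zn n) \<beta>" by (rule fin_norm_le_L2_norm [OF \<beta> K])
    finally show ?thesis using \<open>0 \<le> M\<close> by (simp add: mult_left_mono)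
  qed
  show m: "conv (Zn n) \<alpha> \<beta> \<in> L2 (Zn n)"
    by (rule L2I [OF _ *]) (rule conv_outside)
  show "L2_norm (Zn n) (conv (Zn n) \<alpha> \<beta>) \<le> M * L2_norm (Zn n) \<beta>"
    by (rule L2_norm_leI [OF m *])
qed

lemma laurent_eval_norm_le:
  assumes "z \<in> torus n"
  shows "cmod (laurent_eval n \<alpha> z) \<le> (\<Sum>g | \<alpha> g \<noteq> 0. cmod (\<alpha> g))"
  unfolding laurent_eval_def character_def [symmetric]
  by (rule sum_norm_le) (simp add: norm_mult character_norm [OF assms])

lemma conv_L2:
  assumes "\<alpha> \<in> cg n" "\<beta> \<in> L2 (Zn n)"
  shows "conv (Zn n) \<alpha> \<beta> \<in> L2 (Zn n)"
  by (rule conv_L2_bounded [OF assms laurent_eval_norm_le]) (simp_all add: sum_nonneg)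

lemma conv_scale_right: "conv G a (\<lambda>g. c * b g) g = c * conv G a b g"
  by (simp add: conv_def sum_distrib_left mult.left_commute)

lemma left_mult_bounded:
  assumes "\<alpha> \<in> cg n"
  shows "left_mult (Zn n) \<alpha> \<in> bounded_ops (Zn n)"
proof (rule bounded_opsI)
  show "op_bounded_by (Zn n) (left_mult (Zn n) \<alpha>) (\<Sum>g | \<alpha> g \<noteq> 0. cmod (\<alpha> g))"
    unfolding op_bounded_by_def left_mult_def
    using conv_norm_le [OF assms _ laurent_eval_norm_le] by (simp add: sum_nonneg)
  fix \<beta> assume \<beta>: "\<beta> \<in> L2 (Zn n)"
  show "left_mult (Zn n) \<alpha> \<beta> \<in> L2 (Zn n)"
    using \<beta> by (simp add: left_mult_def conv_L2 assms)
  show "left_mult (Zn n) \<alpha> (\<lambda>g. c * \<beta> g) = (\<lambda>g. c * left_mult (Zn n) \<alpha> \<beta> g)" for c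
    using \<beta> L2_scale [OF \<beta>] unfolding left_mult_def by (simp add: fun_eq_iff conv_scale_right [of _ _ c \<beta>])
  fix \<gamma> assume \<gamma>: "\<gamma> \<in> L2 (Zn n)"
  show "left_mult (Zn n) \<alpha> (\<lambda>g. \<beta> g + \<gamma> g) = (\<lambda>g. left_mult (Zn n) \<alpha> \<beta> g + left_mult (Zn n) \<alpha> \<gamma> g)"
    using \<beta> \<gamma> L2_add [OF \<beta> \<gamma>] unfolding left_mult_def by (simp add: fun_eq_iff conv_add_right [of _ _ \<beta> \<gamma>])
qed (simp add: left_mult_def)

lemma left_mult_bounded_by:
  assumes "\<alpha> \<in> cg n" "\<And>z. z \<in> torus n \<Longrightarrow> cmod (laurent_eval n \<alpha> z) \<le> M" "0 \<le> M"
  shows "op_bounded_by (Zn n) (left_mult (Zn n) \<alpha>) M"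
  unfolding op_bounded_by_def left_mult_def using conv_norm_le [OF assms(1) _ assms(2,3)] by simp

section \<open>The supremum norm is at most the operator norm\<close>

text \<open>The element of \<open>\<int>\<^sup>n\<close> with the coordinates \<open>f 0, \<dots>, f (n - 1)\<close>.\<close>

definition lattice_point :: "nat \<Rightarrow> (nat \<Rightarrow> int) \<Rightarrow> nat \<Rightarrow>\<^sub>0 int"
  where "lattice_point n f = (\<Sum>i<n. frag_cmul (f i) (frag_of i))"

lemma lookup_lattice_point: "Poly_Mapping.lookup (lattice_point n f) i = (if i < n then f i else 0)"
proof -
  have "Poly_Mapping.lookup (lattice_point n f) i = (\<Sum>j<n. if j = i then f i else 0)"
    unfolding lattice_point_def lookup_sum by (intro sum.cong) (auto simp: lookup_frag_of)
  then show ?thesis by simp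
qed

text \<open>The elements of \<open>\<int>\<^sup>n\<close> all of whose coordinates lie in \<open>[a, b)\<close>.\<close>

definition lattice_cube :: "nat \<Rightarrow> int \<Rightarrow> int \<Rightarrow> (nat \<Rightarrow>\<^sub>0 int) set"
  where "lattice_cube n a b = lattice_point n ` ({..<n} \<rightarrow>\<^sub>E {a..<b})"

lemma lattice_cube_iff:
  "g \<in> lattice_cube n a b \<longleftrightarrow> g \<in> carrier (Zn n) \<and> (\<forall>i<n. a \<le> Poly_Mapping.lookup g i \<and> Poly_Mapping.lookup g i < b)"
proof
  assume "g \<in> lattice_cube n a b"
  then obtain f where f: "g = lattice_point n f" "f \<in> {..<n} \<rightarrow>\<^sub>E {a..<b}" by (auto simp: lattice_cube_def)
  have "g \<in> carrier (Zn n)"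
    by (auto simp: f(1) in_keys_iff lookup_lattice_point split: if_splits)
  then show "g \<in> carrier (Zn n) \<and> (\<forall>i<n. a \<le> Poly_Mapping.lookup g i \<and> Poly_Mapping.lookup g i < b)"
    using f(2) by (auto simp: f(1) lookup_lattice_point PiE_iff)
next
  assume g: "g \<in> carrier (Zn n) \<and> (\<forall>i<n. a \<le> Poly_Mapping.lookup g i \<and> Poly_Mapping.lookup g i < b)"
  let ?f = "restrict (Poly_Mapping.lookup g) {..<n}"
  have "lattice_point n ?f \<in> carrier (Zn n)"
    by (auto simp: in_keys_iff lookup_lattice_point split: if_splits)
  then have "lattice_point n ?f = g"
    using g by (intro Zn_eqI [of _ n]) (auto simp: lookup_lattice_point simp del: carrier_free_Abelian_group_iff)
  moreover have "?f \<in> {..<n} \<rightarrow>\<^sub>E {a..<b}" using g by auto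
  ultimately show "g \<in> lattice_cube n a b" unfolding lattice_cube_def by (metis image_eqI)
qed

lemma lattice_cube_finite: "finite (lattice_cube n a b)"
  unfolding lattice_cube_def by (intro finite_imageI finite_PiE) auto

lemma lattice_cube_carrier: "lattice_cube n a b \<subseteq> carrier (Zn n)"
  using lattice_cube_iff by blast

lemma card_lattice_cube: "card (lattice_cube n a b) = nat (b - a) ^ n"
proof -
  have "inj_on (lattice_point n) ({..<n} \<rightarrow>\<^sub>E {a..<b})"
  proof (rule inj_onI)
    fix f f' assume f: "f \<in> {..<n} \<rightarrow>\<^sub>E {a..<b}" "f' \<in> {..<n} \<rightarrow>\<^sub>E {a..<b}"
      and e: "lattice_point n f = lattice_point n f'"
    show "f = f'"
    proof (rule PiE_ext [OF f])
      fix i assume "i \<in> {..<n}"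
      then show "f i = f' i"
        using arg_cong [OF e, of "\<lambda>g. Poly_Mapping.lookup g i"] by (simp add: lookup_lattice_point)
    qed
  qed
  then show ?thesis unfolding lattice_cube_def by (subst card_image) (simp_all add: card_PiE)
qed

lemma fin_norm_const:
  assumes "\<And>g. g \<in> S \<Longrightarrow> cmod (\<beta> g) = c" "0 \<le> c"
  shows "fin_norm S \<beta> = sqrt (card S) * c"
proof -
  have "(\<Sum>g\<in>S. (cmod (\<beta> g))\<^sup>2) = (\<Sum>g\<in>S. c\<^sup>2)" using assms by (intro sum.cong) auto
  then show ?thesis using assms(2) by (simp add: L2_set_def real_sqrt_mult)
qed

text \<open>A character \<open>g \<mapsto> z\<^sup>-\<^sup>g\<close> is an eigenvector of \<open>\<alpha>\<close> with eigenvalue the value of \<open>\<alpha>\<close> at \<open>z\<close>, except that it is not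
  square summable.  Cutting it off on a large cube changes this only near the boundary of the cube, and the
  boundary is asymptotically negligible.\<close>

lemma laurent_eval_le_op_bound:
  assumes \<alpha>: "\<alpha> \<in> cg n" and M: "op_bounded_by (Zn n) (left_mult (Zn n) \<alpha>) M" "0 \<le> M"
    and z: "z \<in> torus n"
  shows "cmod (laurent_eval n \<alpha> z) \<le> M"
proof -
  let ?A = "{g. \<alpha> g \<noteq> 0}"
  have A: "finite ?A" "?A \<subseteq> carrier (Zn n)" using \<alpha> by (simp_all add: cg_iff)
  obtain R where R: "\<And>h i. h \<in> ?A \<Longrightarrow> \<bar>Poly_Mapping.lookup h i\<bar> < int R"
    using Zn_separating_bound [of "insert 0 ?A"] A(1) by force
  define c where "c = cmod (laurent_eval n \<alpha> z)"
  have c: "0 \<le> c" by (simp add: c_def)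
  \<comment> \<open>The cutoff to a cube of side \<open>k + 2R\<close> is an exact eigenvector on the concentric cube of side \<open>k\<close>, because
    the support of \<open>\<alpha>\<close> has radius at most \<open>R\<close>.\<close>
  have le: "sqrt (real k ^ n) * c \<le> M * sqrt (real (k + 2 * R) ^ n)" for k
  proof -
    let ?N = "int (k + 2 * R)"
    let ?B = "lattice_cube n 0 ?N" and ?I = "lattice_cube n (int R) (int (k + R))"
    let ?\<beta> = "\<lambda>g. if g \<in> ?B then character n z (- g) else 0"
    have \<beta>: "?\<beta> \<in> L2 (Zn n)"
      by (rule L2_finite_support [of ?B, OF lattice_cube_finite lattice_cube_carrier]) simp
    have "L2_norm (Zn n) ?\<beta> = fin_norm ?B ?\<beta>"
      by (rule L2_norm_finite_support [of ?B, OF lattice_cube_finite lattice_cube_carrier]) simp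
    also have "\<dots> = sqrt (card ?B) * 1"
      by (rule fin_norm_const) (simp_all add: character_norm [OF z])
    also have "\<dots> = sqrt (real (k + 2 * R) ^ n)" by (simp add: card_lattice_cube)
    finally have nb: "L2_norm (Zn n) ?\<beta> = sqrt (real (k + 2 * R) ^ n)" .
    have "cmod (conv (Zn n) \<alpha> ?\<beta> g) = c" if g: "g \<in> ?I" for g
    proof -
      have gc: "g \<in> carrier (Zn n)" using g lattice_cube_carrier by blast
      have "conv (Zn n) \<alpha> ?\<beta> g = (\<Sum>h\<in>?A. \<alpha> h * ?\<beta> (g - h))"
        by (rule conv_Zn [OF A order_refl gc])
      also have "\<dots> = (\<Sum>h\<in>?A. \<alpha> h * character n z h * character n z (- g))"
      proof (rule sum.cong [OF refl])
        fix h assume h: "h \<in> ?A"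
        then have "h \<in> carrier (Zn n)" using A by blast
        then have d: "g - h \<in> carrier (Zn n)" by (rule Zn_diff [OF gc])
        have "0 \<le> Poly_Mapping.lookup (g - h) i \<and> Poly_Mapping.lookup (g - h) i < ?N" if "i < n" for i
        proof -
          have "int R \<le> Poly_Mapping.lookup g i \<and> Poly_Mapping.lookup g i < int (k + R)"
            using g that unfolding lattice_cube_iff by blast
          then show ?thesis using R [OF h, of i] unfolding lookup_minus by (simp add: abs_less_iff)
        qed
        then have "g - h \<in> ?B" using d unfolding lattice_cube_iff by blast
        then have "?\<beta> (g - h) = character n z (h + - g)" by simp
        then show "\<alpha> h * ?\<beta> (g - h) = \<alpha> h * character n z h * character n z (- g)"
          unfolding character_add [OF z] by (simp only: mult.assoc)
      qed
      also have "\<dots> = laurent_eval n \<alpha> z * character n z (- g)"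
        by (simp only: sum_distrib_right laurent_eval_superset [OF A(1) order_refl])
      finally show ?thesis by (simp only: norm_mult character_norm [OF z] c_def mult_1_right)
    qed
    then have "sqrt (card ?I) * c = fin_norm ?I (conv (Zn n) \<alpha> ?\<beta>)"
      by (intro fin_norm_const [symmetric] c)
    also have "\<dots> \<le> L2_norm (Zn n) (conv (Zn n) \<alpha> ?\<beta>)"
      by (rule fin_norm_le_L2_norm [OF conv_L2 [OF \<alpha> \<beta>] lattice_cube_finite lattice_cube_carrier])
    also have "\<dots> \<le> M * L2_norm (Zn n) ?\<beta>"
      using bspec [OF M(1) [unfolded op_bounded_by_def] \<beta>] by (simp only: left_mult_def restrict_apply' [OF \<beta>])
    finally show ?thesis unfolding nb card_lattice_cube by simp
  qed
  have sq: "c\<^sup>2 \<le> M\<^sup>2 * (1 + real (2 * R) / real (Suc k)) ^ n" for k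
  proof -
    have "(sqrt (real (Suc k) ^ n) * c)\<^sup>2 \<le> (M * sqrt (real (Suc k + 2 * R) ^ n))\<^sup>2"
      using c by (intro power_mono le) auto
    then have "real (Suc k) ^ n * c\<^sup>2 \<le> M\<^sup>2 * real (Suc k + 2 * R) ^ n"
      by (simp add: power_mult_distrib)
    also have "real (Suc k + 2 * R) = real (Suc k) * (1 + real (2 * R) / real (Suc k))"
      by (simp add: field_simps)
    finally have "real (Suc k) ^ n * c\<^sup>2 \<le> real (Suc k) ^ n * (M\<^sup>2 * (1 + real (2 * R) / real (Suc k)) ^ n)"
      by (simp only: power_mult_distrib mult.left_commute)
    then show ?thesis by (simp only: mult_le_cancel_left_pos zero_less_power of_nat_0_less_iff zero_less_Suc)
  qed
  have "(\<lambda>k. real (2 * R) / real (Suc k)) \<longlonglongrightarrow> 0"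
    by (rule LIMSEQ_Suc [OF lim_const_over_n])
  then have "(\<lambda>k. M\<^sup>2 * (1 + real (2 * R) / real (Suc k)) ^ n) \<longlonglongrightarrow> M\<^sup>2 * (1 + 0) ^ n"
    by (intro tendsto_intros)
  then have "c\<^sup>2 \<le> M\<^sup>2 * (1 + 0) ^ n"
    by (rule LIMSEQ_le_const) (use sq in blast)
  then show ?thesis
    using M(2) power2_le_imp_le [of c M] by (simp add: c_def)
qed

section \<open>Pairs of an operator and its transform\<close>

lemma laurent_eval_continuous: "continuous_on (torus n) (laurent_eval n \<alpha>)"
  unfolding laurent_eval_def
  by (intro continuous_intros continuous_on_product_coordinates [THEN continuous_on_subset])
     (auto simp: torus_nonzero)

text \<open>\<open>T\<close> and \<open>f\<close> are limits of one and the same sequence in the group ring, in the operator norm and in the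
  supremum norm, respectively.\<close>

definition fourier_pair ::
    "nat \<Rightarrow> (((nat \<Rightarrow>\<^sub>0 int) \<Rightarrow> complex) \<Rightarrow> (nat \<Rightarrow>\<^sub>0 int) \<Rightarrow> complex) \<Rightarrow> ((nat \<Rightarrow> complex) \<Rightarrow> complex) \<Rightarrow> bool"
  where "fourier_pair n T f \<longleftrightarrow> T \<in> bounded_ops (Zn n) \<and> f \<in> carrier (torus_functions n) \<and>
    (\<forall>e>0. \<exists>\<alpha>\<in>cg n. op_bounded_by (Zn n) (op_diff (Zn n) T (left_mult (Zn n) \<alpha>)) e \<and>
      (\<forall>z\<in>torus n. cmod (f z - laurent_eval n \<alpha> z) \<le> e))"

lemma fourier_pairE:
  assumes "fourier_pair n T f" "0 < e"
  obtains \<alpha> where "\<alpha> \<in> cg n"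
    "op_bounded_by (Zn n) (op_diff (Zn n) T (left_mult (Zn n) \<alpha>)) e"
    "\<forall>z\<in>torus n. cmod (f z - laurent_eval n \<alpha> z) \<le> e"
  using assms unfolding fourier_pair_def by blast

lemma op_bounded_by_mono:
  assumes "op_bounded_by G D c" "c \<le> d" shows "op_bounded_by G D d"
  using assms mult_right_mono [OF assms(2) L2_norm_nonneg] unfolding op_bounded_by_def
  by (meson order_trans)

lemma op_dist_le_iff_Zn:
  "T \<in> bounded_ops (Zn n) \<Longrightarrow> \<alpha> \<in> cg n \<Longrightarrow>
    op_dist (Zn n) T (left_mult (Zn n) \<alpha>) \<le> e \<longleftrightarrow>
    0 \<le> e \<and> op_bounded_by (Zn n) (op_diff (Zn n) T (left_mult (Zn n) \<alpha>)) e"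
  by (rule op_dist_le_iff [OF _ left_mult_bounded Zn_zero])

lemma fourier_pair_iff_op_dist:
  assumes "T \<in> bounded_ops (Zn n)" "f \<in> carrier (torus_functions n)"
  shows "fourier_pair n T f \<longleftrightarrow> (\<forall>e>0. \<exists>\<alpha>\<in>cg n. op_dist (Zn n) T (left_mult (Zn n) \<alpha>) < e \<and>
        (\<forall>z\<in>torus n. cmod (f z - laurent_eval n \<alpha> z) < e))" (is "_ \<longleftrightarrow> ?R")
proof
  assume p: "fourier_pair n T f"
  show ?R
  proof (intro allI impI)
    fix e :: real assume e: "e > 0"
    then obtain \<alpha> where \<alpha>: "\<alpha> \<in> cg n"
        "op_bounded_by (Zn n) (op_diff (Zn n) T (left_mult (Zn n) \<alpha>)) (e / 2)"
        "\<forall>z\<in>torus n. cmod (f z - laurent_eval n \<alpha> z) \<le> e / 2"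
      by (rule fourier_pairE [OF p half_gt_zero])
    have "op_dist (Zn n) T (left_mult (Zn n) \<alpha>) \<le> e / 2"
      using \<alpha>(2) e by (intro op_dist_le_iff_Zn [OF assms(1) \<alpha>(1), THEN iffD2]) simp
    then show "\<exists>\<alpha>\<in>cg n. op_dist (Zn n) T (left_mult (Zn n) \<alpha>) < e \<and>
        (\<forall>z\<in>torus n. cmod (f z - laurent_eval n \<alpha> z) < e)"
      using \<alpha>(1,3) e by (intro bexI [of _ \<alpha>] conjI ballI) force+
  qed
next
  assume r: ?R
  show "fourier_pair n T f"
    unfolding fourier_pair_def
  proof (intro conjI assms allI impI)
    fix e :: real assume e: "e > 0"
    then obtain \<alpha> where \<alpha>: "\<alpha> \<in> cg n" "op_dist (Zn n) T (left_mult (Zn n) \<alpha>) < e"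
        "\<forall>z\<in>torus n. cmod (f z - laurent_eval n \<alpha> z) < e"
      using r by meson
    then show "\<exists>\<alpha>\<in>cg n. op_bounded_by (Zn n) (op_diff (Zn n) T (left_mult (Zn n) \<alpha>)) e \<and>
      (\<forall>z\<in>torus n. cmod (f z - laurent_eval n \<alpha> z) \<le> e)"
      using op_dist_le_iff_Zn [OF assms(1) \<alpha>(1), of e] by (intro bexI [of _ \<alpha>]) (auto intro: less_imp_le)
  qed
qed

text \<open>The correspondence between \<open>T\<close> and \<open>f\<close> is isometric, because it is so on the group ring.  As it is also
  linear, either of \<open>T\<close> and \<open>f\<close> determines the other.\<close>

lemma fourier_pair_norm:
  assumes p: "fourier_pair n T f" and M: "0 \<le> M"
  shows "op_bounded_by (Zn n) T M \<longleftrightarrow> (\<forall>z\<in>torus n. cmod (f z) \<le> M)"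
proof -
  have T: "T \<in> bounded_ops (Zn n)" using p by (simp add: fourier_pair_def)
  note TL = bounded_opsD(2) [OF T]
  show ?thesis
  proof
    assume b: "op_bounded_by (Zn n) T M"
    show "\<forall>z\<in>torus n. cmod (f z) \<le> M"
    proof (rule ballI, rule field_le_epsilon)
      fix z and e :: real assume z: "z \<in> torus n" and e: "e > 0"
      obtain \<alpha> where \<alpha>: "\<alpha> \<in> cg n"
          "op_bounded_by (Zn n) (op_diff (Zn n) T (left_mult (Zn n) \<alpha>)) (e / 2)"
          "\<forall>z\<in>torus n. cmod (f z - laurent_eval n \<alpha> z) \<le> e / 2"
        by (rule fourier_pairE [OF p half_gt_zero [OF e]])
      note \<alpha>L = bounded_opsD(2) [OF left_mult_bounded [OF \<alpha>(1)]]
      let ?D = "op_diff (Zn n) T (left_mult (Zn n) \<alpha>)"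
      have "op_bounded_by (Zn n) (op_diff (Zn n) T ?D) (M + e / 2)"
        by (rule op_bounded_by_diff [OF TL _ b \<alpha>(2)]) (auto intro!: L2_diff TL \<alpha>L)
      then have "op_bounded_by (Zn n) (left_mult (Zn n) \<alpha>) (M + e / 2)"
        by (rule op_bounded_by_cong [THEN iffD1, rotated]) simp
      then have "cmod (laurent_eval n \<alpha> z) \<le> M + e / 2"
        by (rule laurent_eval_le_op_bound [OF \<alpha>(1) _ _ z]) (use M e in simp)
      then show "cmod (f z) \<le> M + e"
        using \<alpha>(3) [rule_format, OF z] norm_triangle_sub [of "f z" "laurent_eval n \<alpha> z"] by linarith
    qed
  next
    assume b: "\<forall>z\<in>torus n. cmod (f z) \<le> M"
    have *: "op_bounded_by (Zn n) T (M + e)" if e: "e > 0" for e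
    proof -
      obtain \<alpha> where \<alpha>: "\<alpha> \<in> cg n"
          "op_bounded_by (Zn n) (op_diff (Zn n) T (left_mult (Zn n) \<alpha>)) (e / 2)"
          "\<forall>z\<in>torus n. cmod (f z - laurent_eval n \<alpha> z) \<le> e / 2"
        by (rule fourier_pairE [OF p half_gt_zero [OF e]])
      note \<alpha>L = bounded_opsD(2) [OF left_mult_bounded [OF \<alpha>(1)]]
      have "cmod (laurent_eval n \<alpha> z) \<le> M + e / 2" if "z \<in> torus n" for z
        using \<alpha>(3) [rule_format, OF that] bspec [OF b that] norm_triangle_sub [of "laurent_eval n \<alpha> z" "f z"]
          norm_minus_commute [of "f z" "laurent_eval n \<alpha> z"] by linarith
      then have \<alpha>M: "op_bounded_by (Zn n) (left_mult (Zn n) \<alpha>) (M + e / 2)"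
        by (rule left_mult_bounded_by [OF \<alpha>(1)]) (use M e in simp_all)
      have "op_bounded_by (Zn n) (\<lambda>\<beta>\<in>L2 (Zn n). \<lambda>g. left_mult (Zn n) \<alpha> \<beta> g +
          1 * op_diff (Zn n) T (left_mult (Zn n) \<alpha>) \<beta> g) (M + e / 2 + cmod 1 * (e / 2))"
        by (rule op_bounded_by_combine [OF \<alpha>L _ \<alpha>M \<alpha>(2)]) (auto intro!: L2_diff TL \<alpha>L)
      moreover have "M + e / 2 + cmod 1 * (e / 2) = M + e" by simp
      ultimately have "op_bounded_by (Zn n) (\<lambda>\<beta>\<in>L2 (Zn n). \<lambda>g. left_mult (Zn n) \<alpha> \<beta> g +
          1 * op_diff (Zn n) T (left_mult (Zn n) \<alpha>) \<beta> g) (M + e)" by (simp only:)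
      then show ?thesis
        by (rule op_bounded_by_cong [THEN iffD1, rotated]) simp
    qed
    show "op_bounded_by (Zn n) T M"
      unfolding op_bounded_by_def
    proof
      fix \<beta> assume \<beta>: "\<beta> \<in> L2 (Zn n)"
      show "L2_norm (Zn n) (T \<beta>) \<le> M * L2_norm (Zn n) \<beta>"
      proof (rule field_le_epsilon)
        fix e :: real assume e: "e > 0"
        let ?l = "L2_norm (Zn n) \<beta>" let ?d = "e / (1 + ?l)"
        have p: "1 + ?l > 0" using L2_norm_nonneg [of "Zn n" \<beta>] by linarith
        have "L2_norm (Zn n) (T \<beta>) \<le> (M + ?d) * ?l"
          using * [of ?d] e p \<beta> by (auto simp: op_bounded_by_def)
        also have "?d * ?l \<le> e" using e p by (simp add: field_simps)
        then have "(M + ?d) * ?l \<le> M * ?l + e" by (simp add: distrib_right)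
        finally show "L2_norm (Zn n) (T \<beta>) \<le> M * ?l + e" .
      qed
    qed
  qed
qed

lemma torus_functions_combine:
  assumes "f \<in> carrier (torus_functions n)" "h \<in> carrier (torus_functions n)"
  shows "(\<lambda>z\<in>torus n. f z + k * h z) \<in> carrier (torus_functions n)"
  using assms unfolding CT_carrier
  by (auto intro!: continuous_intros simp: continuous_on_restrict)

lemma fourier_pair_combine:
  assumes p: "fourier_pair n S f" and q: "fourier_pair n T h"
  shows "fourier_pair n (\<lambda>\<beta>\<in>L2 (Zn n). \<lambda>g. S \<beta> g + k * T \<beta> g) (\<lambda>z\<in>torus n. f z + k * h z)"
  unfolding fourier_pair_def
proof (intro conjI allI impI)
  have S: "S \<in> bounded_ops (Zn n)" and T: "T \<in> bounded_ops (Zn n)"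
    using p q by (simp_all add: fourier_pair_def)
  show "(\<lambda>\<beta>\<in>L2 (Zn n). \<lambda>g. S \<beta> g + k * T \<beta> g) \<in> bounded_ops (Zn n)"
    by (rule bounded_ops_combine [OF S T])
  show "(\<lambda>z\<in>torus n. f z + k * h z) \<in> carrier (torus_functions n)"
    using p q by (intro torus_functions_combine) (simp_all add: fourier_pair_def)
  fix e :: real assume e: "e > 0"
  define d where "d = e / (1 + cmod k)"
  have k: "1 + cmod k > 0" using norm_ge_zero [of k] by linarith
  have "(1 + cmod k) * d = e" using k by (simp add: d_def)
  then have d: "d > 0" "d + cmod k * d = e" using e k by (simp_all only: d_def distrib_right mult_1_left divide_pos_pos)
  obtain a where a: "a \<in> cg n" "op_bounded_by (Zn n) (op_diff (Zn n) S (left_mult (Zn n) a)) d"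
      "\<forall>z\<in>torus n. cmod (f z - laurent_eval n a z) \<le> d"
    by (rule fourier_pairE [OF p d(1)])
  obtain b where b: "b \<in> cg n" "op_bounded_by (Zn n) (op_diff (Zn n) T (left_mult (Zn n) b)) d"
      "\<forall>z\<in>torus n. cmod (h z - laurent_eval n b z) \<le> d"
    by (rule fourier_pairE [OF q d(1)])
  let ?c = "\<lambda>g. 1 * a g + k * b g"
  have c: "?c \<in> cg n" by (rule cg_combine [OF a(1) b(1)])
  have lc: "conv (Zn n) ?c \<beta> g = conv (Zn n) a \<beta> g + k * conv (Zn n) b \<beta> g" for \<beta> g
  proof (cases "g \<in> carrier (Zn n)")
    case True
    let ?A = "{g. a g \<noteq> 0} \<union> {g. b g \<noteq> 0}"
    have A: "finite ?A" "?A \<subseteq> carrier (Zn n)" using a(1) b(1) by (simp_all add: cg_iff)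
    show ?thesis
      by (subst (1 2 3) conv_Zn [OF A _ True]) (auto simp: sum_distrib_left sum.distrib [symmetric] algebra_simps)
  qed (simp add: conv_outside)
  have "op_bounded_by (Zn n) (\<lambda>\<beta>\<in>L2 (Zn n). \<lambda>g. op_diff (Zn n) S (left_mult (Zn n) a) \<beta> g +
      k * op_diff (Zn n) T (left_mult (Zn n) b) \<beta> g) (d + cmod k * d)"
    by (rule op_bounded_by_combine [OF _ _ a(2) b(2)])
       (simp_all add: L2_diff bounded_opsD(2) [OF S] bounded_opsD(2) [OF T]
          bounded_opsD(2) [OF left_mult_bounded] a(1) b(1))
  then have "op_bounded_by (Zn n) (op_diff (Zn n) (\<lambda>\<beta>\<in>L2 (Zn n). \<lambda>g. S \<beta> g + k * T \<beta> g) (left_mult (Zn n) ?c)) e"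
    unfolding d(2) by (rule op_bounded_by_cong [THEN iffD1, rotated]) (simp add: left_mult_def lc [simplified] algebra_simps)
  moreover have "cmod ((\<lambda>z\<in>torus n. f z + k * h z) z - laurent_eval n ?c z) \<le> e" if z: "z \<in> torus n" for z
  proof -
    have "(\<lambda>z\<in>torus n. f z + k * h z) z - laurent_eval n ?c z = (f z - laurent_eval n a z) + k * (h z - laurent_eval n b z)"
      unfolding laurent_eval_combine [OF a(1) b(1)] using z by (simp add: algebra_simps)
    also have "cmod \<dots> \<le> cmod (f z - laurent_eval n a z) + cmod k * cmod (h z - laurent_eval n b z)"
      by (rule order_trans [OF norm_triangle_ineq]) (simp add: norm_mult)
    also have "\<dots> \<le> d + cmod k * d"
      using a(3) [rule_format, OF z] b(3) [rule_format, OF z] by (intro add_mono mult_left_mono) auto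
    finally show ?thesis unfolding d(2) .
  qed
  ultimately show "\<exists>\<alpha>\<in>cg n. op_bounded_by (Zn n) (op_diff (Zn n) (\<lambda>\<beta>\<in>L2 (Zn n). \<lambda>g. S \<beta> g + k * T \<beta> g)
      (left_mult (Zn n) \<alpha>)) e \<and> (\<forall>z\<in>torus n. cmod ((\<lambda>z\<in>torus n. f z + k * h z) z - laurent_eval n \<alpha> z) \<le> e)"
    using c by blast
qed

lemma fourier_pair_unique_fun:
  assumes p: "fourier_pair n T f" and q: "fourier_pair n T h"
  shows "f = h"
proof (rule extensionalityI)
  show "f \<in> extensional (torus n)" "h \<in> extensional (torus n)"
    using p q by (simp_all add: fourier_pair_def CT_carrier)
  fix z assume z: "z \<in> torus n"
  let ?D = "\<lambda>\<beta>\<in>L2 (Zn n). \<lambda>g. T \<beta> g + (-1) * T \<beta> g"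
  have "op_bounded_by (Zn n) ?D 0" by (simp add: op_bounded_by_def L2_norm_zero)
  then show "f z = h z"
    using fourier_pair_norm [OF fourier_pair_combine [OF p q, of "-1"] order_refl] z by auto
qed

lemma fourier_pair_unique_op:
  assumes p: "fourier_pair n S f" and q: "fourier_pair n T f"
  shows "S = T"
proof (rule extensionalityI)
  have S: "S \<in> bounded_ops (Zn n)" and T: "T \<in> bounded_ops (Zn n)"
    using p q by (simp_all add: fourier_pair_def)
  then show "S \<in> extensional (L2 (Zn n))" "T \<in> extensional (L2 (Zn n))"
    by (simp_all add: bounded_opsD(1))
  let ?D = "\<lambda>\<beta>\<in>L2 (Zn n). \<lambda>g. S \<beta> g + (-1) * T \<beta> g"
  have "op_bounded_by (Zn n) ?D 0"
    using fourier_pair_norm [OF fourier_pair_combine [OF p q, of "-1"] order_refl] by simp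
  then have "?D = (\<lambda>\<beta>\<in>L2 (Zn n). \<lambda>g. 0)"
    by (rule bounded_ops_eq_0 [OF bounded_ops_combine [OF S T]])
  then show "S \<beta> = T \<beta>" if "\<beta> \<in> L2 (Zn n)" for \<beta>
    using that by (auto simp: fun_eq_iff dest!: spec [of _ \<beta>])
qed

text \<open>Associativity for an arbitrary third factor reduces to the group ring, because the value at one point
  depends on finitely many values of that factor only.\<close>

lemma conv_assoc_L2:
  assumes a: "a \<in> cg n" and b: "b \<in> cg n"
  shows "conv (Zn n) (conv (Zn n) a b) \<beta> = conv (Zn n) a (conv (Zn n) b \<beta>)"
proof
  fix g
  let ?A = "{g. a g \<noteq> 0}" and ?B = "{g. b g \<noteq> 0}"
  let ?AB = "(\<lambda>(h, k). h + k) ` (?A \<times> ?B)"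
  have A: "finite ?A" "?A \<subseteq> carrier (Zn n)" and B: "finite ?B" "?B \<subseteq> carrier (Zn n)"
    using assms by (simp_all add: cg_iff)
  have AB: "finite ?AB" "?AB \<subseteq> carrier (Zn n)"
    using A B by (auto intro!: Zn_add simp del: carrier_free_Abelian_group_iff)
  have supp: "{g. conv (Zn n) a b g \<noteq> 0} \<subseteq> ?AB"
    using group.conv_closed [OF group_free_Abelian_group A B] by (simp only: mult_free_Abelian_group)
  let ?K = "(\<lambda>p. g - p) ` ?AB"
  let ?c = "\<lambda>h. if h \<in> ?K then \<beta> h else 0"
  show "conv (Zn n) (conv (Zn n) a b) \<beta> g = conv (Zn n) a (conv (Zn n) b \<beta>) g"
  proof (cases "g \<in> carrier (Zn n)")
    case g: True
    have K: "finite ?K" "?K \<subseteq> carrier (Zn n)"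
      using AB Zn_diff [OF g] by (auto simp del: carrier_free_Abelian_group_iff)
    have c: "?c \<in> cg n" by (rule cgI [OF K]) simp
    have "conv (Zn n) (conv (Zn n) a b) \<beta> g = conv (Zn n) (conv (Zn n) a b) ?c g"
      unfolding conv_Zn [OF AB supp g] by (intro sum.cong refl) simp
    also have "\<dots> = conv (Zn n) a (conv (Zn n) b ?c) g"
    proof -
      have C: "finite {h. ?c h \<noteq> 0}" "{h. ?c h \<noteq> 0} \<subseteq> carrier (Zn n)"
        using c unfolding cg_iff by blast+
      show ?thesis by (rule fun_cong [OF group.conv_assoc [OF group_free_Abelian_group A B C]])
    qed
    also have "\<dots> = conv (Zn n) a (conv (Zn n) b \<beta>) g"
      unfolding conv_Zn [OF A order_refl g]
    proof (intro sum.cong refl)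
      fix h assume h: "h \<in> ?A"
      then have "h \<in> carrier (Zn n)" using A by blast
      then have gh: "g - h \<in> carrier (Zn n)" by (rule Zn_diff [OF g])
      have "conv (Zn n) b ?c (g - h) = conv (Zn n) b \<beta> (g - h)"
        unfolding conv_Zn [OF B order_refl gh]
      proof (intro sum.cong refl)
        fix k assume k: "k \<in> ?B"
        have "h + k \<in> ?AB" using h k by blast
        then have "g - h - k \<in> ?K" by (rule rev_image_eqI) (simp add: diff_diff_eq)
        then show "b k * ?c (g - h - k) = b k * \<beta> (g - h - k)" by (simp only: if_True)
      qed
      then show "a h * conv (Zn n) b ?c (g - h) = a h * conv (Zn n) b \<beta> (g - h)" by (simp only:)
    qed
    finally show ?thesis .
  qed (simp add: conv_outside)
qed

lemma fourier_pair_mult: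
  assumes p: "fourier_pair n T f" and a: "a \<in> cg n"
  shows "fourier_pair n (compose (L2 (Zn n)) (left_mult (Zn n) a) T) (\<lambda>z\<in>torus n. laurent_eval n a z * f z)"
  unfolding fourier_pair_def
proof (intro conjI allI impI)
  have T: "T \<in> bounded_ops (Zn n)" and f: "f \<in> carrier (torus_functions n)"
    using p by (simp_all add: fourier_pair_def)
  show "compose (L2 (Zn n)) (left_mult (Zn n) a) T \<in> bounded_ops (Zn n)"
    by (rule bounded_ops_compose [OF left_mult_bounded [OF a] T])
  show "(\<lambda>z\<in>torus n. laurent_eval n a z * f z) \<in> carrier (torus_functions n)"
    using f laurent_eval_continuous unfolding CT_carrier
    by (auto intro!: continuous_intros simp: continuous_on_restrict)
  fix e :: real assume e: "e > 0"
  define C where "C = (\<Sum>g | a g \<noteq> 0. cmod (a g))"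
  have C: "0 \<le> C" by (simp add: C_def sum_nonneg)
  have aC: "cmod (laurent_eval n a z) \<le> C" if "z \<in> torus n" for z
    unfolding C_def by (rule laurent_eval_norm_le [OF that])
  define d where "d = e / (1 + C)"
  have d: "d > 0" using e C by (simp add: d_def)
  have Cd: "C * d \<le> e" using e C by (simp add: d_def field_simps)
  obtain b where b: "b \<in> cg n" "op_bounded_by (Zn n) (op_diff (Zn n) T (left_mult (Zn n) b)) d"
      "\<forall>z\<in>torus n. cmod (f z - laurent_eval n b z) \<le> d"
    by (rule fourier_pairE [OF p d(1)])
  let ?c = "conv (Zn n) a b"
  have c: "?c \<in> cg n" by (rule cg_conv [OF a b(1)])
  have "op_bounded_by (Zn n) (op_diff (Zn n) (compose (L2 (Zn n)) (left_mult (Zn n) a) T) (left_mult (Zn n) ?c)) e"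
    unfolding op_bounded_by_def
  proof
    fix \<beta> assume \<beta>: "\<beta> \<in> L2 (Zn n)"
    let ?\<gamma> = "\<lambda>g. T \<beta> g - conv (Zn n) b \<beta> g"
    have T\<beta>: "T \<beta> \<in> L2 (Zn n)" by (rule bounded_opsD(2) [OF T \<beta>])
    have \<gamma>: "?\<gamma> \<in> L2 (Zn n)" by (intro L2_diff T\<beta> conv_L2 b(1) \<beta>)
    have "conv (Zn n) a (T \<beta>) g - conv (Zn n) ?c \<beta> g = conv (Zn n) a ?\<gamma> g" for g
      unfolding conv_assoc_L2 [OF a b(1)]
      using conv_add_right [of "Zn n" a ?\<gamma> "conv (Zn n) b \<beta>" g] by simp
    then have "op_diff (Zn n) (compose (L2 (Zn n)) (left_mult (Zn n) a) T) (left_mult (Zn n) ?c) \<beta> = conv (Zn n) a ?\<gamma>"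
      using \<beta> T\<beta> by (simp add: compose_eq left_mult_def fun_eq_iff)
    then have "L2_norm (Zn n) (op_diff (Zn n) (compose (L2 (Zn n)) (left_mult (Zn n) a) T) (left_mult (Zn n) ?c) \<beta>) =
        L2_norm (Zn n) (conv (Zn n) a ?\<gamma>)" by (rule arg_cong)
    also have "\<dots> \<le> C * L2_norm (Zn n) ?\<gamma>"
      by (rule conv_norm_le [OF a \<gamma> aC C])
    also have "\<dots> \<le> C * (d * L2_norm (Zn n) \<beta>)"
      using b(2) \<beta> unfolding op_bounded_by_def left_mult_def by (intro mult_left_mono C) fastforce
    also have "\<dots> \<le> e * L2_norm (Zn n) \<beta>"
      unfolding mult.assoc [symmetric] by (intro mult_right_mono Cd L2_norm_nonneg)
    finally show "L2_norm (Zn n) (op_diff (Zn n) (compose (L2 (Zn n)) (left_mult (Zn n) a) T) (left_mult (Zn n) ?c) \<beta>)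
        \<le> e * L2_norm (Zn n) \<beta>" .
  qed
  moreover have "cmod ((\<lambda>z\<in>torus n. laurent_eval n a z * f z) z - laurent_eval n ?c z) \<le> e" if z: "z \<in> torus n" for z
  proof -
    have "(\<lambda>z\<in>torus n. laurent_eval n a z * f z) z - laurent_eval n ?c z = laurent_eval n a z * (f z - laurent_eval n b z)"
      unfolding laurent_eval_conv [OF a b(1) z] using z by (simp add: algebra_simps)
    then have "cmod ((\<lambda>z\<in>torus n. laurent_eval n a z * f z) z - laurent_eval n ?c z) =
        cmod (laurent_eval n a z) * cmod (f z - laurent_eval n b z)" by (simp only: norm_mult)
    also have "\<dots> \<le> C * d" using aC [OF z] b(3) [rule_format, OF z] C by (intro mult_mono) auto
    finally show ?thesis using Cd by linarith
  qed
  ultimately show "\<exists>\<alpha>\<in>cg n. op_bounded_by (Zn n) (op_diff (Zn n) (compose (L2 (Zn n)) (left_mult (Zn n) a) T)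
      (left_mult (Zn n) \<alpha>)) e \<and> (\<forall>z\<in>torus n. cmod ((\<lambda>z\<in>torus n. laurent_eval n a z * f z) z - laurent_eval n \<alpha> z) \<le> e)"
    using c by blast
qed

section \<open>The Fourier transform is an isomorphism\<close>

text \<open>A Cauchy sequence with an explicit rate, and the rate of its convergence.\<close>

lemma limit_with_rate:
  fixes x :: "nat \<Rightarrow> complex"
  assumes e: "e \<longlonglongrightarrow> (0 :: real)" and x: "\<And>k l. cmod (x k - x l) \<le> e k + e l"
  shows "x \<longlonglongrightarrow> lim x" and "cmod (lim x - x k) \<le> e k"
proof -
  have "Cauchy x"
  proof (rule CauchyI)
    fix d :: real assume "d > 0"
    then have "\<forall>\<^sub>F k in sequentially. e k < d / 2" by (intro order_tendstoD [OF e]) simp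
    then obtain N where N: "\<And>k. k \<ge> N \<Longrightarrow> e k < d / 2" by (auto simp: eventually_sequentially)
    have "norm (x k - x l) < d" if "k \<ge> N" "l \<ge> N" for k l
      using x [of k l] N [OF that(1)] N [OF that(2)] by linarith
    then show "\<exists>N. \<forall>m\<ge>N. \<forall>l\<ge>N. norm (x m - x l) < d" by blast
  qed
  then show lim: "x \<longlonglongrightarrow> lim x"
    using Cauchy_convergent convergent_LIMSEQ_iff by blast
  have "(\<lambda>l. cmod (x l - x k)) \<longlonglongrightarrow> cmod (lim x - x k)"
    by (intro tendsto_intros lim)
  moreover have "(\<lambda>l. e l + e k) \<longlonglongrightarrow> 0 + e k"
    by (intro tendsto_intros e)
  ultimately have "cmod (lim x - x k) \<le> 0 + e k"
    by (rule LIMSEQ_le) (use x in blast)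
  then show "cmod (lim x - x k) \<le> e k" by simp
qed

lemma inverse_Suc_tendsto: "(\<lambda>k. 1 / real (Suc k)) \<longlonglongrightarrow> 0"
  by (rule LIMSEQ_Suc [OF lim_const_over_n])

lemma left_mult_diff:
  assumes "a \<in> cg n" "b \<in> cg n" "\<beta> \<in> L2 (Zn n)"
  shows "left_mult (Zn n) (\<lambda>g. a g - b g) \<beta> = (\<lambda>g. left_mult (Zn n) a \<beta> g - left_mult (Zn n) b \<beta> g)"
proof
  fix g
  let ?A = "{g. a g \<noteq> 0} \<union> {g. b g \<noteq> 0}"
  have A: "finite ?A" "?A \<subseteq> carrier (Zn n)" using assms by (simp_all add: cg_iff)
  have "conv (Zn n) (\<lambda>g. a g - b g) \<beta> g = conv (Zn n) a \<beta> g - conv (Zn n) b \<beta> g"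
  proof (cases "g \<in> carrier (Zn n)")
    case True
    show ?thesis
      by (subst (1 2 3) conv_Zn [OF A _ True]) (auto simp: sum_subtractf [symmetric] algebra_simps)
  qed (simp add: conv_outside)
  then show "left_mult (Zn n) (\<lambda>g. a g - b g) \<beta> g = left_mult (Zn n) a \<beta> g - left_mult (Zn n) b \<beta> g"
    using assms(3) by (simp add: left_mult_def)
qed

lemma cstar_carrier_iff:
  "T \<in> carrier (cstar_red G) \<longleftrightarrow> T \<in> bounded_ops G \<and>
    (\<forall>e>0. \<exists>\<alpha>\<in>carrier (complex_group_ring G). op_dist G T (left_mult G \<alpha>) < e)"
  by (simp add: cstar_red_def)

text \<open>Group ring elements that approximate \<open>T\<close> have transforms that form a uniform Cauchy sequence.\<close>

lemma fourier_pair_exists_fun: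
  assumes "T \<in> carrier (cstar_red (Zn n))"
  shows "\<exists>f. fourier_pair n T f"
proof -
  have T: "T \<in> bounded_ops (Zn n)" using assms by (simp add: cstar_red_def)
  note TL = bounded_opsD(2) [OF T]
  let ?e = "\<lambda>k. 1 / real (Suc k)"
  have "\<exists>\<alpha>. \<alpha> \<in> cg n \<and> op_bounded_by (Zn n) (op_diff (Zn n) T (left_mult (Zn n) \<alpha>)) (?e k)" for k
  proof -
    have "?e k > 0" by simp
    then obtain \<alpha> where \<alpha>: "\<alpha> \<in> cg n" "op_dist (Zn n) T (left_mult (Zn n) \<alpha>) < ?e k"
      using assms unfolding cstar_carrier_iff by blast
    then show ?thesis using op_dist_le_iff_Zn [OF T \<alpha>(1), of "?e k"] by auto
  qed
  from choice [OF allI [OF this]] obtain a where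
    "\<forall>k. a k \<in> cg n \<and> op_bounded_by (Zn n) (op_diff (Zn n) T (left_mult (Zn n) (a k))) (?e k)"
    by (rule exE)
  then have a: "a k \<in> cg n" "op_bounded_by (Zn n) (op_diff (Zn n) T (left_mult (Zn n) (a k))) (?e k)" for k
    by blast+
  note aL = bounded_opsD(2) [OF left_mult_bounded [OF a(1)]]
  have cauchy: "cmod (laurent_eval n (a k) z - laurent_eval n (a l) z) \<le> ?e k + ?e l" if z: "z \<in> torus n" for k l z
  proof -
    have D: "(\<lambda>g. a k g - a l g) \<in> cg n" by (rule cg_diff [OF a(1) a(1)])
    have "op_bounded_by (Zn n) (op_diff (Zn n) (op_diff (Zn n) T (left_mult (Zn n) (a l)))
        (op_diff (Zn n) T (left_mult (Zn n) (a k)))) (?e l + ?e k)"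
      by (rule op_bounded_by_diff [OF _ _ a(2) a(2)]) (auto intro!: L2_diff TL aL)
    then have "op_bounded_by (Zn n) (left_mult (Zn n) (\<lambda>g. a k g - a l g)) (?e l + ?e k)"
      by (rule op_bounded_by_cong [THEN iffD1, rotated]) (simp add: left_mult_diff a(1))
    then have "cmod (laurent_eval n (\<lambda>g. a k g - a l g) z) \<le> ?e l + ?e k"
      by (rule laurent_eval_le_op_bound [OF D _ _ z]) simp
    then show ?thesis by (simp add: laurent_eval_diff [OF a(1) a(1)] add.commute)
  qed
  define f where "f = (\<lambda>z\<in>torus n. lim (\<lambda>k. laurent_eval n (a k) z))"
  have f: "cmod (f z - laurent_eval n (a k) z) \<le> ?e k" if z: "z \<in> torus n" for z k
    using limit_with_rate(2) [OF inverse_Suc_tendsto cauchy [OF z], of k] z by (simp add: f_def)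
  have e_small: "\<forall>\<^sub>F k in sequentially. ?e k < d" if "d > 0" for d
    using order_tendstoD(2) [OF inverse_Suc_tendsto that] .
  have "uniform_limit (torus n) (\<lambda>k. laurent_eval n (a k)) f sequentially"
  proof (rule uniform_limitI)
    fix d :: real assume "d > 0"
    then show "\<forall>\<^sub>F k in sequentially. \<forall>z\<in>torus n. dist (laurent_eval n (a k) z) (f z) < d"
    proof (rule eventually_mono [OF e_small])
      fix k assume k: "?e k < d"
      show "\<forall>z\<in>torus n. dist (laurent_eval n (a k) z) (f z) < d"
      proof
        fix z assume "z \<in> torus n"
        from le_less_trans [OF f [OF this] k] show "dist (laurent_eval n (a k) z) (f z) < d"
          by (simp only: dist_norm norm_minus_commute)
      qed
    qed
  qed
  then have "continuous_on (torus n) f"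
    by (rule uniform_limit_theorem [rotated]) (simp_all add: laurent_eval_continuous)
  then have "f \<in> carrier (torus_functions n)" by (simp add: CT_carrier f_def)
  moreover have "\<exists>\<alpha>\<in>cg n. op_bounded_by (Zn n) (op_diff (Zn n) T (left_mult (Zn n) \<alpha>)) d \<and>
      (\<forall>z\<in>torus n. cmod (f z - laurent_eval n \<alpha> z) \<le> d)" if "d > 0" for d
  proof -
    from eventually_happens [OF e_small [OF that]] obtain k where "?e k < d" by auto
    then show ?thesis
      using f [of _ k] by (intro bexI [OF _ a(1) [of k]] conjI op_bounded_by_mono [OF a(2)] ballI) fastforce+
  qed
  ultimately have "fourier_pair n T f" using T unfolding fourier_pair_def by blast
  then show ?thesis by blast
qed

lemma fourier_pair_cstar:
  assumes "fourier_pair n T f" shows "T \<in> carrier (cstar_red (Zn n))"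
proof -
  have T: "T \<in> bounded_ops (Zn n)" "f \<in> carrier (torus_functions n)" using assms by (simp_all add: fourier_pair_def)
  show ?thesis
    using T(1) assms fourier_pair_iff_op_dist [OF T] unfolding cstar_carrier_iff by blast
qed

lemma torus_compact: "compact (torus n)"
proof -
  let ?S = "\<lambda>i. if i < n then {z :: complex. cmod z = 1} else {undefined}"
  have "torus n = Pi\<^sub>E UNIV ?S" 
  proof (rule Set.set_eqI)
    fix x
    have "x \<in> torus n \<longleftrightarrow> (\<forall>i. x i \<in> ?S i)"
      unfolding torus_iff by (intro iff_allI) simp
    also have "\<dots> \<longleftrightarrow> x \<in> Pi\<^sub>E UNIV ?S" by (simp only: PiE_UNIV_domain Pi_iff ball_UNIV)
    finally show "x \<in> torus n \<longleftrightarrow> x \<in> Pi\<^sub>E UNIV ?S" .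
  qed
  moreover have "compact (?S i)" for i
  proof -
    have "{z :: complex. cmod z = 1} = sphere 0 1" by (auto simp: dist_norm)
    then show ?thesis by simp
  qed
  then have "compactin (product_topology (\<lambda>_. euclidean) UNIV) (Pi\<^sub>E UNIV ?S)"
    unfolding compactin_PiE by simp
  ultimately show ?thesis by (simp add: euclidean_product_topology)
qed

lemma
  assumes "h \<in> carrier (Zn n)"
  shows cg_delta: "(\<lambda>g. if g = h then c else 0) \<in> cg n"
    and laurent_eval_delta: "laurent_eval n (\<lambda>g. if g = h then c else 0) z = c * character n z h"
proof -
  show "(\<lambda>g. if g = h then c else 0) \<in> cg n"
    by (rule cgI [of "{h}"]) (use assms in \<open>auto simp del: carrier_free_Abelian_group_iff\<close>)
  show "laurent_eval n (\<lambda>g. if g = h then c else 0) z = c * character n z h"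
    by (subst laurent_eval_superset [of "{h}"]) auto
qed

text \<open>Stone-Weierstrass, applied to the real functions on the torus that are Laurent polynomials.  The real
  and imaginary parts of the coordinates are among them, since \<open>cnj z\<^sub>i = z\<^sub>i\<^sup>-\<^sup>1\<close> on the torus, and separate points.\<close>

lemma laurent_dense:
  assumes f: "f \<in> carrier (torus_functions n)" and e: "e > 0"
  shows "\<exists>\<alpha>\<in>cg n. \<forall>z\<in>torus n. cmod (f z - laurent_eval n \<alpha> z) \<le> e"
proof -
  define P where "P g \<longleftrightarrow> continuous_on (torus n) g \<and>
    (\<exists>\<alpha>\<in>cg n. \<forall>z\<in>torus n. complex_of_real (g z) = laurent_eval n \<alpha> z)" for g :: "(nat \<Rightarrow> complex) \<Rightarrow> real"
  have dense: "\<exists>\<alpha>\<in>cg n. \<forall>z\<in>torus n. cmod (complex_of_real (u z) - laurent_eval n \<alpha> z) < e / 2"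
    if u: "continuous_on (torus n) u" for u
  proof -
    have "\<exists>g. P g \<and> (\<forall>z\<in>torus n. \<bar>u z - g z\<bar> < e / 2)"
    proof (rule Stone_Weierstrass_HOL [OF torus_compact _ _ _ _ _ u])
      show "P (\<lambda>z. c)" for c
        unfolding P_def
        by (intro conjI continuous_on_const bexI [of _ "\<lambda>g. if g = 0 then complex_of_real c else 0"])
           (auto simp: laurent_eval_delta [OF Zn_zero] character_zero intro: cg_delta [OF Zn_zero])
      show "continuous_on (torus n) g" if "P g" for g
        using that by (simp add: P_def)
      show "P (\<lambda>z. g z + h z)" if gh: "P g \<and> P h" for g h
      proof -
        obtain a b where "a \<in> cg n" "\<forall>z\<in>torus n. complex_of_real (g z) = laurent_eval n a z"
          and "b \<in> cg n" "\<forall>z\<in>torus n. complex_of_real (h z) = laurent_eval n b z"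
          using gh by (auto simp: P_def)
        then show ?thesis
          using gh unfolding P_def
          by (intro conjI continuous_intros bexI [of _ "\<lambda>g. a g + b g"]) (auto simp: laurent_eval_add intro: cg_add)
      qed
      show "P (\<lambda>z. g z * h z)" if gh: "P g \<and> P h" for g h
      proof -
        obtain a b where "a \<in> cg n" "\<forall>z\<in>torus n. complex_of_real (g z) = laurent_eval n a z"
          and "b \<in> cg n" "\<forall>z\<in>torus n. complex_of_real (h z) = laurent_eval n b z"
          using gh by (auto simp: P_def)
        then show ?thesis
          using gh unfolding P_def
          by (intro conjI continuous_intros bexI [of _ "conv (Zn n) a b"]) (auto simp: laurent_eval_conv intro: cg_conv)
      qed
      show "\<exists>g. P g \<and> g x \<noteq> g y" if xy: "x \<in> torus n \<and> y \<in> torus n \<and> x \<noteq> y" for x y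
      proof -
        have "\<exists>i<n. x i \<noteq> y i"
        proof (rule ccontr)
          assume "\<not> (\<exists>i<n. x i \<noteq> y i)"
          then have "x = y" using xy unfolding torus_def by (intro PiE_ext [of x "{..<n}" _ y]) auto
          then show False using xy by blast
        qed
        then obtain i where i: "i < n" "x i \<noteq> y i" by blast
        have fi: "frag_of i \<in> carrier (Zn n)" "- frag_of i \<in> carrier (Zn n)"
          using i Zn_diff [OF Zn_zero, of "frag_of i" n] by simp_all
        have cnj: "character n z (- frag_of i) = cnj (z i)" if z: "z \<in> torus n" for z
        proof -
          have "character n z (frag_of i) * character n z (- frag_of i) = 1"
            using character_add [OF z, of "frag_of i" "- frag_of i"] by (simp add: character_zero)
          moreover have "z i * cnj (z i) = 1"
            using torus_norm [OF z i(1)] by (simp add: complex_norm_square [symmetric])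
          ultimately show ?thesis
            using torus_nonzero [OF z i(1)] by (simp add: character_frag_of [OF i(1)]) (metis mult_left_cancel)
        qed
        let ?a = "\<lambda>c d g. 1 * (if g = frag_of i then c else 0) + 1 * (if g = - frag_of i then d else 0)"
        have a: "?a c d \<in> cg n" for c d
          by (rule cg_combine [OF cg_delta [OF fi(1)] cg_delta [OF fi(2)]])
        have ev: "laurent_eval n (?a c d) z = c * z i + d * cnj (z i)" if "z \<in> torus n" for c d z
          unfolding laurent_eval_combine [OF cg_delta [OF fi(1)] cg_delta [OF fi(2)]]
            laurent_eval_delta [OF fi(1)] laurent_eval_delta [OF fi(2)] character_frag_of [OF i(1)] cnj [OF that]
          by simp
        have ci: "continuous_on (torus n) (\<lambda>z. z i)"
          by (rule continuous_on_subset [OF continuous_on_product_coordinates]) simp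
        have "complex_of_real (Re w) = (1/2) * w + (1/2) * cnj w" for w
          by (simp add: complex_eq_iff)
        then have "P (\<lambda>z. Re (z i))"
          unfolding P_def
          by (intro conjI continuous_intros ci bexI [OF _ a [of "1/2" "1/2"]] ballI) (simp only: ev)
        moreover have "complex_of_real (Im w) = (-\<i>/2) * w + (\<i>/2) * cnj w" for w
          by (simp add: complex_eq_iff)
        then have "P (\<lambda>z. Im (z i))"
          unfolding P_def
          by (intro conjI continuous_intros ci bexI [OF _ a [of "-\<i>/2" "\<i>/2"]] ballI) (simp only: ev)
        moreover have "Re (x i) \<noteq> Re (y i) \<or> Im (x i) \<noteq> Im (y i)"
          using i(2) by (simp add: complex_eq_iff)
        ultimately show ?thesis by blast
      qed
      show "0 < e / 2" using e by simp
    qed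
    then obtain g \<alpha> where g: "\<And>z. z \<in> torus n \<Longrightarrow> \<bar>u z - g z\<bar> < e / 2"
      and \<alpha>: "\<alpha> \<in> cg n" "\<And>z. z \<in> torus n \<Longrightarrow> complex_of_real (g z) = laurent_eval n \<alpha> z"
      unfolding P_def by blast
    have "cmod (complex_of_real (u z) - laurent_eval n \<alpha> z) < e / 2" if "z \<in> torus n" for z
      using g [OF that] unfolding \<alpha>(2) [OF that, symmetric] of_real_diff [symmetric] norm_of_real .
    then show ?thesis using \<alpha>(1) by blast
  qed
  have cf: "continuous_on (torus n) f" using f by (simp add: CT_carrier)
  obtain a where a: "a \<in> cg n" "\<And>z. z \<in> torus n \<Longrightarrow> cmod (complex_of_real (Re (f z)) - laurent_eval n a z) < e / 2"
    using dense [of "\<lambda>z. Re (f z)"] cf by (metis continuous_on_Re)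
  obtain b where b: "b \<in> cg n" "\<And>z. z \<in> torus n \<Longrightarrow> cmod (complex_of_real (Im (f z)) - laurent_eval n b z) < e / 2"
    using dense [of "\<lambda>z. Im (f z)"] cf by (metis continuous_on_Im)
  have "cmod (f z - laurent_eval n (\<lambda>g. 1 * a g + \<i> * b g) z) \<le> e" if z: "z \<in> torus n" for z
  proof -
    have "f z - laurent_eval n (\<lambda>g. 1 * a g + \<i> * b g) z =
        (complex_of_real (Re (f z)) - laurent_eval n a z) + \<i> * (complex_of_real (Im (f z)) - laurent_eval n b z)"
      unfolding laurent_eval_combine [OF a(1) b(1)]
      by (subst complex_eq [of "f z"]) (simp add: algebra_simps)
    also have "cmod \<dots> \<le> cmod (complex_of_real (Re (f z)) - laurent_eval n a z) +
        cmod (\<i> * (complex_of_real (Im (f z)) - laurent_eval n b z))" by (rule norm_triangle_ineq)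
    also have "\<dots> \<le> e" using a(2) [OF z] b(2) [OF z] by (simp add: norm_mult)
    finally show ?thesis .
  qed
  then show ?thesis by (intro bexI [OF _ cg_combine [OF a(1) b(1)]]) blast
qed

lemma fin_norm_tendsto:
  assumes "\<And>g. (\<lambda>k. x k g) \<longlonglongrightarrow> y g"
  shows "(\<lambda>k. fin_norm F (x k)) \<longlonglongrightarrow> fin_norm F y"
  unfolding L2_set_def by (intro tendsto_intros assms)

text \<open>Laurent polynomials that converge uniformly to \<open>f\<close> define a Cauchy sequence of operators; its limit is
  formed at each coordinate of each image vector.\<close>

lemma fourier_pair_exists_op:
  assumes f: "f \<in> carrier (torus_functions n)"
  shows "\<exists>T. fourier_pair n T f"
proof -
  let ?e = "\<lambda>k. 1 / real (Suc k)"
  have "\<exists>\<alpha>. \<alpha> \<in> cg n \<and> (\<forall>z\<in>torus n. cmod (f z - laurent_eval n \<alpha> z) \<le> ?e k)" for k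
    using laurent_dense [OF f, of "?e k"] by auto
  from choice [OF allI [OF this]] obtain a where
    "\<forall>k. a k \<in> cg n \<and> (\<forall>z\<in>torus n. cmod (f z - laurent_eval n (a k) z) \<le> ?e k)"
    by (rule exE)
  then have a: "a k \<in> cg n" "\<forall>z\<in>torus n. cmod (f z - laurent_eval n (a k) z) \<le> ?e k" for k
    by blast+
  have cauchy: "L2_norm (Zn n) (\<lambda>g. conv (Zn n) (a k) \<beta> g - conv (Zn n) (a l) \<beta> g) \<le> (?e k + ?e l) * L2_norm (Zn n) \<beta>"
    if \<beta>: "\<beta> \<in> L2 (Zn n)" for k l \<beta>
  proof -
    have D: "(\<lambda>g. a k g - a l g) \<in> cg n" by (rule cg_diff [OF a(1) a(1)])
    have "L2_norm (Zn n) (conv (Zn n) (\<lambda>g. a k g - a l g) \<beta>) \<le> (?e k + ?e l) * L2_norm (Zn n) \<beta>"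
    proof (rule conv_norm_le [OF D \<beta>])
      fix z assume z: "z \<in> torus n"
      have "cmod (laurent_eval n (a k) z - laurent_eval n (a l) z) \<le>
          cmod (laurent_eval n (a k) z - f z) + cmod (f z - laurent_eval n (a l) z)"
        using norm_triangle_ineq [of "laurent_eval n (a k) z - f z" "f z - laurent_eval n (a l) z"] by simp
      then show "cmod (laurent_eval n (\<lambda>g. a k g - a l g) z) \<le> ?e k + ?e l"
        unfolding laurent_eval_diff [OF a(1) a(1)]
        using bspec [OF a(2) z, of k] bspec [OF a(2) z, of l] norm_minus_commute [of "f z" "laurent_eval n (a k) z"]
        by linarith
    qed simp
    then show ?thesis
      using left_mult_diff [OF a(1) a(1) \<beta>, of k l] \<beta> by (simp add: left_mult_def)
  qed
  define T where "T = (\<lambda>\<beta>\<in>L2 (Zn n). \<lambda>g. lim (\<lambda>k. conv (Zn n) (a k) \<beta> g))"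
  have lim: "(\<lambda>k. conv (Zn n) (a k) \<beta> g) \<longlonglongrightarrow> T \<beta> g" if \<beta>: "\<beta> \<in> L2 (Zn n)" for \<beta> g
  proof -
    let ?c = "L2_norm (Zn n) \<beta>"
    have "(\<lambda>k. ?e k * ?c) \<longlonglongrightarrow> 0 * ?c" by (intro tendsto_intros inverse_Suc_tendsto)
    then have 0: "(\<lambda>k. ?e k * ?c) \<longlonglongrightarrow> 0" by simp
    have "cmod (conv (Zn n) (a k) \<beta> g - conv (Zn n) (a l) \<beta> g) \<le> ?e k * ?c + ?e l * ?c" for k l
    proof -
      have "(\<lambda>g. conv (Zn n) (a k) \<beta> g - conv (Zn n) (a l) \<beta> g) \<in> L2 (Zn n)"
        by (intro L2_diff conv_L2 a(1) \<beta>)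
      from norm_le_L2_norm [OF this, of g] show ?thesis
        using cauchy [OF \<beta>, of k l] by (simp only: distrib_right)
    qed
    from limit_with_rate(1) [OF 0 this] show ?thesis using \<beta> by (simp add: T_def)
  qed
  have close: "fin_norm F (\<lambda>g. T \<beta> g - conv (Zn n) (a k) \<beta> g) \<le> ?e k * L2_norm (Zn n) \<beta>"
    if \<beta>: "\<beta> \<in> L2 (Zn n)" and F: "finite F" "F \<subseteq> carrier (Zn n)" for \<beta> k F
  proof -
    let ?c = "L2_norm (Zn n) \<beta>"
    have "(\<lambda>l. (?e l + ?e k) * ?c) \<longlonglongrightarrow> (0 + ?e k) * ?c"
      by (intro tendsto_intros inverse_Suc_tendsto)
    moreover have "(\<lambda>l. fin_norm F (\<lambda>g. conv (Zn n) (a l) \<beta> g - conv (Zn n) (a k) \<beta> g)) \<longlonglongrightarrow>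
        fin_norm F (\<lambda>g. T \<beta> g - conv (Zn n) (a k) \<beta> g)"
      by (intro fin_norm_tendsto tendsto_intros lim \<beta>)
    moreover have "fin_norm F (\<lambda>g. conv (Zn n) (a l) \<beta> g - conv (Zn n) (a k) \<beta> g) \<le> (?e l + ?e k) * ?c" for l
    proof -
      have "(\<lambda>g. conv (Zn n) (a l) \<beta> g - conv (Zn n) (a k) \<beta> g) \<in> L2 (Zn n)"
        by (intro L2_diff conv_L2 a(1) \<beta>)
      from fin_norm_le_L2_norm [OF this F] show ?thesis using cauchy [OF \<beta>, of l k] by linarith
    qed
    ultimately have "fin_norm F (\<lambda>g. T \<beta> g - conv (Zn n) (a k) \<beta> g) \<le> (0 + ?e k) * ?c"
      by (intro LIMSEQ_le) auto
    then show ?thesis by simp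
  qed
  have outside: "T \<beta> g = 0" if \<beta>: "\<beta> \<in> L2 (Zn n)" and g: "g \<notin> carrier (Zn n)" for \<beta> g
    using lim [OF \<beta>, of g] unfolding conv_outside [OF g] by (simp add: LIMSEQ_const_iff)
  have diff: "(\<lambda>g. T \<beta> g - conv (Zn n) (a k) \<beta> g) \<in> L2 (Zn n)" if \<beta>: "\<beta> \<in> L2 (Zn n)" for \<beta> k
    by (rule L2I [OF _ close [OF \<beta>]]) (simp add: outside \<beta> conv_outside del: carrier_free_Abelian_group_iff)
  have TL: "T \<beta> \<in> L2 (Zn n)" if \<beta>: "\<beta> \<in> L2 (Zn n)" for \<beta>
    using L2_add [OF diff [OF \<beta>, of 0] conv_L2 [OF a(1) \<beta>, of 0]] by simp
  have bound: "op_bounded_by (Zn n) (op_diff (Zn n) T (left_mult (Zn n) (a k))) (?e k)" for k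
    unfolding op_bounded_by_def
  proof
    fix \<beta> assume \<beta>: "\<beta> \<in> L2 (Zn n)"
    then show "L2_norm (Zn n) (op_diff (Zn n) T (left_mult (Zn n) (a k)) \<beta>) \<le> ?e k * L2_norm (Zn n) \<beta>"
      using L2_norm_leI [OF diff [OF \<beta>] close [OF \<beta>]] by (simp add: left_mult_def)
  qed
  have T: "T \<in> bounded_ops (Zn n)"
  proof -
    note aL = bounded_opsD(2) [OF left_mult_bounded [OF a(1)]]
    obtain C where C: "op_bounded_by (Zn n) (left_mult (Zn n) (a 0)) C"
      using bounded_opsD(5) [OF left_mult_bounded [OF a(1)], of 0] by blast
    have "op_bounded_by (Zn n) (\<lambda>\<beta>\<in>L2 (Zn n). \<lambda>g. left_mult (Zn n) (a 0) \<beta> g +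
        1 * op_diff (Zn n) T (left_mult (Zn n) (a 0)) \<beta> g) (C + cmod 1 * ?e 0)"
      by (rule op_bounded_by_combine [OF aL _ C bound]) (auto intro!: L2_diff TL aL)
    then have b: "op_bounded_by (Zn n) T (C + cmod 1 * ?e 0)"
      by (rule op_bounded_by_cong [THEN iffD1, rotated]) simp
    show ?thesis
    proof (rule bounded_opsI [OF _ TL _ _ b])
      show "T \<in> extensional (L2 (Zn n))" by (simp add: T_def)
      fix \<beta> assume \<beta>: "\<beta> \<in> L2 (Zn n)"
      show "T (\<lambda>g. c * \<beta> g) = (\<lambda>g. c * T \<beta> g)" for c
      proof
        fix g
        have "(\<lambda>k. c * conv (Zn n) (a k) \<beta> g) \<longlonglongrightarrow> c * T \<beta> g" by (intro tendsto_intros lim \<beta>)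
        then show "T (\<lambda>g. c * \<beta> g) g = c * T \<beta> g"
          using lim [OF L2_scale [OF \<beta>], of c g] unfolding conv_scale_right [of _ _ c \<beta>] by (rule LIMSEQ_unique [rotated])
      qed
      fix \<gamma> assume \<gamma>: "\<gamma> \<in> L2 (Zn n)"
      show "T (\<lambda>g. \<beta> g + \<gamma> g) = (\<lambda>g. T \<beta> g + T \<gamma> g)"
      proof
        fix g
        have "(\<lambda>k. conv (Zn n) (a k) \<beta> g + conv (Zn n) (a k) \<gamma> g) \<longlonglongrightarrow> T \<beta> g + T \<gamma> g"
          by (intro tendsto_intros lim \<beta> \<gamma>)
        then show "T (\<lambda>g. \<beta> g + \<gamma> g) g = T \<beta> g + T \<gamma> g"
          using lim [OF L2_add [OF \<beta> \<gamma>], of g] unfolding conv_add_right [of _ _ \<beta> \<gamma>] by (rule LIMSEQ_unique [rotated])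
      qed
    qed
  qed
  have "\<exists>\<alpha>\<in>cg n. op_bounded_by (Zn n) (op_diff (Zn n) T (left_mult (Zn n) \<alpha>)) d \<and>
      (\<forall>z\<in>torus n. cmod (f z - laurent_eval n \<alpha> z) \<le> d)" if "d > 0" for d
  proof -
    from eventually_happens [OF order_tendstoD(2) [OF inverse_Suc_tendsto that]] obtain k where "?e k < d" by auto
    then show ?thesis
      using a(2) [of k] by (intro bexI [OF _ a(1) [of k]] conjI op_bounded_by_mono [OF bound] ballI) fastforce+
  qed
  then have "fourier_pair n T f" using T f unfolding fourier_pair_def by blast
  then show ?thesis by blast
qed

lemma fourier_eqI:
  assumes p: "fourier_pair n T f" shows "fourier n T = f"
proof -
  have T: "T \<in> bounded_ops (Zn n)" using p by (simp add: fourier_pair_def)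
  have "h \<in> carrier (torus_functions n) \<and> (\<forall>e>0. \<exists>\<alpha>\<in>cg n. op_dist (Zn n) T (left_mult (Zn n) \<alpha>) < e \<and>
        (\<forall>z\<in>torus n. cmod (h z - laurent_eval n \<alpha> z) < e)) \<longleftrightarrow> fourier_pair n T h" for h
    using fourier_pair_iff_op_dist [OF T, of h] by (auto simp: fourier_pair_def)
  then have "fourier n T = (THE h. fourier_pair n T h)" unfolding fourier_def by simp
  also have "\<dots> = f" using p fourier_pair_unique_fun by blast
  finally show ?thesis .
qed

lemma fourier_pair_fourier:
  assumes "T \<in> carrier (cstar_red (Zn n))" shows "fourier_pair n T (fourier n T)"
  using fourier_pair_exists_fun [OF assms] fourier_eqI by blast

theorem fourier_bij: "bij_betw (fourier n) (carrier (cstar_red (Zn n))) (carrier (torus_functions n))"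
  unfolding bij_betw_def
proof (intro conjI inj_onI equalityI subsetI)
  fix S T assume "S \<in> carrier (cstar_red (Zn n))" "T \<in> carrier (cstar_red (Zn n))" "fourier n S = fourier n T"
  then show "S = T" by (metis fourier_pair_fourier fourier_pair_unique_op)
next
  fix f assume "f \<in> fourier n ` carrier (cstar_red (Zn n))"
  then show "f \<in> carrier (torus_functions n)" using fourier_pair_fourier by (auto simp: fourier_pair_def)
next
  fix f assume "f \<in> carrier (torus_functions n)"
  then obtain T where "fourier_pair n T f" using fourier_pair_exists_op by blast
  then show "f \<in> fourier n ` carrier (cstar_red (Zn n))"
    using fourier_eqI fourier_pair_cstar by (metis image_eqI)
qed

lemma
  assumes "S \<in> carrier (cstar_red (Zn n))" "T \<in> carrier (cstar_red (Zn n))"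
  shows cstar_add_closed: "S \<oplus>\<^bsub>cstar_red (Zn n)\<^esub> T \<in> carrier (cstar_red (Zn n))"
    and fourier_add: "fourier n (S \<oplus>\<^bsub>cstar_red (Zn n)\<^esub> T) = (\<lambda>z\<in>torus n. fourier n S z + fourier n T z)"
proof -
  have "fourier_pair n (S \<oplus>\<^bsub>cstar_red (Zn n)\<^esub> T) (\<lambda>z\<in>torus n. fourier n S z + fourier n T z)"
    using fourier_pair_combine [OF assms [THEN fourier_pair_fourier], of 1] by (simp add: cstar_red_def)
  then show "S \<oplus>\<^bsub>cstar_red (Zn n)\<^esub> T \<in> carrier (cstar_red (Zn n))"
    "fourier n (S \<oplus>\<^bsub>cstar_red (Zn n)\<^esub> T) = (\<lambda>z\<in>torus n. fourier n S z + fourier n T z)"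
    by (rule fourier_pair_cstar, rule fourier_eqI)
qed

lemma
  assumes "T \<in> carrier (cstar_red (Zn n))" "a \<in> cg n"
  shows cstar_left_mult_closed: "left_mult (Zn n) a \<otimes>\<^bsub>cstar_red (Zn n)\<^esub> T \<in> carrier (cstar_red (Zn n))"
    and fourier_left_mult: "fourier n (left_mult (Zn n) a \<otimes>\<^bsub>cstar_red (Zn n)\<^esub> T) = (\<lambda>z\<in>torus n. laurent_eval n a z * fourier n T z)"
proof -
  have "fourier_pair n (left_mult (Zn n) a \<otimes>\<^bsub>cstar_red (Zn n)\<^esub> T) (\<lambda>z\<in>torus n. laurent_eval n a z * fourier n T z)"
    using fourier_pair_mult [OF assms(1) [THEN fourier_pair_fourier] assms(2)] by (simp add: cstar_red_def)
  then show "left_mult (Zn n) a \<otimes>\<^bsub>cstar_red (Zn n)\<^esub> T \<in> carrier (cstar_red (Zn n))"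
    "fourier n (left_mult (Zn n) a \<otimes>\<^bsub>cstar_red (Zn n)\<^esub> T) = (\<lambda>z\<in>torus n. laurent_eval n a z * fourier n T z)"
    by (rule fourier_pair_cstar, rule fourier_eqI)
qed

lemma
  shows cstar_zero_closed: "\<zero>\<^bsub>cstar_red (Zn n)\<^esub> \<in> carrier (cstar_red (Zn n))"
    and fourier_zero: "fourier n \<zero>\<^bsub>cstar_red (Zn n)\<^esub> = (\<lambda>z\<in>torus n. 0)"
proof -
  have "(\<lambda>z\<in>torus n. 0) \<in> carrier (torus_functions n)" by (simp add: CT_carrier)
  then obtain T where p: "fourier_pair n T (\<lambda>z\<in>torus n. 0)" using fourier_pair_exists_op by blast
  have "fourier_pair n (\<zero>\<^bsub>cstar_red (Zn n)\<^esub>) (\<lambda>z\<in>torus n. 0)"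
    using fourier_pair_combine [OF p p, of "-1"] by (simp add: cstar_red_def cong: restrict_cong)
  then show "\<zero>\<^bsub>cstar_red (Zn n)\<^esub> \<in> carrier (cstar_red (Zn n))" "fourier n \<zero>\<^bsub>cstar_red (Zn n)\<^esub> = (\<lambda>z\<in>torus n. 0)"
    by (rule fourier_pair_cstar, rule fourier_eqI)
qed

section \<open>Pulling back functions along the projection of tori\<close>

text \<open>The composition of \<open>f\<close> with the projection \<open>\<T>\<^sup>n\<^sup>+\<^sup>1 \<rightarrow> \<T>\<^sup>n\<close> that forgets the last coordinate.\<close>

definition pullback :: "nat \<Rightarrow> ((nat \<Rightarrow> complex) \<Rightarrow> complex) \<Rightarrow> (nat \<Rightarrow> complex) \<Rightarrow> complex"
  where "pullback n f = (\<lambda>z\<in>torus (Suc n). f (restrict z {..<n}))"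

lemma torus_projection: "z \<in> torus (Suc n) \<Longrightarrow> restrict z {..<n} \<in> torus n"
  unfolding torus_iff by simp

lemma torus_section: "z \<in> torus n \<Longrightarrow> z(n := 1) \<in> torus (Suc n)"
  unfolding torus_iff by (simp add: less_Suc_eq)

lemma torus_projection_section: "z \<in> torus n \<Longrightarrow> restrict (z(n := 1)) {..<n} = z"
  unfolding torus_iff by (intro ext) (simp add: restrict_def)

lemma pullback_closed:
  assumes "f \<in> carrier (CT n)" shows "pullback n f \<in> carrier (CT (Suc n))"
proof -
  have "continuous_on (torus (Suc n)) (\<lambda>z. restrict z {..<n} i)" for i
    by (cases "i < n") (simp_all add: torus_coordinate_continuous)
  then have "continuous_on (torus (Suc n)) (\<lambda>z. restrict z {..<n})"
    by (rule continuous_on_coordinatewise_then_product)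
  then have "continuous_on (torus (Suc n)) (\<lambda>z. f (restrict z {..<n}))"
    by (rule continuous_on_compose2 [OF CT_continuous [OF assms]]) (auto dest: torus_projection)
  then show ?thesis unfolding pullback_def by (rule CT_restrict)
qed

lemma restriction_closed:
  assumes "F \<in> carrier (CT (Suc n))" shows "(\<lambda>z\<in>torus n. F (z(n := 1))) \<in> carrier (CT n)"
proof -
  have "continuous_on (torus n) (\<lambda>z. (z(n := 1)) i)" for i
    by (cases "i = n") (simp_all add: torus_coordinate_continuous)
  then have "continuous_on (torus n) (\<lambda>z. z(n := 1))"
    by (rule continuous_on_coordinatewise_then_product)
  then have "continuous_on (torus n) (\<lambda>z. F (z(n := 1)))"
    by (rule continuous_on_compose2 [OF CT_continuous [OF assms]]) (auto dest: torus_section)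
  then show ?thesis by (rule CT_restrict)
qed

lemma pullback_hom: "pullback n \<in> ring_hom (CT n) (CT (Suc n))"
proof -
  interpret cring "CT n" by (rule CT_cring)
  show ?thesis
    by (intro ring_hom_memI pullback_closed; (intro CT_eqI [of _ "Suc n"] CT_closed pullback_closed)?)
       (simp_all add: CT_simps pullback_def torus_projection)
qed

text \<open>Restricting an equation \<open>f = \<Sum>i\<le>n. (z\<^sub>i - 1) F\<^sub>i\<close> to \<open>z\<^sub>n = 1\<close> kills the last summand.\<close>

lemma pullback_ideal_iff:
  assumes f: "f \<in> carrier (CT n)"
  shows "pullback n f \<in> torus_ideal (Suc n) \<longleftrightarrow> f \<in> torus_ideal n"
proof
  assume "pullback n f \<in> torus_ideal (Suc n)"
  then obtain F where F: "\<forall>i<Suc n. F i \<in> carrier (CT (Suc n))"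
    "\<forall>w\<in>torus (Suc n). pullback n f w = (\<Sum>i<Suc n. (w i - 1) * F i w)"
    unfolding torus_ideal_iff by blast
  show "f \<in> torus_ideal n"
    unfolding torus_ideal_iff
  proof (intro conjI f exI [of _ "\<lambda>i. \<lambda>z\<in>torus n. F i (z(n := 1))"] allI impI ballI)
    show "(\<lambda>z\<in>torus n. F i (z(n := 1))) \<in> carrier (CT n)" if "i < n" for i
      using F(1) that by (intro restriction_closed) simp
    fix z assume z: "z \<in> torus n"
    have "f z = pullback n f (z(n := 1))"
      by (simp add: pullback_def torus_section [OF z] torus_projection_section [OF z])
    also have "\<dots> = (\<Sum>i<Suc n. ((z(n := 1)) i - 1) * F i (z(n := 1)))"
      using F(2) torus_section [OF z] by blast
    also have "\<dots> = (\<Sum>i<n. (z i - 1) * (\<lambda>z\<in>torus n. F i (z(n := 1))) z)"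
      using z by simp
    finally show "f z = (\<Sum>i<n. (z i - 1) * (\<lambda>z\<in>torus n. F i (z(n := 1))) z)" .
  qed
next
  assume "f \<in> torus_ideal n"
  then obtain h where h: "\<forall>i<n. h i \<in> carrier (CT n)" "\<forall>z\<in>torus n. f z = (\<Sum>i<n. (z i - 1) * h i z)"
    unfolding torus_ideal_iff by blast
  let ?F = "\<lambda>i. if i < n then pullback n (h i) else \<zero>\<^bsub>CT (Suc n)\<^esub>"
  show "pullback n f \<in> torus_ideal (Suc n)"
    unfolding torus_ideal_iff
  proof (intro conjI pullback_closed [OF f] exI [of _ ?F] allI impI ballI)
    show "?F i \<in> carrier (CT (Suc n))" for i
      using h(1) by (simp add: pullback_closed CT_closed)
    show "pullback n f w = (\<Sum>i<Suc n. (w i - 1) * ?F i w)" if w: "w \<in> torus (Suc n)" for w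
      using h(2) torus_projection [OF w] w by (simp add: pullback_def CT_simps)
  qed
qed

lemma torus_quotient_embedding:
  obtains D where "D \<in> ring_hom (torus_quotient n) (torus_quotient (Suc n))"
    and "inj_on D (carrier (torus_quotient n))"
    and "\<forall>f\<in>carrier (CT n). D (torus_class n f) = torus_class (Suc n) (pullback n f)"
proof -
  define h where "h = torus_class (Suc n) \<circ> pullback n"
  have hom: "h \<in> ring_hom (CT n) (torus_quotient (Suc n))"
    unfolding h_def by (rule ring_hom_trans [OF pullback_hom torus_class_hom])
  interpret h: ring_hom_ring "CT n" "torus_quotient (Suc n)" h
    by (intro ring_hom_ringI2 hom torus_quotient_ring cring.axioms(1) [OF CT_cring])
  have k: "a_kernel (CT n) (torus_quotient (Suc n)) h = torus_ideal n"
  proof -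
    have "f \<in> carrier (CT n) \<and> h f = \<zero>\<^bsub>torus_quotient (Suc n)\<^esub> \<longleftrightarrow> f \<in> torus_ideal n" for f
    proof (cases "f \<in> carrier (CT n)")
      case True
      then show ?thesis
        by (simp add: h_def torus_class_zero_iff pullback_closed pullback_ideal_iff)
    qed (simp add: torus_ideal_iff)
    then show ?thesis unfolding a_kernel_def' by blast
  qed
  show thesis
  proof
    show "(\<lambda>X. the_elem (h ` X)) \<in> ring_hom (torus_quotient n) (torus_quotient (Suc n))"
      using h.the_elem_hom unfolding k .
    show "inj_on (\<lambda>X. the_elem (h ` X)) (carrier (torus_quotient n))"
      using h.the_elem_inj unfolding k by (intro inj_onI)
    show "\<forall>f\<in>carrier (CT n). the_elem (h ` torus_class n f) = torus_class (Suc n) (pullback n f)"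
    proof
      fix f assume f: "f \<in> carrier (CT n)"
      have "the_elem (h ` torus_class n f) = h f"
        using h.the_elem_simp [OF f] unfolding k torus_class_def .
      then show "the_elem (h ` torus_class n f) = torus_class (Suc n) (pullback n f)" by (simp add: h_def)
    qed
  qed
qed

section \<open>Cochains on the Koszul complex as families of functions\<close>

text \<open>The ring \<open>\<int>[\<int>\<^sup>n]\<close> and its module \<open>C\<^sup>*\<^sub>r\<^sub>e\<^sub>d(\<int>\<^sup>n)\<close>.\<close>

abbreviation zg_ring where "zg_ring n \<equiv> int_group_ring (Zn n)"

abbreviation cstar_mod where "cstar_mod n \<equiv> cstar_red_module (Zn n)"

text \<open>The transform of an element of \<open>\<int>[\<int>\<^sup>n]\<close>.\<close>

definition int_eval :: "nat \<Rightarrow> ((nat \<Rightarrow>\<^sub>0 int) \<Rightarrow> int) \<Rightarrow> (nat \<Rightarrow> complex) \<Rightarrow> complex"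
  where "int_eval n a = laurent_eval n (\<lambda>g. of_int (a g))"

lemma int_eval_zero: "int_eval n (\<lambda>g. 0) z = 0"
  by (simp add: int_eval_def laurent_eval_def)

lemma int_eval_add: "a \<in> zg n \<Longrightarrow> b \<in> zg n \<Longrightarrow> int_eval n (\<lambda>g. a g + b g) z = int_eval n a z + int_eval n b z"
  using laurent_eval_add [OF cg_of_int cg_of_int] by (simp add: int_eval_def)

lemma int_eval_sign: "int_eval n (\<lambda>g. (-1) ^ k * a g) z = (-1) ^ k * int_eval n a z"
  by (simp add: int_eval_def laurent_eval_def sum_distrib_left mult.assoc)

lemma int_eval_conv:
  assumes "a \<in> zg n" "b \<in> zg n" "z \<in> torus n"
  shows "int_eval n (conv (Zn n) a b) z = int_eval n a z * int_eval n b z"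
proof -
  have "(\<lambda>g. of_int (conv (Zn n) a b g)) = conv (Zn n) (\<lambda>g. complex_of_int (a g)) (\<lambda>g. of_int (b g))"
    by (simp add: conv_def fun_eq_iff)
  then show ?thesis
    unfolding int_eval_def using laurent_eval_conv [OF cg_of_int cg_of_int] assms by simp
qed

lemma zg_one: "indicator {0} \<in> zg n"
  using cring.cring_simprules(6) [OF cring_zg, of n] by (simp add: group_ring_def)

lemma int_eval_one: "int_eval n (indicator {0}) z = 1"
proof -
  have "(\<lambda>g :: nat \<Rightarrow>\<^sub>0 int. complex_of_int (indicator {0} g)) = (\<lambda>g. if g = 0 then 1 else 0)"
    by (auto simp: indicator_def)
  then show ?thesis by (simp only: int_eval_def laurent_eval_delta [OF Zn_zero] character_zero mult_1_right)
qed

lemma int_eval_gen_minus_one: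
  assumes "i < n" shows "int_eval n (gen_minus_one i) z = z i - 1"
proof -
  have m: "frag_of i \<in> carrier (Zn n)" using assms by simp
  have "frag_of i \<noteq> (0 :: nat \<Rightarrow>\<^sub>0 int)" by (simp add: frag_of_nonzero)
  then have "(\<lambda>g. complex_of_int (gen_minus_one i g)) =
      (\<lambda>g. 1 * (if g = frag_of i then 1 else 0) + (-1) * (if g = 0 then 1 else 0))"
    by (auto simp: gen_minus_one_def indicator_def)
  then show ?thesis
    unfolding int_eval_def
    by (simp only: laurent_eval_combine [OF cg_delta [OF m] cg_delta [OF Zn_zero]]
        laurent_eval_delta [OF m] laurent_eval_delta [OF Zn_zero] character_frag_of [OF assms] character_zero) simp
qed

lemma int_eval_continuous: "continuous_on (torus n) (int_eval n a)"
  unfolding int_eval_def by (rule laurent_eval_continuous)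

lemma cstar_mod_carrier: "carrier (cstar_mod n) = carrier (cstar_red (Zn n))"
  by (simp add: cstar_red_module_def)

lemma fourier_closed: "T \<in> carrier (cstar_mod n) \<Longrightarrow> fourier n T \<in> carrier (CT n)"
  using bij_betw_apply [OF fourier_bij] by (simp add: cstar_mod_carrier)

lemma fourier_eqD:
  assumes "S \<in> carrier (cstar_mod n)" "T \<in> carrier (cstar_mod n)"
    and "\<And>z. z \<in> torus n \<Longrightarrow> fourier n S z = fourier n T z"
  shows "S = T"
proof -
  have "fourier n S = fourier n T"
    by (rule CT_eqI [OF fourier_closed fourier_closed]) (use assms in auto)
  then show ?thesis
    using bij_betw_imp_inj_on [OF fourier_bij] assms(1,2) unfolding cstar_mod_carrier by (blast dest: inj_onD)
qed

lemma fourier_surj: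
  assumes "f \<in> carrier (CT n)" obtains T where "T \<in> carrier (cstar_mod n)" "fourier n T = f"
proof -
  have "f \<in> fourier n ` carrier (cstar_mod n)"
    using assms bij_betw_imp_surj_on [OF fourier_bij, of n] unfolding cstar_mod_carrier by simp
  then show thesis using that by (elim imageE) simp
qed

lemma
  assumes "S \<in> carrier (cstar_mod n)" "T \<in> carrier (cstar_mod n)"
  shows cstar_mod_add_closed: "S \<oplus>\<^bsub>cstar_mod n\<^esub> T \<in> carrier (cstar_mod n)"
    and cstar_mod_fourier_add: "z \<in> torus n \<Longrightarrow> fourier n (S \<oplus>\<^bsub>cstar_mod n\<^esub> T) z = fourier n S z + fourier n T z"
  using cstar_add_closed [of S n T] fourier_add [of S n T] assms by (simp_all add: cstar_red_module_def)

lemma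
  assumes "a \<in> zg n" "T \<in> carrier (cstar_mod n)"
  shows cstar_mod_smult_closed: "a \<odot>\<^bsub>cstar_mod n\<^esub> T \<in> carrier (cstar_mod n)"
    and cstar_mod_fourier_smult: "z \<in> torus n \<Longrightarrow> fourier n (a \<odot>\<^bsub>cstar_mod n\<^esub> T) z = int_eval n a z * fourier n T z"
  using cstar_left_mult_closed [OF _ cg_of_int, of T n a] fourier_left_mult [OF _ cg_of_int, of T n a] assms
  by (simp_all add: cstar_red_module_def int_eval_def)

lemma
  shows cstar_mod_zero_closed: "\<zero>\<^bsub>cstar_mod n\<^esub> \<in> carrier (cstar_mod n)"
    and cstar_mod_fourier_zero: "z \<in> torus n \<Longrightarrow> fourier n \<zero>\<^bsub>cstar_mod n\<^esub> z = 0"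
  using cstar_zero_closed [of n] fourier_zero [of n] by (simp_all add: cstar_red_module_def)

lemma lin_mapsD:
  assumes "\<phi> \<in> lin_maps (zg_ring n) (koszul n k) (cstar_mod n)"
  shows "v \<in> carrier (koszul n k) \<Longrightarrow> \<phi> v \<in> carrier (cstar_mod n)"
    and "v \<in> carrier (koszul n k) \<Longrightarrow> w \<in> carrier (koszul n k) \<Longrightarrow>
      \<phi> (v \<oplus>\<^bsub>koszul n k\<^esub> w) = \<phi> v \<oplus>\<^bsub>cstar_mod n\<^esub> \<phi> w"
    and "a \<in> zg n \<Longrightarrow> v \<in> carrier (koszul n k) \<Longrightarrow> \<phi> (a \<odot>\<^bsub>koszul n k\<^esub> v) = a \<odot>\<^bsub>cstar_mod n\<^esub> \<phi> v"
    and "\<phi> \<in> extensional (carrier (koszul n k))"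
  using assms unfolding lin_maps_def by (auto simp: PiE_iff)

text \<open>The basis element \<open>e\<^sub>S\<close> of the Koszul module of degree \<open>k\<close>.\<close>

definition koszul_unit :: "nat \<Rightarrow> nat \<Rightarrow> nat set \<Rightarrow> nat set \<Rightarrow> (nat \<Rightarrow>\<^sub>0 int) \<Rightarrow> int"
  where "koszul_unit n k S = (\<lambda>T\<in>koszul_basis n k. if T = S then indicator {0} else (\<lambda>g. 0))"

lemma koszul_add: "v \<oplus>\<^bsub>koszul n k\<^esub> w = (\<lambda>S\<in>koszul_basis n k. \<lambda>g. v S g + w S g)"
  by (simp add: koszul_def free_module_def group_ring_def)

lemma koszul_smult: "a \<odot>\<^bsub>koszul n k\<^esub> v = (\<lambda>S\<in>koszul_basis n k. conv (Zn n) a (v S))"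
  by (simp add: koszul_def free_module_def group_ring_def)

lemma koszul_unit_closed: "koszul_unit n k S \<in> carrier (koszul n k)"
  unfolding koszul_carrier koszul_unit_def by (simp add: zg_one zg_zero)

lemma koszul_basis_finite: "finite (koszul_basis n k)"
  unfolding koszul_basis_def by (rule finite_subset [of _ "Pow {..<n}"]) auto

lemma zg_conv_one: "a \<in> zg n \<Longrightarrow> conv (Zn n) a (indicator {0}) = a"
proof -
  interpret R: cring "zg_ring n" by (rule cring_zg)
  show "a \<in> zg n \<Longrightarrow> conv (Zn n) a (indicator {0}) = a"
    using R.r_one [of a] by (simp add: group_ring_def)
qed

lemma lin_maps_fourier_zero:
  assumes \<phi>: "\<phi> \<in> lin_maps (zg_ring n) (koszul n k) (cstar_mod n)" and z: "z \<in> torus n"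
  shows "fourier n (\<phi> \<zero>\<^bsub>koszul n k\<^esub>) z = 0"
proof -
  interpret P: module "zg_ring n" "koszul n k" by (rule koszul_module)
  let ?o = "\<zero>\<^bsub>koszul n k\<^esub>"
  note o = P.M.zero_closed
  have "\<phi> ?o \<oplus>\<^bsub>cstar_mod n\<^esub> \<phi> ?o = \<phi> (?o \<oplus>\<^bsub>koszul n k\<^esub> ?o)"
    by (rule lin_mapsD(2) [OF \<phi> o o, symmetric])
  also have "\<dots> = \<phi> ?o" by simp
  finally show ?thesis
    using cstar_mod_fourier_add [OF lin_mapsD(1) [OF \<phi> o] lin_mapsD(1) [OF \<phi> o] z] by simp
qed

text \<open>A cochain of degree \<open>k\<close> amounts to the family of the transforms of its values on the basis.\<close>

lemma lin_maps_fourier: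
  assumes \<phi>: "\<phi> \<in> lin_maps (zg_ring n) (koszul n k) (cstar_mod n)"
    and v: "v \<in> carrier (koszul n k)" and z: "z \<in> torus n"
  shows "fourier n (\<phi> v) z = (\<Sum>S\<in>koszul_basis n k. int_eval n (v S) z * fourier n (\<phi> (koszul_unit n k S)) z)"
proof -
  note \<phi>D = lin_mapsD [OF \<phi>]
  let ?v = "\<lambda>B. \<lambda>T\<in>koszul_basis n k. if T \<in> B then v T else (\<lambda>g. 0)"
  have vB: "?v B \<in> carrier (koszul n k)" for B
    using koszul_mem [OF v] by (auto simp: koszul_carrier zg_zero)
  have "finite B \<Longrightarrow> B \<subseteq> koszul_basis n k \<Longrightarrow>
      fourier n (\<phi> (?v B)) z = (\<Sum>S\<in>B. int_eval n (v S) z * fourier n (\<phi> (koszul_unit n k S)) z)" for B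
  proof (induction B rule: finite_induct)
    case empty
    have "?v {} = \<zero>\<^bsub>koszul n k\<^esub>" by (simp add: koszul_zero)
    then show ?case by (simp only: lin_maps_fourier_zero [OF \<phi> z] sum.empty)
  next
    case (insert S B)
    have S: "S \<in> koszul_basis n k" using insert by blast
    note vS = koszul_mem [OF v S]
    have e: "?v (insert S B) = ?v B \<oplus>\<^bsub>koszul n k\<^esub> (v S \<odot>\<^bsub>koszul n k\<^esub> koszul_unit n k S)"
      unfolding koszul_add
    proof (rule restrict_ext)
      fix T assume T: "T \<in> koszul_basis n k"
      have "(v S \<odot>\<^bsub>koszul n k\<^esub> koszul_unit n k S) T = (if T = S then v S else (\<lambda>g. 0))"
        using T zg_conv_one [OF vS] by (simp add: koszul_smult koszul_unit_def) (simp add: conv_def fun_eq_iff)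
      then show "(if T \<in> insert S B then v T else (\<lambda>g. 0)) =
          (\<lambda>g. ?v B T g + (v S \<odot>\<^bsub>koszul n k\<^esub> koszul_unit n k S) T g)"
        using T insert.hyps by auto
    qed
    have m: "v S \<odot>\<^bsub>koszul n k\<^esub> koszul_unit n k S \<in> carrier (koszul n k)"
      by (rule module.smult_closed [OF koszul_module vS koszul_unit_closed])
    have "fourier n (\<phi> (?v (insert S B))) z =
        fourier n (\<phi> (?v B)) z + fourier n (\<phi> (v S \<odot>\<^bsub>koszul n k\<^esub> koszul_unit n k S)) z"
      unfolding e \<phi>D(2) [OF vB m] by (rule cstar_mod_fourier_add [OF \<phi>D(1) [OF vB] \<phi>D(1) [OF m] z])
    also have "fourier n (\<phi> (v S \<odot>\<^bsub>koszul n k\<^esub> koszul_unit n k S)) z =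
        int_eval n (v S) z * fourier n (\<phi> (koszul_unit n k S)) z"
      unfolding \<phi>D(3) [OF vS koszul_unit_closed]
      by (rule cstar_mod_fourier_smult [OF vS \<phi>D(1) [OF koszul_unit_closed] z])
    finally show ?case using insert by simp
  qed
  from this [OF koszul_basis_finite order_refl]
  show ?thesis using v by (simp add: koszul_carrier PiE_restrict cong: restrict_cong)
qed

lemma lin_maps_eqI:
  assumes \<phi>: "\<phi> \<in> lin_maps (zg_ring n) (koszul n k) (cstar_mod n)"
    and \<psi>: "\<psi> \<in> lin_maps (zg_ring n) (koszul n k) (cstar_mod n)"
    and e: "\<And>S z. S \<in> koszul_basis n k \<Longrightarrow> z \<in> torus n \<Longrightarrow>
      fourier n (\<phi> (koszul_unit n k S)) z = fourier n (\<psi> (koszul_unit n k S)) z"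
  shows "\<phi> = \<psi>"
proof (rule extensionalityI [OF lin_mapsD(4) [OF \<phi>] lin_mapsD(4) [OF \<psi>]])
  fix v assume v: "v \<in> carrier (koszul n k)"
  show "\<phi> v = \<psi> v"
  proof (rule fourier_eqD [OF lin_mapsD(1) [OF \<phi> v] lin_mapsD(1) [OF \<psi> v]])
    show "fourier n (\<phi> v) z = fourier n (\<psi> v) z" if "z \<in> torus n" for z
      unfolding lin_maps_fourier [OF \<phi> v that] lin_maps_fourier [OF \<psi> v that]
      using e that by (intro sum.cong) auto
  qed
qed

text \<open>Conversely, every family of continuous functions on the basis comes from a cochain.  The formula
  prescribes the transforms of its values, and linearity is checked on the transforms.\<close>

lemma lin_maps_exists:
  assumes f: "\<And>S. S \<in> koszul_basis n k \<Longrightarrow> f S \<in> carrier (CT n)"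
  obtains \<phi> where "\<phi> \<in> lin_maps (zg_ring n) (koszul n k) (cstar_mod n)"
    and "\<And>v z. v \<in> carrier (koszul n k) \<Longrightarrow> z \<in> torus n \<Longrightarrow>
      fourier n (\<phi> v) z = (\<Sum>S\<in>koszul_basis n k. int_eval n (v S) z * f S z)"
    and "\<And>S z. S \<in> koszul_basis n k \<Longrightarrow> z \<in> torus n \<Longrightarrow> fourier n (\<phi> (koszul_unit n k S)) z = f S z"
proof -
  interpret P: module "zg_ring n" "koszul n k" by (rule koszul_module)
  let ?F = "\<lambda>v. \<lambda>z\<in>torus n. \<Sum>S\<in>koszul_basis n k. int_eval n (v S) z * f S z"
  have "?F v \<in> carrier (CT n)" for v
    by (intro CT_restrict continuous_intros int_eval_continuous CT_continuous f)
  then have "\<exists>T. T \<in> carrier (cstar_mod n) \<and> fourier n T = ?F v" for v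
    by (meson fourier_surj)
  from choice [OF allI [OF this]] obtain t where
    t: "\<forall>v. t v \<in> carrier (cstar_mod n) \<and> fourier n (t v) = ?F v" by (rule exE)
  let ?\<phi> = "restrict t (carrier (koszul n k))"
  have F: "fourier n (?\<phi> v) z = (\<Sum>S\<in>koszul_basis n k. int_eval n (v S) z * f S z)"
    if "v \<in> carrier (koszul n k)" "z \<in> torus n" for v z
    using t that by simp
  have \<phi>c: "?\<phi> v \<in> carrier (cstar_mod n)" if "v \<in> carrier (koszul n k)" for v
    using t that by simp
  have \<phi>: "?\<phi> \<in> lin_maps (zg_ring n) (koszul n k) (cstar_mod n)"
    unfolding lin_maps_def
  proof (intro CollectI conjI ballI PiE_I)
    fix v assume v: "v \<in> carrier (koszul n k)"
    then show "?\<phi> v \<in> carrier (cstar_mod n)" by (rule \<phi>c)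
    fix w assume w: "w \<in> carrier (koszul n k)"
    note vw = P.M.add.m_closed [OF v w]
    show "?\<phi> (v \<oplus>\<^bsub>koszul n k\<^esub> w) = ?\<phi> v \<oplus>\<^bsub>cstar_mod n\<^esub> ?\<phi> w"
    proof (rule fourier_eqD [OF \<phi>c [OF vw] cstar_mod_add_closed [OF \<phi>c [OF v] \<phi>c [OF w]]])
      fix z assume z: "z \<in> torus n"
      have "int_eval n ((v \<oplus>\<^bsub>koszul n k\<^esub> w) S) z = int_eval n (v S) z + int_eval n (w S) z"
        if S: "S \<in> koszul_basis n k" for S
        using S int_eval_add [OF koszul_mem [OF v S] koszul_mem [OF w S]] by (simp add: koszul_add)
      then show "fourier n (?\<phi> (v \<oplus>\<^bsub>koszul n k\<^esub> w)) z = fourier n (?\<phi> v \<oplus>\<^bsub>cstar_mod n\<^esub> ?\<phi> w) z"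
        unfolding cstar_mod_fourier_add [OF \<phi>c [OF v] \<phi>c [OF w] z] F [OF vw z] F [OF v z] F [OF w z]
        by (simp add: distrib_right sum.distrib)
    qed
  next
    fix a v assume a: "a \<in> zg n" and v: "v \<in> carrier (koszul n k)"
    note av = P.smult_closed [OF a v]
    show "?\<phi> (a \<odot>\<^bsub>koszul n k\<^esub> v) = a \<odot>\<^bsub>cstar_mod n\<^esub> ?\<phi> v"
    proof (rule fourier_eqD [OF \<phi>c [OF av] cstar_mod_smult_closed [OF a \<phi>c [OF v]]])
      fix z assume z: "z \<in> torus n"
      have "int_eval n ((a \<odot>\<^bsub>koszul n k\<^esub> v) S) z = int_eval n a z * int_eval n (v S) z"
        if S: "S \<in> koszul_basis n k" for S
        using S int_eval_conv [OF a koszul_mem [OF v S] z] by (simp add: koszul_smult)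
      then show "fourier n (?\<phi> (a \<odot>\<^bsub>koszul n k\<^esub> v)) z = fourier n (a \<odot>\<^bsub>cstar_mod n\<^esub> ?\<phi> v) z"
        unfolding cstar_mod_fourier_smult [OF a \<phi>c [OF v] z] F [OF av z] F [OF v z]
        by (simp add: sum_distrib_left mult.assoc)
    qed
  qed simp
  have "fourier n (?\<phi> (koszul_unit n k S)) z = f S z" if S: "S \<in> koszul_basis n k" and z: "z \<in> torus n" for S z
  proof -
    have "fourier n (?\<phi> (koszul_unit n k S)) z = (\<Sum>T\<in>koszul_basis n k. if T = S then f S z else 0)"
      unfolding F [OF koszul_unit_closed z]
      by (intro sum.cong) (auto simp: koszul_unit_def int_eval_one int_eval_zero)
    then show ?thesis using S koszul_basis_finite by simp
  qed
  then show thesis using that \<phi> F by blast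
qed

section \<open>The top cohomology group\<close>

lemma koszul_basis_top: "koszul_basis n n = {{..<n}}"
  unfolding koszul_basis_def using card_subset_eq [of "{..<n}"] by auto

lemma koszul_top_unit: "koszul_top n = koszul_unit n n {..<n}"
  by (auto simp: koszul_top_def koszul_unit_def koszul_basis_top group_ring_def fun_eq_iff)

text \<open>The cochains and the group of cocycles in degree \<open>n\<close>.\<close>

abbreviation top_cochains where
  "top_cochains n \<equiv> lin_maps (zg_ring n) (koszul n n) (cstar_mod n)"

abbreviation top_cocycles where
  "top_cocycles n \<equiv> cocycles (zg_ring n) (koszul n) (koszul_diff n) (cstar_mod n) n"

text \<open>The transform of \<open>\<phi>(1)\<close>, a continuous function on the torus that determines the top cochain \<open>\<phi>\<close>.\<close>

definition top_symbol where
  "top_symbol n \<phi> = fourier n (\<phi> (koszul_top n))"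

lemma top_symbol_closed: "\<phi> \<in> top_cochains n \<Longrightarrow> top_symbol n \<phi> \<in> carrier (CT n)"
  unfolding top_symbol_def koszul_top_unit by (rule fourier_closed [OF lin_mapsD(1) [OF _ koszul_unit_closed]])

lemma top_symbol_inj:
  assumes "\<phi> \<in> top_cochains n" "\<psi> \<in> top_cochains n" and e: "\<And>z. z \<in> torus n \<Longrightarrow> top_symbol n \<phi> z = top_symbol n \<psi> z"
  shows "\<phi> = \<psi>"
proof (rule lin_maps_eqI [OF assms(1,2)])
  fix S z assume "S \<in> koszul_basis n n" "z \<in> torus n"
  then show "fourier n (\<phi> (koszul_unit n n S)) z = fourier n (\<psi> (koszul_unit n n S)) z"
    using e [of z] by (simp add: koszul_basis_top top_symbol_def koszul_top_unit)
qed

lemma top_symbol_surj: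
  assumes "f \<in> carrier (CT n)"
  obtains \<phi> where "\<phi> \<in> top_cochains n" "top_symbol n \<phi> = f"
proof -
  obtain \<phi> where \<phi>: "\<phi> \<in> top_cochains n"
    and e: "\<And>S z. S \<in> koszul_basis n n \<Longrightarrow> z \<in> torus n \<Longrightarrow> fourier n (\<phi> (koszul_unit n n S)) z = f z"
    by (rule lin_maps_exists [of n n "\<lambda>S. f"]) (use assms in auto)
  have "top_symbol n \<phi> = f"
    by (rule CT_eqI [OF top_symbol_closed [OF \<phi>] assms])
       (use e in \<open>simp add: top_symbol_def koszul_top_unit koszul_basis_top\<close>)
  then show thesis using that \<phi> by blast
qed

lemma top_cochains_mult:
  assumes \<phi>: "\<phi> \<in> top_cochains n" and \<psi>: "\<psi> \<in> top_cochains n"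
  shows "(\<lambda>v\<in>carrier (koszul n n). \<phi> v \<oplus>\<^bsub>cstar_mod n\<^esub> \<psi> v) \<in> top_cochains n"
proof -
  let ?f = "\<lambda>S. \<lambda>z\<in>torus n. fourier n (\<phi> (koszul_unit n n S)) z + fourier n (\<psi> (koszul_unit n n S)) z"
  have "?f S \<in> carrier (CT n)" for S
    by (intro CT_restrict continuous_intros CT_continuous fourier_closed lin_mapsD(1) [OF \<phi>] lin_mapsD(1) [OF \<psi>] koszul_unit_closed)
  then obtain \<eta> where \<eta>: "\<eta> \<in> top_cochains n"
    and e: "\<And>v z. v \<in> carrier (koszul n n) \<Longrightarrow> z \<in> torus n \<Longrightarrow>
      fourier n (\<eta> v) z = (\<Sum>S\<in>koszul_basis n n. int_eval n (v S) z * ?f S z)"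
    by (rule lin_maps_exists [of n n ?f]) auto
  have "\<eta> = (\<lambda>v\<in>carrier (koszul n n). \<phi> v \<oplus>\<^bsub>cstar_mod n\<^esub> \<psi> v)"
  proof (rule extensionalityI [OF lin_mapsD(4) [OF \<eta>]])
    fix v assume v: "v \<in> carrier (koszul n n)"
    note c = lin_mapsD(1) [OF \<phi> v] lin_mapsD(1) [OF \<psi> v]
    have "\<eta> v = \<phi> v \<oplus>\<^bsub>cstar_mod n\<^esub> \<psi> v"
    proof (rule fourier_eqD [OF lin_mapsD(1) [OF \<eta> v] cstar_mod_add_closed [OF c]])
      fix z assume z: "z \<in> torus n"
      show "fourier n (\<eta> v) z = fourier n (\<phi> v \<oplus>\<^bsub>cstar_mod n\<^esub> \<psi> v) z"
        unfolding cstar_mod_fourier_add [OF c z] e [OF v z] lin_maps_fourier [OF \<phi> v z] lin_maps_fourier [OF \<psi> v z]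
        using z by (simp add: distrib_left sum.distrib)
    qed
    then show "\<eta> v = (\<lambda>v\<in>carrier (koszul n n). \<phi> v \<oplus>\<^bsub>cstar_mod n\<^esub> \<psi> v) v" using v by simp
  qed simp
  then show ?thesis using \<eta> by simp
qed

lemma top_cochains_zero: "(\<lambda>v\<in>carrier (koszul n n). \<zero>\<^bsub>cstar_mod n\<^esub>) \<in> top_cochains n"
proof -
  have "\<zero>\<^bsub>CT n\<^esub> \<in> carrier (CT n)" by (rule CT_closed)
  then obtain \<eta> where \<eta>: "\<eta> \<in> top_cochains n"
    and e: "\<And>v z. v \<in> carrier (koszul n n) \<Longrightarrow> z \<in> torus n \<Longrightarrow>
      fourier n (\<eta> v) z = (\<Sum>S\<in>koszul_basis n n. int_eval n (v S) z * \<zero>\<^bsub>CT n\<^esub> z)"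
    by (rule lin_maps_exists [of n n "\<lambda>S. \<zero>\<^bsub>CT n\<^esub>"]) auto
  have "\<eta> = (\<lambda>v\<in>carrier (koszul n n). \<zero>\<^bsub>cstar_mod n\<^esub>)"
  proof (rule extensionalityI [OF lin_mapsD(4) [OF \<eta>]])
    fix v assume v: "v \<in> carrier (koszul n n)"
    have "\<eta> v = \<zero>\<^bsub>cstar_mod n\<^esub>"
      by (rule fourier_eqD [OF lin_mapsD(1) [OF \<eta> v] cstar_mod_zero_closed])
         (simp add: e [OF v] cstar_mod_fourier_zero CT_simps)
    then show "\<eta> v = (\<lambda>v\<in>carrier (koszul n n). \<zero>\<^bsub>cstar_mod n\<^esub>) v" using v by simp
  qed simp
  then show ?thesis using \<eta> by simp
qed

text \<open>The complex stops in degree \<open>n\<close>, so every top cochain is a cocycle.\<close>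

lemma top_cocycles_carrier: "carrier (top_cocycles n) = top_cochains n"
proof -
  have "\<phi> (koszul_diff n n x) = \<zero>\<^bsub>cstar_mod n\<^esub>"
    if \<phi>: "\<phi> \<in> top_cochains n" and x: "x \<in> carrier (koszul n (Suc n))" for \<phi> x
  proof -
    have d: "koszul_diff n n x \<in> carrier (koszul n n)"
      using koszul_diff_linear [of n n] x unfolding lin_maps_def by blast
    have "koszul_diff n n x S = (\<lambda>g. 0)" if "S \<in> koszul_basis n n" for S
      using that x by (simp add: koszul_diff_def koszul_basis_top)
    then show ?thesis
      by (intro fourier_eqD [OF lin_mapsD(1) [OF \<phi> d] cstar_mod_zero_closed])
         (simp add: lin_maps_fourier [OF \<phi> d] cstar_mod_fourier_zero int_eval_zero)
  qed
  then show ?thesis by (auto simp: cocycles_def)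
qed

lemma top_cocycles_simps:
  "\<phi> \<otimes>\<^bsub>top_cocycles n\<^esub> \<psi> = (\<lambda>v\<in>carrier (koszul n n). \<phi> v \<oplus>\<^bsub>cstar_mod n\<^esub> \<psi> v)"
  "\<one>\<^bsub>top_cocycles n\<^esub> = (\<lambda>v\<in>carrier (koszul n n). \<zero>\<^bsub>cstar_mod n\<^esub>)"
  by (simp_all add: cocycles_def)

lemma koszul_top_closed: "koszul_top n \<in> carrier (koszul n n)"
  unfolding koszul_top_unit by (rule koszul_unit_closed)

lemma top_symbol_mult:
  assumes "\<phi> \<in> top_cochains n" "\<psi> \<in> top_cochains n" "z \<in> torus n"
  shows "top_symbol n (\<phi> \<otimes>\<^bsub>top_cocycles n\<^esub> \<psi>) z = top_symbol n \<phi> z + top_symbol n \<psi> z"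
  using cstar_mod_fourier_add [OF lin_mapsD(1) [OF assms(1) koszul_top_closed] lin_mapsD(1) [OF assms(2) koszul_top_closed] assms(3)]
  by (simp add: top_symbol_def top_cocycles_simps koszul_top_closed)

lemma top_symbol_one: "z \<in> torus n \<Longrightarrow> top_symbol n \<one>\<^bsub>top_cocycles n\<^esub> z = 0"
  by (simp add: top_symbol_def top_cocycles_simps koszul_top_closed cstar_mod_fourier_zero)

lemma top_cocycles_group: "Group.group (top_cocycles n)"
proof (rule groupI; unfold top_cocycles_carrier)
  have m: "\<phi> \<otimes>\<^bsub>top_cocycles n\<^esub> \<psi> \<in> top_cochains n" if "\<phi> \<in> top_cochains n" "\<psi> \<in> top_cochains n" for \<phi> \<psi>
    unfolding top_cocycles_simps by (rule top_cochains_mult [OF that])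
  have o: "\<one>\<^bsub>top_cocycles n\<^esub> \<in> top_cochains n"
    unfolding top_cocycles_simps by (rule top_cochains_zero)
  show "\<one>\<^bsub>top_cocycles n\<^esub> \<in> top_cochains n" by (rule o)
  fix \<phi> assume \<phi>: "\<phi> \<in> top_cochains n"
  show "\<one>\<^bsub>top_cocycles n\<^esub> \<otimes>\<^bsub>top_cocycles n\<^esub> \<phi> = \<phi>"
    by (rule top_symbol_inj [OF m [OF o \<phi>] \<phi>]) (simp add: top_symbol_mult o \<phi> top_symbol_one)
  have "(\<lambda>z\<in>torus n. - top_symbol n \<phi> z) \<in> carrier (CT n)"
    by (intro CT_restrict continuous_intros CT_continuous top_symbol_closed \<phi>)
  then obtain \<psi> where \<psi>: "\<psi> \<in> top_cochains n" "top_symbol n \<psi> = (\<lambda>z\<in>torus n. - top_symbol n \<phi> z)"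
    by (rule top_symbol_surj)
  have "\<psi> \<otimes>\<^bsub>top_cocycles n\<^esub> \<phi> = \<one>\<^bsub>top_cocycles n\<^esub>"
    by (rule top_symbol_inj [OF m [OF \<psi>(1) \<phi>] o]) (simp add: top_symbol_mult \<psi> \<phi> top_symbol_one)
  then show "\<exists>\<psi>\<in>top_cochains n. \<psi> \<otimes>\<^bsub>top_cocycles n\<^esub> \<phi> = \<one>\<^bsub>top_cocycles n\<^esub>" using \<psi>(1) by blast
  fix \<psi> assume \<psi>: "\<psi> \<in> top_cochains n"
  show "\<phi> \<otimes>\<^bsub>top_cocycles n\<^esub> \<psi> \<in> top_cochains n" by (rule m [OF \<phi> \<psi>])
  fix \<eta> assume \<eta>: "\<eta> \<in> top_cochains n"
  show "\<phi> \<otimes>\<^bsub>top_cocycles n\<^esub> \<psi> \<otimes>\<^bsub>top_cocycles n\<^esub> \<eta> = \<phi> \<otimes>\<^bsub>top_cocycles n\<^esub> (\<psi> \<otimes>\<^bsub>top_cocycles n\<^esub> \<eta>)"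
    by (rule top_symbol_inj [OF m [OF m [OF \<phi> \<psi>] \<eta>] m [OF \<phi> m [OF \<psi> \<eta>]]])
       (simp add: top_symbol_mult m \<phi> \<psi> \<eta> add.assoc)
qed

text \<open>The basis elements one degree below the top are the complements of the single indices.\<close>

lemma koszul_basis_below_top:
  "bij_betw (\<lambda>i. {..<Suc m} - {i}) {..<Suc m} (koszul_basis (Suc m) m)"
  unfolding bij_betw_def
proof (intro conjI inj_onI equalityI subsetI)
  fix i j assume "i \<in> {..<Suc m}" "j \<in> {..<Suc m}" "{..<Suc m} - {i} = {..<Suc m} - {j}"
  then show "i = j" by blast
next
  fix S assume "S \<in> (\<lambda>i. {..<Suc m} - {i}) ` {..<Suc m}"
  then show "S \<in> koszul_basis (Suc m) m" by (auto simp: koszul_basis_def card_Diff_singleton)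
next
  fix S assume "S \<in> koszul_basis (Suc m) m"
  then have S: "S \<subseteq> {..<Suc m}" "card S = m" by (simp_all add: koszul_basis_def)
  then have "card ({..<Suc m} - S) = 1" using finite_subset [OF S(1)] by (simp add: card_Diff_subset)
  then obtain i where i: "{..<Suc m} - S = {i}" by (auto simp: card_1_singleton_iff)
  then have "S = {..<Suc m} - {i}" "i \<in> {..<Suc m}" using S(1) by auto
  then show "S \<in> (\<lambda>i. {..<Suc m} - {i}) ` {..<Suc m}" by blast
qed

lemma koszul_diff_top:
  assumes "i < Suc m" "z \<in> torus (Suc m)"
  shows "int_eval (Suc m) (koszul_diff (Suc m) m (koszul_top (Suc m)) ({..<Suc m} - {i})) z = (-1) ^ i * (z i - 1)"
proof -
  let ?n = "Suc m" and ?T = "{..<Suc m} - {i}"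
  have T: "?T \<in> koszul_basis ?n m" using bij_betwE [OF koszul_basis_below_top] assms(1) by blast
  have "{..<?n} - ?T = {i}" "insert i ?T = {..<?n}" using assms(1) by auto
  moreover have "{j \<in> ?T. j < i} = {..<i}" using assms(1) by auto
  ultimately have "koszul_diff ?n m (koszul_top ?n) ?T =
      (\<lambda>g. (-1) ^ i * conv (Zn ?n) (gen_minus_one i) (koszul_top ?n {..<?n}) g)"
    using T koszul_top_closed [of ?n] by (simp add: koszul_diff_def)
  also have "koszul_top ?n {..<?n} = indicator {0}"
    by (simp add: koszul_top_unit koszul_unit_def koszul_basis_top)
  also have "conv (Zn ?n) (gen_minus_one i) (indicator {0}) = gen_minus_one i"
    by (rule zg_conv_one [OF gen_minus_one_mem [OF assms(1)]])
  finally show ?thesis by (simp only: int_eval_sign int_eval_gen_minus_one [OF assms(1)])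
qed

lemma koszul_diff_closed: "v \<in> carrier (koszul n (Suc k)) \<Longrightarrow> koszul_diff n k v \<in> carrier (koszul n k)"
  using koszul_diff_linear [of n k] unfolding lin_maps_def by blast

lemma coboundary_linear:
  assumes \<psi>: "\<psi> \<in> lin_maps (zg_ring n) (koszul n k) (cstar_mod n)"
  shows "compose (carrier (koszul n (Suc k))) \<psi> (koszul_diff n k) \<in> lin_maps (zg_ring n) (koszul n (Suc k)) (cstar_mod n)"
proof -
  interpret P: module "zg_ring n" "koszul n (Suc k)" by (rule koszul_module)
  have d: "koszul_diff n k (v \<oplus>\<^bsub>koszul n (Suc k)\<^esub> w) = koszul_diff n k v \<oplus>\<^bsub>koszul n k\<^esub> koszul_diff n k w"
    "a \<in> zg n \<Longrightarrow> koszul_diff n k (a \<odot>\<^bsub>koszul n (Suc k)\<^esub> v) = a \<odot>\<^bsub>koszul n k\<^esub> koszul_diff n k v"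
    if "v \<in> carrier (koszul n (Suc k))" "w \<in> carrier (koszul n (Suc k))" for a v w
    using koszul_diff_linear [of n k] that unfolding lin_maps_def by blast+
  show ?thesis
    unfolding lin_maps_def
    by (intro CollectI conjI ballI PiE_I)
       (simp_all add: compose_def d koszul_diff_closed lin_mapsD(1-3) [OF \<psi>] P.smult_closed P.M.add.m_closed)
qed

text \<open>The coboundary of a cochain of degree \<open>m\<close> on the generator \<open>1\<close> is the combination of its values with
  coefficients \<open>\<plusminus>(z\<^sub>i - 1)\<close>, hence the coboundaries correspond to the ideal.\<close>

lemma coboundary_symbol:
  assumes \<psi>: "\<psi> \<in> lin_maps (zg_ring (Suc m)) (koszul (Suc m) m) (cstar_mod (Suc m))" and z: "z \<in> torus (Suc m)"
  shows "top_symbol (Suc m) (compose (carrier (koszul (Suc m) (Suc m))) \<psi> (koszul_diff (Suc m) m)) z =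
    (\<Sum>i<Suc m. (z i - 1) * ((-1) ^ i * fourier (Suc m) (\<psi> (koszul_unit (Suc m) m ({..<Suc m} - {i}))) z))"
proof -
  let ?n = "Suc m" let ?d = "koszul_diff ?n m (koszul_top ?n)"
  have d: "?d \<in> carrier (koszul ?n m)" by (rule koszul_diff_closed [OF koszul_top_closed])
  have "top_symbol ?n (compose (carrier (koszul ?n ?n)) \<psi> (koszul_diff ?n m)) z = fourier ?n (\<psi> ?d) z"
    by (simp add: top_symbol_def compose_eq koszul_top_closed)
  also have "\<dots> = (\<Sum>S\<in>koszul_basis ?n m. int_eval ?n (?d S) z * fourier ?n (\<psi> (koszul_unit ?n m S)) z)"
    by (rule lin_maps_fourier [OF \<psi> d z])
  also have "\<dots> = (\<Sum>i<?n. int_eval ?n (?d ({..<?n} - {i})) z * fourier ?n (\<psi> (koszul_unit ?n m ({..<?n} - {i}))) z)"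
    by (rule sum.reindex_bij_betw [OF koszul_basis_below_top, symmetric])
  also have "\<dots> = (\<Sum>i<?n. (z i - 1) * ((-1) ^ i * fourier ?n (\<psi> (koszul_unit ?n m ({..<?n} - {i}))) z))"
  proof (rule sum.cong [OF refl])
    fix i assume "i \<in> {..<?n}"
    then have "i < ?n" by simp
    from koszul_diff_top [OF this z]
    show "int_eval ?n (?d ({..<?n} - {i})) z * fourier ?n (\<psi> (koszul_unit ?n m ({..<?n} - {i}))) z =
        (z i - 1) * ((-1) ^ i * fourier ?n (\<psi> (koszul_unit ?n m ({..<?n} - {i}))) z)"
      by (simp only: ac_simps)
  qed
  finally show ?thesis .
qed

lemma coboundary_iff:
  assumes \<phi>: "\<phi> \<in> top_cochains (Suc m)"
  shows "\<phi> \<in> coboundaries (zg_ring (Suc m)) (koszul (Suc m)) (koszul_diff (Suc m)) (cstar_mod (Suc m)) (Suc m)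
    \<longleftrightarrow> top_symbol (Suc m) \<phi> \<in> torus_ideal (Suc m)"
proof
  let ?n = "Suc m"
  assume "\<phi> \<in> coboundaries (zg_ring ?n) (koszul ?n) (koszul_diff ?n) (cstar_mod ?n) ?n"
  then obtain \<psi> where \<psi>: "\<psi> \<in> lin_maps (zg_ring ?n) (koszul ?n m) (cstar_mod ?n)"
    and e: "\<phi> = compose (carrier (koszul ?n ?n)) \<psi> (koszul_diff ?n m)" by auto
  let ?f = "\<lambda>i. \<lambda>z\<in>torus ?n. (-1) ^ i * fourier ?n (\<psi> (koszul_unit ?n m ({..<?n} - {i}))) z"
  show "top_symbol ?n \<phi> \<in> torus_ideal ?n"
    unfolding torus_ideal_iff
  proof (intro conjI exI [of _ ?f] allI impI ballI)
    show "top_symbol ?n \<phi> \<in> carrier (CT ?n)" by (rule top_symbol_closed [OF \<phi>])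
    show "?f i \<in> carrier (CT ?n)" for i
      by (intro CT_restrict continuous_intros CT_continuous fourier_closed lin_mapsD(1) [OF \<psi>] koszul_unit_closed)
    show "top_symbol ?n \<phi> z = (\<Sum>i<?n. (z i - 1) * ?f i z)" if "z \<in> torus ?n" for z
      unfolding e coboundary_symbol [OF \<psi> that] using that by simp
  qed
next
  let ?n = "Suc m"
  assume "top_symbol ?n \<phi> \<in> torus_ideal ?n"
  then obtain f where f: "\<forall>i<?n. f i \<in> carrier (CT ?n)"
    "\<forall>z\<in>torus ?n. top_symbol ?n \<phi> z = (\<Sum>i<?n. (z i - 1) * f i z)"
    unfolding torus_ideal_iff by blast
  \<comment> \<open>\<open>r S\<close> is the index that is missing from \<open>S\<close>.  The signs in the differential are absorbed into the family.\<close>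
  define r where "r = inv_into {..<?n} (\<lambda>i. {..<?n} - {i})"
  have r: "r ({..<?n} - {i}) = i" if "i < ?n" for i
    unfolding r_def using that by (intro inv_into_f_f bij_betw_imp_inj_on [OF koszul_basis_below_top]) simp
  have r_lt: "r S < ?n" if "S \<in> koszul_basis ?n m" for S
    using that inv_into_into [of S "\<lambda>i. {..<?n} - {i}" "{..<?n}"] bij_betw_imp_surj_on [OF koszul_basis_below_top [of m]]
    unfolding r_def by simp
  let ?f = "\<lambda>S. \<lambda>z\<in>torus ?n. (-1) ^ r S * f (r S) z"
  have "?f S \<in> carrier (CT ?n)" if "S \<in> koszul_basis ?n m" for S
    using f(1) r_lt [OF that] by (intro CT_restrict continuous_intros CT_continuous) blast
  then obtain \<psi> where \<psi>: "\<psi> \<in> lin_maps (zg_ring ?n) (koszul ?n m) (cstar_mod ?n)"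
    and u: "\<And>S z. S \<in> koszul_basis ?n m \<Longrightarrow> z \<in> torus ?n \<Longrightarrow> fourier ?n (\<psi> (koszul_unit ?n m S)) z = ?f S z"
    by (rule lin_maps_exists [of ?n m ?f]) auto
  have "\<phi> = compose (carrier (koszul ?n ?n)) \<psi> (koszul_diff ?n m)"
  proof (rule top_symbol_inj [OF \<phi> coboundary_linear [OF \<psi>]])
    fix z assume z: "z \<in> torus ?n"
    have "(-1) ^ i * fourier ?n (\<psi> (koszul_unit ?n m ({..<?n} - {i}))) z = f i z" if i: "i < ?n" for i
    proof -
      have "{..<?n} - {i} \<in> koszul_basis ?n m" using bij_betwE [OF koszul_basis_below_top] i by blast
      from u [OF this z] have "fourier ?n (\<psi> (koszul_unit ?n m ({..<?n} - {i}))) z = (-1) ^ i * f i z"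
        unfolding r [OF i] using z by simp
      then show ?thesis by (simp add: mult.assoc [symmetric] power_mult_distrib [symmetric])
    qed
    then show "top_symbol ?n \<phi> z = top_symbol ?n (compose (carrier (koszul ?n ?n)) \<psi> (koszul_diff ?n m)) z"
      unfolding coboundary_symbol [OF \<psi> z] using f(2) z by (simp del: sum.lessThan_Suc)
  qed
  then show "\<phi> \<in> coboundaries (zg_ring ?n) (koszul ?n) (koszul_diff ?n) (cstar_mod ?n) ?n"
    using \<psi> by auto
qed

text \<open>\<open>H\<^sup>n(\<int>\<^sup>n, C\<^sup>*\<^sub>r\<^sub>e\<^sub>d(\<int>\<^sup>n))\<close> for \<open>n = m + 1\<close>: the identification is the isomorphism that the homomorphism theorem
  gives for \<open>\<phi> \<mapsto> \<phi>(1)\<close>.  In degree \<open>0\<close> the coboundaries are defined separately, whence the successor.\<close>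

theorem
  shows zn_cohomology_group: "Group.group (zn_cohomology (Suc m))"
    and zn_ident_iso: "zn_ident (Suc m) \<in> Group.iso (zn_cohomology (Suc m)) (add_monoid (torus_quotient (Suc m)))"
proof -
  let ?n = "Suc m"
  let ?\<theta> = "\<lambda>\<phi>. torus_class ?n (top_symbol ?n \<phi>)"
  interpret Q: ring "torus_quotient ?n" by (rule torus_quotient_ring)
  have m: "\<phi> \<otimes>\<^bsub>top_cocycles ?n\<^esub> \<psi> \<in> top_cochains ?n" if "\<phi> \<in> top_cochains ?n" "\<psi> \<in> top_cochains ?n" for \<phi> \<psi>
    unfolding top_cocycles_simps by (rule top_cochains_mult [OF that])
  have add: "?\<theta> (\<phi> \<otimes>\<^bsub>top_cocycles ?n\<^esub> \<psi>) = ?\<theta> \<phi> \<oplus>\<^bsub>torus_quotient ?n\<^esub> ?\<theta> \<psi>"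
    if c: "\<phi> \<in> top_cochains ?n" "\<psi> \<in> top_cochains ?n" for \<phi> \<psi>
  proof -
    have "top_symbol ?n (\<phi> \<otimes>\<^bsub>top_cocycles ?n\<^esub> \<psi>) = top_symbol ?n \<phi> \<oplus>\<^bsub>CT ?n\<^esub> top_symbol ?n \<psi>"
      by (intro CT_eqI [of _ ?n] CT_closed top_symbol_closed m c) (simp add: top_symbol_mult c CT_simps)
    then show ?thesis
      using ring_hom_add [OF torus_class_hom top_symbol_closed top_symbol_closed] c by simp
  qed
  interpret \<theta>: group_hom "top_cocycles ?n" "add_monoid (torus_quotient ?n)" ?\<theta>
  proof (intro group_hom.intro group_hom_axioms.intro top_cocycles_group Q.a_group homI)
    fix \<phi> assume "\<phi> \<in> carrier (top_cocycles ?n)"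
    then show "?\<theta> \<phi> \<in> carrier (add_monoid (torus_quotient ?n))"
      by (simp add: top_cocycles_carrier torus_class_surj top_symbol_closed)
  next
    fix \<phi> \<psi> assume "\<phi> \<in> carrier (top_cocycles ?n)" "\<psi> \<in> carrier (top_cocycles ?n)"
    then show "?\<theta> (\<phi> \<otimes>\<^bsub>top_cocycles ?n\<^esub> \<psi>) = ?\<theta> \<phi> \<otimes>\<^bsub>add_monoid (torus_quotient ?n)\<^esub> ?\<theta> \<psi>"
      using add by (simp add: top_cocycles_carrier)
  qed
  have surj: "?\<theta> ` carrier (top_cocycles ?n) = carrier (add_monoid (torus_quotient ?n))"
  proof -
    have "f \<in> top_symbol ?n ` top_cochains ?n \<longleftrightarrow> f \<in> carrier (CT ?n)" for f
      using top_symbol_closed top_symbol_surj by blast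
    then have "top_symbol ?n ` top_cochains ?n = carrier (CT ?n)" by blast
    then show ?thesis by (simp add: top_cocycles_carrier torus_class_surj image_image [symmetric])
  qed
  let ?B = "coboundaries (zg_ring ?n) (koszul ?n) (koszul_diff ?n) (cstar_mod ?n) ?n"
  have "?B \<subseteq> top_cochains ?n" using coboundary_linear by auto
  moreover have "?\<theta> \<phi> = \<zero>\<^bsub>torus_quotient ?n\<^esub> \<longleftrightarrow> \<phi> \<in> ?B" if "\<phi> \<in> top_cochains ?n" for \<phi>
    unfolding torus_class_zero_iff [OF top_symbol_closed [OF that]] by (rule coboundary_iff [OF that, symmetric])
  ultimately have k: "kernel (top_cocycles ?n) (add_monoid (torus_quotient ?n)) ?\<theta> = ?B"
    unfolding kernel_def top_cocycles_carrier monoid.simps by blast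
  then have H: "zn_cohomology ?n = top_cocycles ?n Mod kernel (top_cocycles ?n) (add_monoid (torus_quotient ?n)) ?\<theta>"
    by (simp only: zn_cohomology_def cohomology_def)
  show "Group.group (zn_cohomology ?n)"
    unfolding H by (rule normal.factorgroup_is_group [OF \<theta>.normal_kernel])
  have "zn_ident ?n = (\<lambda>X. the_elem (?\<theta> ` X))"
    by (simp add: zn_ident_def top_symbol_def fun_eq_iff)
  then show "zn_ident ?n \<in> Group.iso (zn_cohomology ?n) (add_monoid (torus_quotient ?n))"
    using \<theta>.FactGroup_iso_set [OF surj] unfolding H by simp
qed

section \<open>The embeddings\<close>

theorem theorem8:
  shows "\<exists>d :: nat \<Rightarrow> zn_cochain set \<Rightarrow> zn_cochain set. \<forall>n\<ge>1.
           d n \<in> complex_algebra_hom (zn_algebra n) (zn_algebra (Suc n)) \<and>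
           inj_on (d n) (carrier (zn_algebra n))"
proof -
  have "\<exists>h. h \<in> complex_algebra_hom (zn_algebra n) (zn_algebra (Suc n)) \<and> inj_on h (carrier (zn_algebra n))"
    if n: "n \<ge> 1" for n
  proof -
    obtain D where D: "D \<in> ring_hom (torus_quotient n) (torus_quotient (Suc n))"
        "inj_on D (carrier (torus_quotient n))"
        "\<forall>f\<in>carrier (CT n). D (torus_class n f) = torus_class (Suc n) (pullback n f)"
      by (rule torus_quotient_embedding)
    let ?H = "\<lambda>k. carrier (zn_cohomology k)" and ?Q = "\<lambda>k. carrier (torus_quotient k)"
    have iso: "zn_ident k \<in> Group.iso (zn_cohomology k) (add_monoid (torus_quotient k))" if "k \<ge> 1" for k
      using zn_ident_iso [of "k - 1"] that by simp
    have bij: "bij_betw (zn_ident k) (?H k) (?Q k)" if "k \<ge> 1" for k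
      using iso [OF that] by (simp add: iso_def)
    have idc: "zn_ident k x \<in> ?Q k" if "k \<ge> 1" "x \<in> ?H k" for k x
      using bij_betw_apply [OF bij] that by blast
    have invc: "zn_ident_inv k q \<in> ?H k" and id_inv: "zn_ident k (zn_ident_inv k q) = q"
      if "k \<ge> 1" "q \<in> ?Q k" for k q
      using bij_betw_inv_into_right [OF bij] bij_betw_apply [OF bij_betw_inv_into [OF bij]] that by blast+
    have inv_id: "zn_ident_inv k (zn_ident k x) = x" if "k \<ge> 1" "x \<in> ?H k" for k x
      using bij_betw_inv_into_left [OF bij] that by blast
    have add: "zn_ident k (x \<otimes>\<^bsub>zn_cohomology k\<^esub> y) = zn_ident k x \<oplus>\<^bsub>torus_quotient k\<^esub> zn_ident k y"
      if "k \<ge> 1" "x \<in> ?H k" "y \<in> ?H k" for k x y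
      using iso [OF that(1)] that by (simp add: iso_def hom_def)
    have addc: "x \<otimes>\<^bsub>zn_cohomology k\<^esub> y \<in> ?H k" if "k \<ge> 1" "x \<in> ?H k" "y \<in> ?H k" for k x y
      using monoid.m_closed [OF group.is_monoid [OF zn_cohomology_group [of "k - 1"]]] that by simp
    have S: "Suc n \<ge> 1" by simp
    note Dc = ring_hom_closed [OF D(1)]
    interpret Q: ring "torus_quotient n" by (rule torus_quotient_ring)
    \<comment> \<open>The embedding of the quotients, transported along the identifications.\<close>
    let ?h = "\<lambda>x. zn_ident_inv (Suc n) (D (zn_ident n x))"
    have hc: "?h x \<in> ?H (Suc n)" and id_h: "zn_ident (Suc n) (?h x) = D (zn_ident n x)" if "x \<in> ?H n" for x
      using invc [OF S Dc [OF idc [OF n that]]] id_inv [OF S Dc [OF idc [OF n that]]] .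
    have const: "torus_class k (\<lambda>z\<in>torus k. c) \<in> ?Q k" for k c
      unfolding torus_class_surj by (intro imageI CT_restrict continuous_on_const)
    have "?h \<in> complex_algebra_hom (zn_algebra n) (zn_algebra (Suc n))"
      unfolding complex_algebra_hom_def
    proof (intro CollectI conjI ring_hom_memI allI ballI)
      fix x assume "x \<in> carrier (zn_algebra n)"
      then have x: "x \<in> ?H n" by (simp add: zn_algebra_def)
      show "?h x \<in> carrier (zn_algebra (Suc n))" using hc [OF x] by (simp add: zn_algebra_def)
      show "?h (c \<odot>\<^bsub>zn_algebra n\<^esub> x) = c \<odot>\<^bsub>zn_algebra (Suc n)\<^esub> ?h x" for c
      proof -
        have "D (torus_class n (\<lambda>z\<in>torus n. c)) = torus_class (Suc n) (pullback n (\<lambda>z\<in>torus n. c))"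
          by (intro bspec [OF D(3)] CT_restrict continuous_on_const)
        also have "pullback n (\<lambda>z\<in>torus n. c) = (\<lambda>z\<in>torus (Suc n). c)"
          unfolding pullback_def by (rule restrict_ext) (simp add: torus_projection)
        finally have "D (torus_class n (\<lambda>z\<in>torus n. c)) = torus_class (Suc n) (\<lambda>z\<in>torus (Suc n). c)" .
        then show ?thesis
          using ring_hom_mult [OF D(1) const idc [OF n x]]
          by (simp add: zn_algebra_def id_inv [OF n] Q.m_closed [OF const idc [OF n x]] id_h [OF x])
      qed
      fix y assume "y \<in> carrier (zn_algebra n)"
      then have y: "y \<in> ?H n" by (simp add: zn_algebra_def)
      show "?h (x \<otimes>\<^bsub>zn_algebra n\<^esub> y) = ?h x \<otimes>\<^bsub>zn_algebra (Suc n)\<^esub> ?h y"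
        using ring_hom_mult [OF D(1) idc [OF n x] idc [OF n y]]
        by (simp add: zn_algebra_def id_inv [OF n] Q.m_closed [OF idc [OF n x] idc [OF n y]] id_h [OF x] id_h [OF y])
      have "?h (x \<otimes>\<^bsub>zn_cohomology n\<^esub> y) = zn_ident_inv (Suc n) (zn_ident (Suc n) (?h x \<otimes>\<^bsub>zn_cohomology (Suc n)\<^esub> ?h y))"
        using ring_hom_add [OF D(1) idc [OF n x] idc [OF n y]]
        by (simp add: add [OF n x y] add [OF S hc [OF x] hc [OF y]] id_h [OF x] id_h [OF y])
      also have "\<dots> = ?h x \<otimes>\<^bsub>zn_cohomology (Suc n)\<^esub> ?h y"
        by (rule inv_id [OF S addc [OF S hc [OF x] hc [OF y]]])
      finally show "?h (x \<oplus>\<^bsub>zn_algebra n\<^esub> y) = ?h x \<oplus>\<^bsub>zn_algebra (Suc n)\<^esub> ?h y"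
        by (simp add: zn_algebra_def)
    next
      show "?h \<one>\<^bsub>zn_algebra n\<^esub> = \<one>\<^bsub>zn_algebra (Suc n)\<^esub>"
        using ring_hom_one [OF D(1)] by (simp add: zn_algebra_def id_inv [OF n Q.one_closed])
    qed
    moreover have "inj_on ?h (carrier (zn_algebra n))"
    proof (rule inj_onI)
      fix x y assume "x \<in> carrier (zn_algebra n)" "y \<in> carrier (zn_algebra n)" and e: "?h x = ?h y"
      then have x: "x \<in> ?H n" and y: "y \<in> ?H n" by (simp_all add: zn_algebra_def)
      have "D (zn_ident n x) = D (zn_ident n y)"
        using arg_cong [OF e, of "zn_ident (Suc n)"] unfolding id_h [OF x] id_h [OF y] .
      then have "zn_ident n x = zn_ident n y" by (rule inj_onD [OF D(2) _ idc [OF n x] idc [OF n y]])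
      then have "zn_ident_inv n (zn_ident n x) = zn_ident_inv n (zn_ident n y)" by (rule arg_cong)
      then show "x = y" unfolding inv_id [OF n x] inv_id [OF n y] .
    qed
    ultimately show ?thesis by blast
  qed
  then have "\<forall>n. \<exists>h. n \<ge> 1 \<longrightarrow> h \<in> complex_algebra_hom (zn_algebra n) (zn_algebra (Suc n)) \<and>
      inj_on h (carrier (zn_algebra n))" by blast
  from choice [OF this] show ?thesis by blast
qed

end
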